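(* Let $G$ be a discrete group acting properly on a space with walls $(Y,\mathcal H)$ with set of walls $W$. Let $X$ be the cube complex associated to $(Y,\mathcal H)$ (defined in the context). Then $X$ is a CAT(0) cube complex, the formula $(g\sigma)(\overline h)=g\big(\sigma(g^{-1}\overline h)\big)$ defines an action of $G$ on $X$ by cellular isometries, and this action is proper. Moreover, if $I(W)$ is finite then $\dim X=I(W)$.
   Context: A space with walls is a set $Y$ together with a non-empty collection $\mathcal H\subset\mathcal P(Y)$ of non-empty subsets (half-spaces) such that $h\in\mathcal H$ implies $h^c=Y\setminus h\in\mathcal H$, and such that for any $p,q\in Y$ only finitely many $h\in\mathcal H$ satisfy $p\in h$, $q\in h^c$ (such $h$ separates $p$ from $q$). Walls are pairs $\overline h=\{h,h^c\}$, $W=\mathcal H/\ast$. Two walls $\{h,h^c\},\{k,k^c\}$ cross if $h\cap k$, $h\cap k^c$, $h^c\cap k$, $h^c\cap k^c$ are all non-empty; $I(W)$ is the supremum of the sizes of families of pairwise crossing walls. Pseudo-metric: $d(p,q)=$ number of walls separating $p$ and $q$. $G$ acts on the space with walls if it acts on $Y$ with $g(\mathcal H)=\mathcal H$; the action is proper if $d(g_np,p)\to\infty$ for every $p\in Y$ and every sequence $g_n$ leaving every finite subset of $G$. An admissible section is a map $\sigma:W\to\mathcal H$ with $\sigma(\overline h)\in\overline h$ for all $\overline h$ and $\sigma(\overline h)\not\subseteq\sigma(\overline k)^c$ for all $\overline h,\overline k\in W$. Let $\Gamma$ be the graph whose vertices are admissible sections, two joined by an edge iff they differ on exactly one wall (the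 edge is labelled by that wall). For $p\in Y$, $\sigma_p(\overline h)$ is the element of $\{h,h^c\}$ containing $p$; $\Gamma_p$ is the connected component of $\Gamma$ containing $\sigma_p$ (it is independent of $p$). A $k$-corner is a vertex $\sigma$ of $\Gamma_p$ together with $k$ edges at $\sigma$ whose labelling walls pairwise cross; each $k$-corner lies in a unique subgraph of $\Gamma_p$ isomorphic to the 1-skeleton of a $k$-cube. The cube complex $X$ is obtained from $X^1=\Gamma_p$ by attaching, for each $k$-corner ($k\ge2$), a Euclidean unit $k$-cube along the corresponding subgraph isomorphic to the 1-skeleton of a $k$-cube. *)

theory Defs
  imports "HOL-Analysis.Analysis" "HOL-Algebra.Group_Action" "HOL-Library.Extended_Nat"
begin

definition space_with_walls :: "'a set \<Rightarrow> 'a set set \<Rightarrow> bool" where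
  "space_with_walls Y H \<longleftrightarrow>
     H \<noteq> {} \<and> H \<subseteq> Pow Y \<and> (\<forall>h\<in>H. h \<noteq> {}) \<and> (\<forall>h\<in>H. Y - h \<in> H) \<and>
     (\<forall>p\<in>Y. \<forall>q\<in>Y. finite {h\<in>H. p \<in> h \<and> q \<notin> h})"

definition wall_of :: "'a set \<Rightarrow> 'a set \<Rightarrow> 'a set set" where
  "wall_of Y h = {h, Y - h}"

definition walls :: "'a set \<Rightarrow> 'a set set \<Rightarrow> 'a set set set" where
  "walls Y H = wall_of Y ` H"

definition crosses :: "'a set set \<Rightarrow> 'a set set \<Rightarrow> bool" where
  "crosses w1 w2 \<longleftrightarrow> (\<forall>h\<in>w1. \<forall>k\<in>w2. h \<inter> k \<noteq> {})"

definition pairwise_crossing :: "'a set set set \<Rightarrow> bool" where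
  "pairwise_crossing F \<longleftrightarrow> (\<forall>w1\<in>F. \<forall>w2\<in>F. w1 \<noteq> w2 \<longrightarrow> crosses w1 w2)"

definition crossing_number :: "'a set \<Rightarrow> 'a set set \<Rightarrow> enat" where
  "crossing_number Y H =
     Sup {enat (card F) | F. F \<subseteq> walls Y H \<and> finite F \<and> pairwise_crossing F}"

definition wall_dist :: "'a set \<Rightarrow> 'a set set \<Rightarrow> 'a \<Rightarrow> 'a \<Rightarrow> nat" where
  "wall_dist Y H p q = card {w \<in> walls Y H. \<exists>h\<in>w. p \<in> h \<and> q \<notin> h}"

definition acts_on_walls ::
  "('g, 'm) monoid_scheme \<Rightarrow> 'a set \<Rightarrow> 'a set set \<Rightarrow> ('g \<Rightarrow> 'a \<Rightarrow> 'a) \<Rightarrow> bool" where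
  "acts_on_walls G Y H \<phi> \<longleftrightarrow> group_action G Y \<phi> \<and>
     (\<forall>g\<in>carrier G. (\<lambda>h. \<phi> g ` h) ` H = H)"

definition leaves_finite :: "('g, 'm) monoid_scheme \<Rightarrow> (nat \<Rightarrow> 'g) \<Rightarrow> bool" where
  "leaves_finite G gs \<longleftrightarrow>
     (\<forall>F. F \<subseteq> carrier G \<and> finite F \<longrightarrow> (\<forall>\<^sub>F n in sequentially. gs n \<notin> F))"

definition proper_on_walls ::
  "('g, 'm) monoid_scheme \<Rightarrow> 'a set \<Rightarrow> 'a set set \<Rightarrow> ('g \<Rightarrow> 'a \<Rightarrow> 'a) \<Rightarrow> bool" where
  "proper_on_walls G Y H \<phi> \<longleftrightarrow>
     (\<forall>p\<in>Y. \<forall>gs. (\<forall>n. gs n \<in> carrier G) \<and> leaves_finite G gs \<longrightarrow>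
        filterlim (\<lambda>n. wall_dist Y H (\<phi> (gs n) p) p) at_top sequentially)"

definition proper_on_metric ::
  "('g, 'm) monoid_scheme \<Rightarrow> 'p set \<Rightarrow> ('p \<Rightarrow> 'p \<Rightarrow> real) \<Rightarrow> ('g \<Rightarrow> 'p \<Rightarrow> 'p) \<Rightarrow> bool" where
  "proper_on_metric G M d \<psi> \<longleftrightarrow>
     (\<forall>x\<in>M. \<forall>gs. (\<forall>n. gs n \<in> carrier G) \<and> leaves_finite G gs \<longrightarrow>
        filterlim (\<lambda>n. d (\<psi> (gs n) x) x) at_top sequentially)"

definition admissible :: "'a set \<Rightarrow> 'a set set \<Rightarrow> ('a set set \<Rightarrow> 'a set) \<Rightarrow> bool" where
  "admissible Y H \<sigma> \<longleftrightarrow> \<sigma> \<in> extensional (walls Y H) \<and>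
     (\<forall>w\<in>walls Y H. \<sigma> w \<in> w) \<and>
     (\<forall>w\<in>walls Y H. \<forall>k\<in>walls Y H. \<not> (\<sigma> w \<subseteq> Y - \<sigma> k))"

definition point_section :: "'a set \<Rightarrow> 'a set set \<Rightarrow> 'a \<Rightarrow> 'a set set \<Rightarrow> 'a set" where
  "point_section Y H p = (\<lambda>w\<in>walls Y H. THE h. h \<in> w \<and> p \<in> h)"

definition gamma_edge :: "'a set \<Rightarrow> 'a set set \<Rightarrow> ('a set set \<Rightarrow> 'a set) \<Rightarrow> ('a set set \<Rightarrow> 'a set) \<Rightarrow> bool" where
  "gamma_edge Y H \<sigma> \<tau> \<longleftrightarrow> admissible Y H \<sigma> \<and> admissible Y H \<tau> \<and>
     card {w \<in> walls Y H. \<sigma> w \<noteq> \<tau> w} = 1"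

definition gamma_vertices :: "'a set \<Rightarrow> 'a set set \<Rightarrow> 'a \<Rightarrow> ('a set set \<Rightarrow> 'a set) set" where
  "gamma_vertices Y H p = {\<tau>. (gamma_edge Y H)\<^sup>*\<^sup>* (point_section Y H p) \<tau>}"

definition flip :: "'a set \<Rightarrow> ('a set set \<Rightarrow> 'a set) \<Rightarrow> 'a set set \<Rightarrow> ('a set set \<Rightarrow> 'a set)" where
  "flip Y \<sigma> w = \<sigma>(w := Y - \<sigma> w)"

text \<open>A corner: a vertex \<sigma> of \<Gamma>_p together with a finite set C of pairwise crossing walls,
  each labelling an edge at \<sigma> (k = card C; k = 0 gives vertices, k = 1 edges).\<close>
definition corner :: "'a set \<Rightarrow> 'a set set \<Rightarrow> 'a \<Rightarrow> ('a set set \<Rightarrow> 'a set) \<Rightarrow> 'a set set set \<Rightarrow> bool" where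
  "corner Y H p \<sigma> C \<longleftrightarrow> \<sigma> \<in> gamma_vertices Y H p \<and> finite C \<and> C \<subseteq> walls Y H \<and>
     pairwise_crossing C \<and> (\<forall>w\<in>C. gamma_edge Y H \<sigma> (flip Y \<sigma> w))"

text \<open>Points of X are realised as weight functions on half-spaces: f h \<in> [0,1],
  f h + f (Y - h) = 1. The vertex \<sigma> is the function that is 1 on the half-spaces
  chosen by \<sigma>. The cube attached at a corner (\<sigma>, C) consists of the points agreeing with
  \<sigma> on all walls outside C; its coordinates are (f (\<sigma> w))_{w \<in> C} \<in> [0,1]^C.\<close>
type_synonym 'a xpoint = "'a set \<Rightarrow> real"

definition weight_fun :: "'a set \<Rightarrow> 'a set set \<Rightarrow> 'a xpoint \<Rightarrow> bool" where
  "weight_fun Y H f \<longleftrightarrow> f \<in> extensional H \<and> (\<forall>h\<in>H. 0 \<le> f h \<and> f h \<le> 1 \<and> f h + f (Y - h) = 1)"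

definition vertex_point :: "'a set \<Rightarrow> 'a set set \<Rightarrow> ('a set set \<Rightarrow> 'a set) \<Rightarrow> 'a xpoint" where
  "vertex_point Y H \<sigma> = (\<lambda>h\<in>H. if \<sigma> (wall_of Y h) = h then 1 else 0)"

definition cube_set :: "'a set \<Rightarrow> 'a set set \<Rightarrow> ('a set set \<Rightarrow> 'a set) \<Rightarrow> 'a set set set \<Rightarrow> 'a xpoint set" where
  "cube_set Y H \<sigma> C = {f. weight_fun Y H f \<and> (\<forall>w \<in> walls Y H - C. f (\<sigma> w) = 1)}"

definition cubes :: "'a set \<Rightarrow> 'a set set \<Rightarrow> 'a \<Rightarrow> 'a xpoint set set" where
  "cubes Y H p = {cube_set Y H \<sigma> C | \<sigma> C. corner Y H p \<sigma> C}"

definition cplx :: "'a set \<Rightarrow> 'a set set \<Rightarrow> 'a \<Rightarrow> 'a xpoint set" where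
  "cplx Y H p = \<Union> (cubes Y H p)"

text \<open>Euclidean distance inside a common cube: the l2 distance of the cube coordinates
  (each wall contributes both of its half-spaces, hence the factor 1/2).\<close>
definition cube_dist :: "'a set set \<Rightarrow> 'a xpoint \<Rightarrow> 'a xpoint \<Rightarrow> real" where
  "cube_dist H f g = sqrt (1/2 * (\<Sum>h\<in>{h\<in>H. f h \<noteq> g h}. (f h - g h)^2))"

definition cplx_dist :: "'a set \<Rightarrow> 'a set set \<Rightarrow> 'a \<Rightarrow> 'a xpoint \<Rightarrow> 'a xpoint \<Rightarrow> real" where
  "cplx_dist Y H p f g =
    (if f \<in> cplx Y H p \<and> g \<in> cplx Y H p then
       Inf {(\<Sum>i<n. cube_dist H (xs i) (xs (Suc i))) | n xs.
              xs 0 = f \<and> xs n = g \<and>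
              (\<forall>i<n. \<exists>Q\<in>cubes Y H p. xs i \<in> Q \<and> xs (Suc i) \<in> Q)}
     else 0)"

definition cplx_dim :: "'a set \<Rightarrow> 'a set set \<Rightarrow> 'a \<Rightarrow> enat" where
  "cplx_dim Y H p = Sup {enat (card C) | \<sigma> C. corner Y H p \<sigma> C}"

definition geodesic_segment ::
  "'p set \<Rightarrow> ('p \<Rightarrow> 'p \<Rightarrow> real) \<Rightarrow> (real \<Rightarrow> 'p) \<Rightarrow> 'p \<Rightarrow> 'p \<Rightarrow> bool" where
  "geodesic_segment M d \<gamma> x y \<longleftrightarrow> \<gamma> 0 = x \<and> \<gamma> (d x y) = y \<and> \<gamma> ` {0..d x y} \<subseteq> M \<and>
     (\<forall>s\<in>{0..d x y}. \<forall>t\<in>{0..d x y}. d (\<gamma> s) (\<gamma> t) = \<bar>s - t\<bar>)"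

definition geodesic_space :: "'p set \<Rightarrow> ('p \<Rightarrow> 'p \<Rightarrow> real) \<Rightarrow> bool" where
  "geodesic_space M d \<longleftrightarrow> (\<forall>x\<in>M. \<forall>y\<in>M. \<exists>\<gamma>. geodesic_segment M d \<gamma> x y)"

definition cmp_point :: "complex \<Rightarrow> complex \<Rightarrow> real \<Rightarrow> real \<Rightarrow> complex" where
  "cmp_point u v l s = u + complex_of_real (s / l) * (v - u)"

definition CAT0 :: "'p set \<Rightarrow> ('p \<Rightarrow> 'p \<Rightarrow> real) \<Rightarrow> bool" where
  "CAT0 M d \<longleftrightarrow> Metric_space M d \<and> geodesic_space M d \<and>
    (\<forall>x\<in>M. \<forall>y\<in>M. \<forall>z\<in>M. \<forall>\<gamma>1 \<gamma>2 \<gamma>3 a b c.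
       geodesic_segment M d \<gamma>1 x y \<and> geodesic_segment M d \<gamma>2 y z \<and> geodesic_segment M d \<gamma>3 z x \<and>
       dist a b = d x y \<and> dist b c = d y z \<and> dist c a = d z x \<longrightarrow>
       (\<forall>(\<gamma>, u, v, l) \<in> {(\<gamma>1, a, b, d x y), (\<gamma>2, b, c, d y z), (\<gamma>3, c, a, d z x)}.
        \<forall>(\<gamma>', u', v', l') \<in> {(\<gamma>1, a, b, d x y), (\<gamma>2, b, c, d y z), (\<gamma>3, c, a, d z x)}.
        \<forall>s\<in>{0..l}. \<forall>t\<in>{0..l'}.
          d (\<gamma> s) (\<gamma>' t) \<le> dist (cmp_point u v l s) (cmp_point u' v' l' t)))"

definition section_action ::
  "('g, 'm) monoid_scheme \<Rightarrow> 'a set \<Rightarrow> 'a set set \<Rightarrow> ('g \<Rightarrow> 'a \<Rightarrow> 'a) \<Rightarrow> 'g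
     \<Rightarrow> ('a set set \<Rightarrow> 'a set) \<Rightarrow> ('a set set \<Rightarrow> 'a set)" where
  "section_action G Y H \<phi> g \<sigma> =
     (\<lambda>w\<in>walls Y H. \<phi> g ` \<sigma> ((\<lambda>h. \<phi> (inv\<^bsub>G\<^esub> g) ` h) ` w))"

text \<open>Its affine (cellular) extension to the points of X.\<close>
definition cplx_action ::
  "('g, 'm) monoid_scheme \<Rightarrow> 'a set \<Rightarrow> 'a set set \<Rightarrow> ('g \<Rightarrow> 'a \<Rightarrow> 'a) \<Rightarrow> 'g
     \<Rightarrow> 'a xpoint \<Rightarrow> 'a xpoint" where
  "cplx_action G Y H \<phi> g f = (\<lambda>h\<in>H. f (\<phi> (inv\<^bsub>G\<^esub> g) ` h))"

end

(* The half-spaces avoiding the base point p form an event structure, and in the coordinates given by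
   their weights the complex X consists of the finitely supported [0,1]-valued functions that respect
   causality and conflict; two points share a cube iff their midpoint is again in X.

   CAT(0) is equivalent to: for all x, y and t there is a point m with
   d(z,m)^2 <= (1-t) d(z,x)^2 + t d(z,y)^2 - t(1-t) d(x,y)^2 for every z.  This inequality survives
   gluing along a convex intersection (Reshetnyak), which is proved by unfolding geodesics in the plane.
   A finite part of X is built by adding the events one at a time, causes first: adding h glues the
   product of [0,1] with a subcomplex, the link of h, onto what is already there.  The link is convex
   since it is the image of a 1-Lipschitz retraction.  The point m is unique, so the finite parts
   determine it for all of X. *)

theory Submission
  imports Defs
begin

section \<open>Comparison geometry in inner product spaces\<close>

text \<open>\<open>X\<close> may contain cubes of unbounded dimension and need not be complete, so a
  local criterion followed by a local-to-global theorem is avoided. The Stewart inequality suits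
  gluing because it speaks of distances only: one point \<open>m\<close> is asked for, and every
  \<open>z\<close> is a separate test. Its uniqueness does much of the later work: a 1-Lipschitz
  retraction must fix \<open>m\<close>, which makes the link convex; every geodesic must run through
  such points; different finite parts must agree on \<open>m\<close>.

  The distance is an infimum over chains and might drop when more of \<open>X\<close> becomes
  available. It does not, because deleting the coordinates outside a set closed under causes keeps
  steps inside cubes and lengthens none; so one metric serves all stages. Gluing needs distances
  that split exactly at the link; compactness of the finite part turns approximate splitting points
  into an exact one.

  Midpoints encode cubes since a midpoint is positive where either end is and is 1 only where both
  are. Restrictions, the retraction and the group action commute with midpoints, so they respect
  cubes without mention of corners.\<close>

lemma stewart_identity:
  fixes a b z :: "'v::real_inner"
  shows "(dist z ((1 - t) *\<^sub>R a + t *\<^sub>R b))\<^sup>2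
    = (1 - t) * (dist z a)\<^sup>2 + t * (dist z b)\<^sup>2 - t * (1 - t) * (dist a b)\<^sup>2"
  unfolding dist_norm power2_norm_eq_inner
  by (simp add: inner_diff_left inner_diff_right inner_add_left inner_add_right
      inner_commute[of b a] inner_commute[of a z] inner_commute[of b z] algebra_simps)

text \<open>The first variation in algebraic form: a quantity minimal at \<open>\<tau> = 0\<close>
  and known up to a quadratic error has nonnegative one-sided derivative.\<close>

lemma nonneg_linear_term:
  fixes X Y :: real
  assumes "\<And>\<tau>. 0 < \<tau> \<Longrightarrow> \<tau> \<le> 1 \<Longrightarrow> 0 \<le> \<tau> * X + \<tau>\<^sup>2 * Y"
  shows "0 \<le> X"
proof (rule ccontr)
  assume "\<not> 0 \<le> X"
  \<comment> \<open>Chosen so that \<open>\<tau> * \<bar>Y\<bar>\<close> is at most half of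
    \<open>- X\<close>; the summand 1 guards against \<open>Y = 0\<close>.\<close>
  define \<tau> where "\<tau> = min 1 (- X / (2 * (\<bar>Y\<bar> + 1)))"
  have \<tau>: "0 < \<tau>" "\<tau> \<le> 1" "\<tau> * (2 * (\<bar>Y\<bar> + 1)) \<le> - X"
  proof -
    have "0 < - X / (2 * (\<bar>Y\<bar> + 1))"
      using \<open>\<not> 0 \<le> X\<close> by (intro divide_pos_pos) auto
    thus "0 < \<tau>" "\<tau> \<le> 1" by (auto simp: \<tau>_def)
    have "\<tau> \<le> - X / (2 * (\<bar>Y\<bar> + 1))" by (simp add: \<tau>_def)
    moreover have "0 < 2 * (\<bar>Y\<bar> + 1)" by simp
    ultimately show "\<tau> * (2 * (\<bar>Y\<bar> + 1)) \<le> - X"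
      by (simp only: pos_le_divide_eq)
  qed
  have "\<tau> * Y \<le> \<tau> * (\<bar>Y\<bar> + 1)"
    using \<tau> by (intro mult_left_mono) auto
  hence "X + \<tau> * Y < 0"
    using \<tau> \<open>\<not> 0 \<le> X\<close> by (simp add: algebra_simps)
  hence "\<tau> * (X + \<tau> * Y) < 0"
    using \<tau>(1) by (simp add: mult_pos_neg)
  moreover have "\<tau> * (X + \<tau> * Y) = \<tau> * X + \<tau>\<^sup>2 * Y"
    by (simp add: algebra_simps power2_eq_square)
  ultimately show False
    using assms[OF \<tau>(1,2)] by simp
qed

text \<open>The square root lies below its tangent at \<open>a\<^sup>2\<close>.\<close>

lemma le_first_order_sqrt:
  fixes a q y :: real
  assumes "0 < a" "0 \<le> y" "y\<^sup>2 \<le> a\<^sup>2 + q"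
  shows "y \<le> a + q / (2 * a)"
proof -
  have "0 \<le> (y - a)\<^sup>2" by simp
  hence "2 * a * y \<le> 2 * a\<^sup>2 + q"
    using assms(3) by (simp add: power2_eq_square algebra_simps)
  thus ?thesis
    using assms(1) by (simp add: field_simps power2_eq_square)
qed

text \<open>The plane figure behind gluing: the triangles \<open>P R W\<close> and
  \<open>Q R W\<close> share the side \<open>R W\<close>, and a path from \<open>P\<close> to a
  point \<open>M\<close> of \<open>R Q\<close> has to pass through that side. The shortest such path
  is compared with the triangle whose third side has the length of the broken line
  \<open>P W Q\<close>. The points may lie in any position, even with \<open>P\<close> and
  \<open>Q\<close> on one side of \<open>R W\<close>.\<close>

lemma bent_path_stewart:
  fixes P Q R W :: "'v::real_inner"
  assumes t: "0 \<le> t" "t \<le> 1"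
  defines "M \<equiv> (1 - t) *\<^sub>R R + t *\<^sub>R Q"
  shows "\<exists>k\<in>closed_segment R W. (dist P k + dist k M)\<^sup>2
    \<le> (1 - t) * (dist P R)\<^sup>2 + t * (dist P W + dist W Q)\<^sup>2 - t * (1 - t) * (dist R Q)\<^sup>2"
proof -
  have "continuous_on (closed_segment R W) (\<lambda>k. dist P k + dist k M)"
    by (intro continuous_intros)
  then obtain k where k: "k \<in> closed_segment R W"
    and min: "\<And>k'. k' \<in> closed_segment R W \<Longrightarrow> dist P k + dist k M \<le> dist P k' + dist k' M"
    using continuous_attains_inf[OF compact_segment, of R W "\<lambda>k. dist P k + dist k M"]
    by auto
  define a b where "a = dist P k" and "b = dist k M"
  have nonneg: "0 \<le> a" "0 \<le> b" by (simp_all add: a_def b_def)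
  text \<open>Unfolding the bent path \<open>P, k, M\<close> at \<open>k\<close> to a straight one moves \<open>P\<close> to a point \<open>P'\<close>
    which, by minimality of \<open>k\<close>, is no farther from either end of the segment.\<close>
  obtain P' where P': "dist P' R \<le> dist P R" "dist P' W \<le> dist P W" "dist P' M = a + b"
  proof (cases "a = 0 \<or> b = 0")
    case True
    hence "dist P M = a + b"
      by (auto simp: a_def b_def)
    thus thesis using that[of P] by simp
  next
    case False
    hence pos: "0 < a" "0 < b" using nonneg by auto
    define e where "e = (1 / b) *\<^sub>R (M - k)"
    have ne: "norm e = 1"
      using pos by (simp add: e_def b_def dist_norm norm_minus_commute)
    have Me: "M - k = b *\<^sub>R e"
      using pos by (simp add: e_def)
    define P' where "P' = k - a *\<^sub>R e"
    \<comment> \<open>First variation of the path length at its minimum \<open>k\<close>, moved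
      towards an arbitrary \<open>x\<close> of the segment.\<close>
    have closer: "dist P' x \<le> dist P x" if x: "x \<in> closed_segment R W" for x
    proof -
      have "0 \<le> \<tau> * ((k - P) \<bullet> (x - k) / a + (k - M) \<bullet> (x - k) / b)
                 + \<tau>\<^sup>2 * ((norm (x - k))\<^sup>2 * (1 / (2 * a) + 1 / (2 * b)))"
        if \<tau>: "0 < \<tau>" "\<tau> \<le> 1" for \<tau>
      proof -
        define k' where "k' = k + \<tau> *\<^sub>R (x - k)"
        have "k' = (1 - \<tau>) *\<^sub>R k + \<tau> *\<^sub>R x"
          by (simp add: k'_def algebra_simps)
        hence "k' \<in> closed_segment R W"
          using \<tau> k x by (auto intro!: convexD convex_closed_segment)
        hence "a + b \<le> dist P k' + dist k' M"
          using min by (simp add: a_def b_def)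
        moreover have "dist P k' \<le> a + (2 * \<tau> * ((k - P) \<bullet> (x - k)) + \<tau>\<^sup>2 * (norm (x - k))\<^sup>2) / (2 * a)"
          by (rule le_first_order_sqrt[OF pos(1)])
            (simp, simp add: a_def k'_def dist_norm power2_norm_eq_inner inner_simps
              inner_commute power2_eq_square[of \<tau>] algebra_simps)
        moreover have "dist k' M \<le> b + (2 * \<tau> * ((k - M) \<bullet> (x - k)) + \<tau>\<^sup>2 * (norm (x - k))\<^sup>2) / (2 * b)"
          by (rule le_first_order_sqrt[OF pos(2)])
            (simp, simp add: b_def k'_def dist_norm power2_norm_eq_inner inner_simps
              inner_commute power2_eq_square[of \<tau>] algebra_simps)
        ultimately have "0 \<le> (2 * \<tau> * ((k - P) \<bullet> (x - k)) + \<tau>\<^sup>2 * (norm (x - k))\<^sup>2) / (2 * a)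
            + (2 * \<tau> * ((k - M) \<bullet> (x - k)) + \<tau>\<^sup>2 * (norm (x - k))\<^sup>2) / (2 * b)"
          by linarith
        also have "\<dots> = \<tau> * ((k - P) \<bullet> (x - k) / a + (k - M) \<bullet> (x - k) / b)
                 + \<tau>\<^sup>2 * ((norm (x - k))\<^sup>2 * (1 / (2 * a) + 1 / (2 * b)))"
          using pos by (simp add: field_simps)
        finally show ?thesis .
      qed
      hence "0 \<le> (k - P) \<bullet> (x - k) / a + (k - M) \<bullet> (x - k) / b"
        by (rule nonneg_linear_term)
      moreover have "(k - M) \<bullet> (x - k) = - b * (e \<bullet> (x - k))"
        using arg_cong[OF Me, of uminus] by (metis inner_minus_left inner_scaleR_left minus_diff_eq mult_minus_left)
      ultimately have "e \<bullet> (x - k) \<le> (k - P) \<bullet> (x - k) / a"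
        using pos by simp
      hence 1: "a * (e \<bullet> (x - k)) \<le> (k - P) \<bullet> (x - k)"
        using pos by (simp add: field_simps)
      \<comment> \<open>\<open>P\<close> and \<open>P'\<close> are both at distance \<open>a\<close>
        from \<open>k\<close>, so their distances to \<open>x\<close> differ only through an inner
        product with \<open>x - k\<close>.\<close>
      have "(dist P' x)\<^sup>2 = a\<^sup>2 * (e \<bullet> e) + 2 * (a * (e \<bullet> (x - k))) + (norm (x - k))\<^sup>2"
        by (simp add: P'_def dist_norm power2_norm_eq_inner inner_simps algebra_simps inner_commute power2_eq_square[of a])
      also have "e \<bullet> e = 1" using ne by (simp add: dot_square_norm)
      also have "a\<^sup>2 * 1 + 2 * (a * (e \<bullet> (x - k))) + (norm (x - k))\<^sup>2
          \<le> a\<^sup>2 + 2 * ((k - P) \<bullet> (x - k)) + (norm (x - k))\<^sup>2"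
        using 1 by simp
      also have "\<dots> = (dist P x)\<^sup>2"
        by (simp add: a_def dist_norm power2_norm_eq_inner inner_simps algebra_simps inner_commute)
      finally show ?thesis by (simp add: power2_le_iff_abs_le)
    qed
    have "M - P' = (a + b) *\<^sub>R e"
      using Me by (simp add: P'_def algebra_simps)
    hence "dist P' M = a + b"
      using ne nonneg by (metis abs_of_nonneg add_nonneg_nonneg dist_norm mult.right_neutral norm_minus_commute norm_scaleR)
    show thesis by (rule that[of P']) (use closer \<open>dist P' M = a + b\<close> in auto)
  qed
  have "dist P' Q \<le> dist P W + dist W Q"
    using P'(2) dist_triangle[of P' Q W] by linarith
  hence "t * (dist P' Q)\<^sup>2 \<le> t * (dist P W + dist W Q)\<^sup>2"
    using t by (intro mult_left_mono power_mono) auto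
  moreover have "(1 - t) * (dist P' R)\<^sup>2 \<le> (1 - t) * (dist P R)\<^sup>2"
    using t P' by (intro mult_left_mono power_mono) auto
  moreover have "(a + b)\<^sup>2 = (1 - t) * (dist P' R)\<^sup>2 + t * (dist P' Q)\<^sup>2 - t * (1 - t) * (dist R Q)\<^sup>2"
    using stewart_identity[of P' t R Q] P'(3) by (simp add: M_def)
  ultimately show ?thesis
    using k by (auto simp: a_def b_def intro!: bexI[of _ k])
qed

lemma comparison_point_exists:
  fixes g \<alpha> u :: real
  assumes "0 \<le> g" "0 \<le> \<alpha>" "0 \<le> u" "g \<le> \<alpha> + u" "\<alpha> \<le> g + u" "u \<le> g + \<alpha>"
  shows "\<exists>P::complex. dist P 0 = \<alpha> \<and> dist P (of_real g) = u"
proof (cases "g = 0")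
  case True
  thus ?thesis using assms by (intro exI[of _ "of_real \<alpha>"]) (auto simp: dist_norm)
next
  case False
  \<comment> \<open>First coordinate of the wanted point, from the difference of the two circle
    equations. The triangle inequalities give \<open>\<bar>x\<bar> \<le> \<alpha>\<close>, so a
    second coordinate exists.\<close>
  define x where "x = (\<alpha>\<^sup>2 + g\<^sup>2 - u\<^sup>2) / (2 * g)"
  have xg: "2 * g * x = \<alpha>\<^sup>2 + g\<^sup>2 - u\<^sup>2"
    using False by (simp add: x_def)
  have "u\<^sup>2 \<le> (g + \<alpha>)\<^sup>2" using assms by (intro power_mono) auto
  moreover have "(g - \<alpha>)\<^sup>2 \<le> u\<^sup>2" using assms by (intro power2_le_iff_abs_le[THEN iffD2]) auto
  ultimately have "2 * g * \<bar>x\<bar> \<le> 2 * g * \<alpha>"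
    using xg assms(1) by (cases "0 \<le> x") (auto simp: power2_eq_square algebra_simps)
  hence "\<bar>x\<bar> \<le> \<alpha>" using False assms(1) by simp
  hence x2: "x\<^sup>2 \<le> \<alpha>\<^sup>2" using assms(2) by (simp add: power2_le_iff_abs_le)
  have "cmod (Complex x (sqrt (\<alpha>\<^sup>2 - x\<^sup>2))) = \<alpha>"
    using x2 assms by (simp add: cmod_def)
  moreover have "cmod (Complex (x - g) (sqrt (\<alpha>\<^sup>2 - x\<^sup>2))) = u"
  proof -
    have "(x - g)\<^sup>2 + (\<alpha>\<^sup>2 - x\<^sup>2) = u\<^sup>2"
      using xg by (simp add: power2_eq_square algebra_simps)
    thus ?thesis using x2 assms by (simp add: cmod_def)
  qed
  moreover have "Complex x (sqrt (\<alpha>\<^sup>2 - x\<^sup>2)) - of_real g = Complex (x - g) (sqrt (\<alpha>\<^sup>2 - x\<^sup>2))"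
    by (simp add: complex_eq_iff)
  ultimately show ?thesis by (metis dist_norm diff_zero)
qed

section \<open>The Stewart inequality in metric spaces\<close>

text \<open>For \<open>t = 1/2\<close> this is the CN inequality of Bruhat and Tits. The test set
  \<open>Z\<close> is a separate argument so that the inequality can be spread from the points of
  one piece to those of another.\<close>

definition stewart :: "('p \<Rightarrow> 'p \<Rightarrow> real) \<Rightarrow> 'p set \<Rightarrow> 'p \<Rightarrow> 'p \<Rightarrow> real \<Rightarrow> 'p \<Rightarrow> bool" where
  "stewart d Z x y t m \<longleftrightarrow>
     (\<forall>z\<in>Z. (d z m)\<^sup>2 \<le> (1 - t) * (d z x)\<^sup>2 + t * (d z y)\<^sup>2 - t * (1 - t) * (d x y)\<^sup>2)"

definition stewart_space :: "'p set \<Rightarrow> ('p \<Rightarrow> 'p \<Rightarrow> real) \<Rightarrow> bool" where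
  "stewart_space S d \<longleftrightarrow> (\<forall>x\<in>S. \<forall>y\<in>S. \<forall>t\<in>{0..1}. \<exists>m\<in>S. stewart d S x y t m)"

lemma stewartD:
  "stewart d Z x y t m \<Longrightarrow> z \<in> Z \<Longrightarrow>
    (d z m)\<^sup>2 \<le> (1 - t) * (d z x)\<^sup>2 + t * (d z y)\<^sup>2 - t * (1 - t) * (d x y)\<^sup>2"
  by (simp add: stewart_def)

lemma stewart_mono: "stewart d Z x y t m \<Longrightarrow> Z' \<subseteq> Z \<Longrightarrow> stewart d Z' x y t m"
  by (auto simp: stewart_def)

lemma stewart_Un: "stewart d Z x y t m \<Longrightarrow> stewart d Z' x y t m \<Longrightarrow> stewart d (Z \<union> Z') x y t m"
  by (auto simp: stewart_def)

lemma stewart_spaceD: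
  assumes "stewart_space S d" "x \<in> S" "y \<in> S" "0 \<le> t" "t \<le> 1"
  obtains m where "m \<in> S" "stewart d S x y t m"
  using assms unfolding stewart_space_def by (meson atLeastAtMost_iff)

lemma mean_of_squares: "(1 - t) * (t * a)\<^sup>2 + t * ((1 - t) * a)\<^sup>2 - t * (1 - t) * a\<^sup>2 = (0::real)"
  by (simp add: power2_eq_square algebra_simps)

section \<open>Uniqueness of dividing points and comparison with plane triangles\<close>

context Metric_space
begin

lemma stewart_commute:
  assumes "stewart d Z x y t m"
  shows "stewart d Z y x (1 - t) m"
  using assms by (auto simp: stewart_def commute[of y x] algebra_simps)

lemma stewart_dist_left:
  assumes "stewart d Z x y t m" "x \<in> Z" "x \<in> M" "0 \<le> t"
  shows "d x m \<le> t * d x y"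
proof -
  have "(d x m)\<^sup>2 \<le> t * (d x y)\<^sup>2 - t * (1 - t) * (d x y)\<^sup>2"
    using stewartD[OF assms(1,2)] assms(3) by simp
  also have "\<dots> = (t * d x y)\<^sup>2" by (simp add: power2_eq_square algebra_simps)
  finally show ?thesis using assms(4) by (simp add: power2_le_iff_abs_le)
qed

lemma stewart_dist_right:
  assumes "stewart d Z x y t m" "y \<in> Z" "y \<in> M" "t \<le> 1"
  shows "d y m \<le> (1 - t) * d x y"
  using stewart_dist_left[OF stewart_commute[OF assms(1)] assms(2,3)] assms(4)
  by (simp add: commute)

text \<open>Testing \<open>m\<close> against \<open>m'\<close> leaves at most 0 on the right, by
  \<open>mean_of_squares\<close>. Upper bounds on the two distances suffice, which is what a
  1-Lipschitz map supplies.\<close>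

lemma stewart_unique:
  assumes m: "stewart d Z x y t m" and M: "m' \<in> Z" "m \<in> M" "m' \<in> M"
    and t: "0 \<le> t" "t \<le> 1"
    and le: "d x m' \<le> t * d x y" "d y m' \<le> (1 - t) * d x y"
  shows "m' = m"
proof -
  have "(1 - t) * (d m' x)\<^sup>2 + t * (d m' y)\<^sup>2
      \<le> (1 - t) * (t * d x y)\<^sup>2 + t * ((1 - t) * d x y)\<^sup>2"
    using t le by (intro add_mono mult_left_mono power_mono) (auto simp: commute)
  hence "(d m' m)\<^sup>2 \<le> 0"
    using stewartD[OF m M(1)] mean_of_squares[of t "d x y"] by linarith
  thus ?thesis using M by simp
qed

lemma comparison_triangle:
  assumes "x \<in> M" "y \<in> M" "z \<in> M"
  shows "\<exists>P::complex. dist P 0 = d z x \<and> dist P (of_real (d x y)) = d z y"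
  using assms triangle[of z x y] triangle[of x y z] triangle[of x z y]
  by (intro comparison_point_exists) (auto simp: commute add.commute)

text \<open>The point \<open>w\<close> divides the side \<open>p q\<close> of the triangle \<open>p q r\<close>; the inequality for the vertex
  \<open>p\<close> against the opposite side \<open>r q\<close> is obtained from the two triangles cut off by \<open>w r\<close>.\<close>
lemma stewart_across:
  assumes M: "p \<in> M" "q \<in> M" "r \<in> M" "w \<in> M" "m \<in> M"
    and w: "d p q = d p w + d w q"
    and k: "\<And>s. 0 \<le> s \<Longrightarrow> s \<le> 1 \<Longrightarrow> \<exists>k\<in>S. stewart d {p, q, r} r w s k"
    and m: "stewart d S r q t m" and SM: "S \<subseteq> M" and t: "0 \<le> t" "t \<le> 1"
  shows "stewart d {p} r q t m"
proof -
  obtain P :: complex where P: "dist P 0 = d p r" "dist P (of_real (d r w)) = d p w"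
    using comparison_triangle[of r w p] M by auto
  obtain Q :: complex where Q: "dist Q 0 = d q r" "dist Q (of_real (d r w)) = d q w"
    using comparison_triangle[of r w q] M by auto
  \<comment> \<open>Both comparison triangles stand on the base from 0 to \<open>W\<close>, which
    represents the side \<open>r w\<close>.\<close>
  define W :: complex where "W = of_real (d r w)"
  have eq: "cmod P = d p r" "cmod Q = d q r" "cmod W = d r w" "dist P W = d p w" "dist Q W = d q w"
    using P Q by (auto simp: W_def)
  obtain c where c: "c \<in> closed_segment 0 W"
    and cle: "(dist P c + dist c ((1 - t) *\<^sub>R 0 + t *\<^sub>R Q))\<^sup>2
      \<le> (1 - t) * (dist P 0)\<^sup>2 + t * (dist P W + dist W Q)\<^sup>2 - t * (1 - t) * (dist 0 Q)\<^sup>2"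
    using bent_path_stewart[OF t, of 0 W P Q] by auto
  obtain s where s: "0 \<le> s" "s \<le> 1" "c = (1 - s) *\<^sub>R 0 + s *\<^sub>R W"
    using c by (auto simp: closed_segment_def)
  \<comment> \<open>The point of \<open>r w\<close> that corresponds to the bend \<open>c\<close>.
    Its distances to \<open>p\<close>, \<open>q\<close> and \<open>r\<close> are at most those of
    \<open>c\<close> in the plane; for the distance to \<open>m\<close> the same follows by testing
    \<open>m\<close> against \<open>k\<close>.\<close>
  obtain k where kS: "k \<in> S" and k: "stewart d {p, q, r} r w s k"
    using k s by blast
  have kM: "k \<in> M" using kS SM by auto
  have pk: "d p k \<le> dist P c"
  proof (rule power2_le_imp_le)
    show "(d p k)\<^sup>2 \<le> (dist P c)\<^sup>2"
      using stewartD[OF k, of p] unfolding s(3) stewart_identity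
      by (simp add: eq del: scaleR_zero_right)
  qed simp
  have qk: "(d q k)\<^sup>2 \<le> (dist Q c)\<^sup>2"
    using stewartD[OF k, of q] unfolding s(3) stewart_identity
    by (simp add: eq del: scaleR_zero_right)
  have rk: "(d r k)\<^sup>2 \<le> (dist 0 c)\<^sup>2"
    using stewartD[OF k, of r] M unfolding s(3) stewart_identity
    by (simp add: eq del: scaleR_zero_right)
  have km: "d k m \<le> dist c ((1 - t) *\<^sub>R 0 + t *\<^sub>R Q)"
  proof (rule power2_le_imp_le)
    have "(1 - t) * (d k r)\<^sup>2 + t * (d k q)\<^sup>2 \<le> (1 - t) * (dist c 0)\<^sup>2 + t * (dist c Q)\<^sup>2"
      using t qk rk by (intro add_mono mult_left_mono) (auto simp: commute dist_commute)
    thus "(d k m)\<^sup>2 \<le> (dist c ((1 - t) *\<^sub>R 0 + t *\<^sub>R Q))\<^sup>2"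
      using stewartD[OF m kS] unfolding stewart_identity
      by (simp add: eq commute[of r q] del: scaleR_zero_right)
  qed simp
  have "d p m \<le> d p k + d k m" using M kM by (intro triangle)
  hence "(d p m)\<^sup>2 \<le> (dist P c + dist c ((1 - t) *\<^sub>R 0 + t *\<^sub>R Q))\<^sup>2"
    using pk km by (intro power_mono) auto
  also note cle
  also have "dist P W + dist W Q = d p q"
    using w by (simp add: eq dist_commute[of W Q] commute[of q w])
  finally show ?thesis
    by (simp add: stewart_def eq commute[of r q])
qed

text \<open>First variation: no shortcut between \<open>x\<close> and \<open>y\<close> near \<open>w\<close> in the direction of \<open>z\<close>.\<close>
lemma stewart_at_joint:
  assumes M: "x \<in> M" "y \<in> M" "z \<in> M" "w \<in> M"
    and w: "d x y = d x w + d w y"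
    and k: "\<And>s. 0 \<le> s \<Longrightarrow> s \<le> 1 \<Longrightarrow> \<exists>k\<in>M. stewart d {x, y} w z s k"
  shows "d x y * (d z w)\<^sup>2 \<le> d w y * (d z x)\<^sup>2 + d x w * (d z y)\<^sup>2 - d x w * d w y * d x y"
proof (cases "d x w = 0 \<or> d w y = 0")
  case True
  thus ?thesis using M w by (auto simp: commute)
next
  case False
  define u v r where "u = d x w" and "v = d w y" and "r = d z w"
  have pos: "0 < u" "0 < v" using False by (auto simp: u_def v_def less_le)
  \<comment> \<open>First-order coefficient in \<open>s\<close> of the upper bounds for
    \<open>d x k + d y k\<close>; a detour through \<open>k\<close> cannot be shorter than
    \<open>u + v\<close>.\<close>
  define X where "X = ((d z x)\<^sup>2 - r\<^sup>2 - u\<^sup>2) / (2 * u) + ((d z y)\<^sup>2 - r\<^sup>2 - v\<^sup>2) / (2 * v)"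
  have "0 \<le> X"
  proof (rule nonneg_linear_term)
    fix s :: real assume s: "0 < s" "s \<le> 1"
    then obtain k where kM: "k \<in> M" and k: "stewart d {x, y} w z s k"
      using k[of s] by (auto simp: less_imp_le)
    have "d x k \<le> u + (s * ((d z x)\<^sup>2 - r\<^sup>2 - u\<^sup>2) + s\<^sup>2 * r\<^sup>2) / (2 * u)"
      using stewartD[OF k, of x]
      by (intro le_first_order_sqrt pos)
        (auto simp: u_def r_def commute power2_eq_square algebra_simps)
    moreover have "d y k \<le> v + (s * ((d z y)\<^sup>2 - r\<^sup>2 - v\<^sup>2) + s\<^sup>2 * r\<^sup>2) / (2 * v)"
      using stewartD[OF k, of y]
      by (intro le_first_order_sqrt pos)
        (auto simp: v_def r_def commute power2_eq_square algebra_simps)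
    moreover have "u + v \<le> d x k + d y k"
      using triangle[of x k y] M kM w by (simp add: u_def v_def commute)
    ultimately have "0 \<le> (s * ((d z x)\<^sup>2 - r\<^sup>2 - u\<^sup>2) + s\<^sup>2 * r\<^sup>2) / (2 * u)
        + (s * ((d z y)\<^sup>2 - r\<^sup>2 - v\<^sup>2) + s\<^sup>2 * r\<^sup>2) / (2 * v)"
      by linarith
    also have "\<dots> = s * X + s\<^sup>2 * (r\<^sup>2 / (2 * u) + r\<^sup>2 / (2 * v))"
      using pos by (simp add: X_def field_simps power2_eq_square)
    finally show "0 \<le> s * X + s\<^sup>2 * (r\<^sup>2 / (2 * u) + r\<^sup>2 / (2 * v))" .
  qed
  hence "0 \<le> 2 * u * v * X" using pos by simp
  also have "\<dots> = v * (d z x)\<^sup>2 + u * (d z y)\<^sup>2 - u * v * (u + v) - (u + v) * r\<^sup>2"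
    using pos by (simp add: X_def field_simps power2_eq_square)
  finally show ?thesis using w by (simp add: u_def v_def r_def)
qed

text \<open>The point \<open>m\<close> divides the first piece \<open>x w\<close>. The inequality
  there involves the distance from \<open>z\<close> to \<open>w\<close>, which \<open>joint\<close>
  bounds in terms of \<open>x\<close> and \<open>y\<close>; the terms then combine exactly.\<close>

lemma stewart_concat:
  assumes M: "x \<in> M" "y \<in> M" "w \<in> M" "m \<in> M" "z \<in> M"
    and w: "d x y = d x w + d w y" "0 < d x w"
    and joint: "d x y * (d z w)\<^sup>2 \<le> d w y * (d z x)\<^sup>2 + d x w * (d z y)\<^sup>2 - d x w * d w y * d x y"
    and t: "0 \<le> t" "t * d x y \<le> d x w"
    and m: "stewart d {z} x w (t * d x y / d x w) m"
  shows "stewart d {z} x y t m"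
proof -
  define u v L where "u = d x w" and "v = d w y" and "L = d x y"
  have pos: "0 < u" "0 < L" "0 \<le> v" "L = u + v" using w by (auto simp: u_def L_def v_def intro: add_pos_nonneg)
  \<comment> \<open>The parameter on \<open>x w\<close> of the point at distance
    \<open>t * L\<close> from \<open>x\<close>.\<close>
  define s where "s = t * L / u"
  have s: "0 \<le> s" "s * u = t * L" using pos t by (auto simp: s_def)
  have "(d z m)\<^sup>2 \<le> (1 - s) * (d z x)\<^sup>2 + s * (d z w)\<^sup>2 - s * (1 - s) * u\<^sup>2"
    using stewartD[OF m, of z] by (simp add: s_def u_def L_def)
  also have "s * (d z w)\<^sup>2 \<le> s * ((v * (d z x)\<^sup>2 + u * (d z y)\<^sup>2) / L - u * v)"
    using joint pos s by (intro mult_left_mono) (auto simp: u_def[symmetric] v_def[symmetric] L_def[symmetric] field_simps)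
  also have "(1 - s) * (d z x)\<^sup>2 + s * ((v * (d z x)\<^sup>2 + u * (d z y)\<^sup>2) / L - u * v) - s * (1 - s) * u\<^sup>2
     = (1 - t) * (d z x)\<^sup>2 + t * (d z y)\<^sup>2 - t * (1 - t) * L\<^sup>2"
  proof -
    have "s * (v / L) = s - t" "s * (u / L) = t"
      using s(2) pos by (auto simp: field_simps)
    hence h1: "s * ((v * a + u * b) / L) = (s - t) * a + t * b" for a b
      by (metis (no_types, lifting) add_divide_distrib distrib_left mult.assoc times_divide_eq_left)
    have h2: "s * (u * v) + s * (1 - s) * u\<^sup>2 = (s * u) * (u + v) - (s * u)\<^sup>2"
      by (simp add: algebra_simps power2_eq_square)
    have h3: "(s * u) * (u + v) - (s * u)\<^sup>2 = t * (1 - t) * L\<^sup>2"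
      unfolding s(2) pos(4)[symmetric] by (simp add: algebra_simps power2_eq_square)
    have h4: "(1 - s) * a + s * (q / L - u * v) - s * (1 - s) * u\<^sup>2
        = (1 - s) * a + s * (q / L) - (s * (u * v) + s * (1 - s) * u\<^sup>2)" for a q
      by (simp add: right_diff_distrib)
    show ?thesis unfolding h4 h1 h2 h3 by (simp add: algebra_simps)
  qed
  finally show ?thesis by (simp add: stewart_def L_def)
qed

section \<open>Gluing and CAT(0) spaces\<close>

text \<open>A point \<open>z\<close> of \<open>B\<close> is seen from \<open>y\<close> through some
  \<open>w\<close> in the intersection. If \<open>x\<close> lies there too, the side
  \<open>x w\<close> is controlled by \<open>C\<close> and \<open>stewart_across\<close> applies. In
  general \<open>x w\<close> is a side in \<open>A\<close> with one end in the intersection, so the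
  first case controls it against \<open>z\<close>, and \<open>stewart_across\<close> applies once
  more.\<close>

lemma stewart_foreign_point:
  assumes AB: "A \<subseteq> M" "B \<subseteq> M"
    and A: "stewart_space A d"
    and C: "\<forall>x\<in>A \<inter> B. \<forall>y\<in>A \<inter> B. \<forall>t\<in>{0..1}. \<exists>m\<in>A \<inter> B. stewart d (A \<union> B) x y t m"
    and cross: "\<forall>a\<in>A. \<forall>b\<in>B. \<exists>c\<in>A \<inter> B. d a b = d a c + d c b"
    and x: "x \<in> A" and y: "y \<in> A" and t: "0 \<le> t" "t \<le> 1" and m: "m \<in> A" "stewart d A x y t m"
  shows "stewart d (A \<union> B) x y t m"
proof -
  have base: "stewart d {z} x y t m"
    if H: "z \<in> B" "x \<in> A \<inter> B" "y \<in> A" "0 \<le> t" "t \<le> 1" "m \<in> A" "stewart d A x y t m" for z x y t m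
  proof -
    obtain w where w: "w \<in> A \<inter> B" "d y z = d y w + d w z"
      using cross H by blast
    show ?thesis
    proof (rule stewart_across[where S = "A \<inter> B" and q = y and w = w])
      show "d z y = d z w + d w y" using w(2) by (simp add: commute)
      show "\<exists>k\<in>A \<inter> B. stewart d {z, y, x} x w s k" if s: "0 \<le> s" "s \<le> 1" for s
      proof -
        obtain k where k: "k \<in> A \<inter> B" "stewart d (A \<union> B) x w s k"
          using C H(2) w(1) s by (meson atLeastAtMost_iff)
        have "stewart d {z, y, x} x w s k"
          by (rule stewart_mono[OF k(2)]) (use H in auto)
        thus ?thesis using k(1) by blast
      qed
      show "stewart d (A \<inter> B) x y t m"
        by (rule stewart_mono[OF H(7)]) auto
    qed (use H w AB in auto)
  qed
  have "stewart d {z} x y t m" if z: "z \<in> B" for z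
  proof -
    obtain w where w: "w \<in> A \<inter> B" "d y z = d y w + d w z"
      using cross y z by blast
    have "stewart d {z} y x (1 - t) m"
    proof (rule stewart_commute, rule stewart_across[where S = A and q = y and w = w])
      show "d z y = d z w + d w y" using w(2) by (simp add: commute)
      show "\<exists>k\<in>A. stewart d {z, y, x} x w s k" if s: "0 \<le> s" "s \<le> 1" for s
      proof -
        obtain k where k: "k \<in> A" "stewart d A w x (1 - s) k"
          using stewart_spaceD[OF A, of w x "1 - s"] w x s by auto
        have "stewart d {z} w x (1 - s) k"
          using base[OF z w(1) x _ _ k] s by auto
        hence "stewart d ({z} \<union> A) w x (1 - s) k"
          using k(2) by (rule stewart_Un)
        hence "stewart d {z, y, x} w x (1 - s) k"
          by (rule stewart_mono) (use x y in auto)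
        thus ?thesis using stewart_commute k(1) by fastforce
      qed
    qed (use m t x y z w AB in auto)
    thus ?thesis using stewart_commute by fastforce
  qed
  thus ?thesis using m(2) by (auto simp: stewart_def)
qed

text \<open>The distance splits at a point \<open>c\<close> of the intersection. From
  \<open>c\<close> one can move towards any \<open>z\<close> inside one of the two pieces, so the
  first variation at \<open>c\<close> yields \<open>joint\<close>. The dividing point is then sought
  on the piece that contains it.\<close>

lemma stewart_crossing:
  assumes AB: "A \<subseteq> M" "B \<subseteq> M"
    and A: "\<forall>x\<in>A. \<forall>y\<in>A. \<forall>t\<in>{0..1}. \<exists>m\<in>A. stewart d (A \<union> B) x y t m"
    and B: "\<forall>x\<in>B. \<forall>y\<in>B. \<forall>t\<in>{0..1}. \<exists>m\<in>B. stewart d (A \<union> B) x y t m"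
    and cross: "\<forall>a\<in>A. \<forall>b\<in>B. \<exists>c\<in>A \<inter> B. d a b = d a c + d c b"
    and x: "x \<in> A" and y: "y \<in> B" and t: "0 \<le> t" "t \<le> 1"
  shows "\<exists>m\<in>A \<union> B. stewart d (A \<union> B) x y t m"
proof -
  obtain c where c: "c \<in> A" "c \<in> B" "d x y = d x c + d c y"
    using cross x y by blast
  have inM: "x \<in> M" "y \<in> M" "c \<in> M" using AB x y c by auto
  have joint: "d x y * (d z c)\<^sup>2 \<le> d c y * (d z x)\<^sup>2 + d x c * (d z y)\<^sup>2 - d x c * d c y * d x y"
    if z: "z \<in> A \<union> B" for z
  proof (rule stewart_at_joint)
    show "\<exists>k\<in>M. stewart d {x, y} c z s k" if s: "0 \<le> s" "s \<le> 1" for s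
    proof -
      have "s \<in> {0..1}" using s by simp
      then obtain k where k: "k \<in> A \<union> B" "stewart d (A \<union> B) c z s k"
        using z A[rule_format, OF c(1), of z s] B[rule_format, OF c(2), of z s] by blast
      have "stewart d {x, y} c z s k"
        by (rule stewart_mono[OF k(2)]) (use x y in simp)
      thus ?thesis using k(1) AB by blast
    qed
  qed (use c(3) inM z AB in \<open>auto simp: subset_iff\<close>)
  \<comment> \<open>The dividing point lies on \<open>x c\<close> or on \<open>c y\<close>; the
    piece that contains it can be taken of positive length, by which the parameter is divided
    below.\<close>
  consider "d x y = 0" | "d x y > 0" "t * d x y \<le> d x c" "0 < d x c" | "d x y > 0" "t * d x y \<ge> d x c" "0 < d c y"
    using c(3) nonneg[of x c] nonneg[of c y] nonneg[of x y] mult_nonneg_nonneg[OF t(1) nonneg, of x y]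
      mult_left_le_one_le[OF nonneg t, of x y]
    by linarith
  thus ?thesis
  proof cases
    case 1
    hence "x = y" using inM by simp
    moreover have "t \<in> {0..1}" using t by simp
    ultimately show ?thesis using A x by blast
  next
    case 2
    hence "t * d x y / d x c \<le> 1" "0 \<le> t * d x y / d x c" using t by auto
    then obtain m where m: "m \<in> A" "stewart d (A \<union> B) x c (t * d x y / d x c) m"
      using A[rule_format, OF x c(1)] by (meson atLeastAtMost_iff)
    have "stewart d {z} x y t m" if z: "z \<in> A \<union> B" for z
    proof (rule stewart_concat[OF inM(1,2,3) _ _ c(3) 2(3) joint[OF z] t(1) 2(2)])
      show "stewart d {z} x c (t * d x y / d x c) m"
        by (rule stewart_mono[OF m(2)]) (use z in simp)
    qed (use m(1) z AB in auto)
    thus ?thesis using m(1) by (auto simp: stewart_def)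
  next
    case 3
    \<comment> \<open>The second piece becomes the first one when the ends are exchanged and
      \<open>t\<close> is replaced by \<open>1 - t\<close>.\<close>
    have c': "d y x = d y c + d c x" using c(3) by (simp add: commute)
    have t': "(1 - t) * d y x \<le> d y c" using 3 c' by (simp add: commute algebra_simps)
    have "(1 - t) * d y x / d y c \<le> 1" "0 \<le> (1 - t) * d y x / d y c" using t 3 t' by (auto simp: commute)
    then obtain m where m: "m \<in> B" "stewart d (A \<union> B) y c ((1 - t) * d y x / d y c) m"
      using B[rule_format, OF y c(2)] by (meson atLeastAtMost_iff)
    have "stewart d {z} y x (1 - t) m" if z: "z \<in> A \<union> B" for z
    proof (rule stewart_concat[OF inM(2,1,3) _ _ c' _ _ _ t'])
      show "d y x * (d z c)\<^sup>2 \<le> d c x * (d z y)\<^sup>2 + d y c * (d z x)\<^sup>2 - d y c * d c x * d y x"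
        using joint[OF z] by (simp add: commute[of y] commute[of c x] mult.commute)
      show "stewart d {z} y c ((1 - t) * d y x / d y c) m"
        by (rule stewart_mono[OF m(2)]) (use z in simp)
    qed (use m(1) z AB 3 t in \<open>auto simp: commute[of y]\<close>)
    hence "stewart d (A \<union> B) y x (1 - t) m" by (auto simp: stewart_def)
    hence "stewart d (A \<union> B) x y t m" using stewart_commute by fastforce
    thus ?thesis using m(1) by auto
  qed
qed

text \<open>Reshetnyak's gluing theorem, for a metric already given on the union.\<close>
theorem stewart_space_Un:
  assumes AB: "A \<subseteq> M" "B \<subseteq> M"
    and A: "stewart_space A d" and B: "stewart_space B d"
    and C: "\<forall>x\<in>A \<inter> B. \<forall>y\<in>A \<inter> B. \<forall>t\<in>{0..1}. \<exists>m\<in>A \<inter> B. stewart d (A \<union> B) x y t m"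
    and cross: "\<forall>a\<in>A. \<forall>b\<in>B. \<exists>c\<in>A \<inter> B. d a b = d a c + d c b"
  shows "stewart_space (A \<union> B) d"
proof -
  have cross': "\<forall>b\<in>B. \<forall>a\<in>A. \<exists>c\<in>B \<inter> A. d b a = d b c + d c a"
  proof (intro ballI)
    fix a b assume "a \<in> A" "b \<in> B"
    then obtain c where c: "c \<in> A \<inter> B" "d a b = d a c + d c b" using cross by blast
    thus "\<exists>c\<in>B \<inter> A. d b a = d b c + d c a"
      by (intro bexI[of _ c]) (auto simp: commute[of b a] commute[of b c] commute[of c a])
  qed
  have C': "\<forall>x\<in>B \<inter> A. \<forall>y\<in>B \<inter> A. \<forall>t\<in>{0..1}. \<exists>m\<in>B \<inter> A. stewart d (B \<union> A) x y t m"
    using C by (simp only: Int_commute[of B A] Un_commute[of B A])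
  have A': "\<forall>x\<in>A. \<forall>y\<in>A. \<forall>t\<in>{0..1}. \<exists>m\<in>A. stewart d (A \<union> B) x y t m"
    using stewart_foreign_point[OF AB A C cross] A[unfolded stewart_space_def]
    by (meson atLeastAtMost_iff)
  have B': "\<forall>x\<in>B. \<forall>y\<in>B. \<forall>t\<in>{0..1}. \<exists>m\<in>B. stewart d (A \<union> B) x y t m"
    using stewart_foreign_point[OF AB(2,1) B C' cross'] B[unfolded stewart_space_def]
    unfolding Un_commute[of B A] by (meson atLeastAtMost_iff)
  have AB': "\<exists>m\<in>A \<union> B. stewart d (A \<union> B) x y t m"
    if "x \<in> A" "y \<in> B" "0 \<le> t" "t \<le> 1" for x y t
    by (rule stewart_crossing[OF AB A' B' cross that])
  have BA': "\<exists>m\<in>A \<union> B. stewart d (A \<union> B) x y t m"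
    if "x \<in> B" "y \<in> A" "0 \<le> t" "t \<le> 1" for x y t
    using AB'[of y x "1 - t"] stewart_commute[of "A \<union> B" y x "1 - t"] that by fastforce
  show ?thesis
    unfolding stewart_space_def
  proof (intro ballI)
    fix x y t assume H: "x \<in> A \<union> B" "y \<in> A \<union> B" "t \<in> {0..1::real}"
    then consider "x \<in> A" "y \<in> A" | "x \<in> B" "y \<in> B" | "x \<in> A" "y \<in> B" | "x \<in> B" "y \<in> A"
      by blast
    thus "\<exists>m\<in>A \<union> B. stewart d (A \<union> B) x y t m"
    proof cases
      case 1 thus ?thesis using A' H(3) by blast
    next
      case 2 thus ?thesis using B' H(3) by blast
    next
      case 3 thus ?thesis using AB' H(3) by simp
    next
      case 4 thus ?thesis using BA' H(3) by simp
    qed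
  qed
qed

section \<open>From dividing points to geodesics and comparison triangles\<close>

lemma geodesic_is_stewart:
  assumes S: "S \<subseteq> M" "stewart_space S d" and x: "x \<in> S" "y \<in> S"
    and g: "geodesic_segment S d \<gamma> x y" and t: "0 \<le> t" "t \<le> 1"
  shows "stewart d S x y t (\<gamma> (t * d x y))" "\<gamma> (t * d x y) \<in> S"
proof -
  have mem: "t * d x y \<in> {0..d x y}" "0 \<in> {0..d x y}" "d x y \<in> {0..d x y}"
    using t by (auto intro: mult_left_le_one_le)
  have g': "\<gamma> 0 = x" "\<gamma> (d x y) = y" "\<And>s t. s \<in> {0..d x y} \<Longrightarrow> t \<in> {0..d x y} \<Longrightarrow> d (\<gamma> s) (\<gamma> t) = \<bar>s - t\<bar>"
    using g by (auto simp: geodesic_segment_def)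
  show in_S: "\<gamma> (t * d x y) \<in> S"
    using g mem(1) unfolding geodesic_segment_def by auto
  obtain m where m: "m \<in> S" "stewart d S x y t m"
    using stewart_spaceD[OF S(2) x t] by blast
  \<comment> \<open>A geodesic passes at the exact distances from both ends, so uniqueness
    identifies its point with \<open>m\<close>. This handles every geodesic at once, as
    \<open>CAT0\<close> requires.\<close>
  have "d x (\<gamma> (t * d x y)) = t * d x y"
    using g'(3)[OF mem(2,1)] t g'(1) by simp
  moreover have "d y (\<gamma> (t * d x y)) = (1 - t) * d x y"
    using g'(3)[OF mem(3,1)] mem(1) g'(2) by (simp add: algebra_simps)
  ultimately have "\<gamma> (t * d x y) = m"
    using S m in_S t by (intro stewart_unique[OF m(2)]) auto
  thus "stewart d S x y t (\<gamma> (t * d x y))" using m(2) by simp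
qed

text \<open>The dividing points for all \<open>t\<close> form the geodesic. Testing one against
  another bounds their distance from above, and the triangle inequality from \<open>x\<close> to
  \<open>y\<close> turns the bound into equality.\<close>

lemma stewart_geodesic:
  assumes S: "S \<subseteq> M" "stewart_space S d" and x: "x \<in> S" "y \<in> S"
  shows "\<exists>\<gamma>. geodesic_segment S d \<gamma> x y"
proof (cases "x = y")
  case True
  thus ?thesis using S x by (intro exI[of _ "\<lambda>_. x"]) (auto simp: geodesic_segment_def)
next
  case False
  define D where "D = d x y"
  have D: "0 < D"
    using False S x zero[of x y] nonneg[of x y] by (auto simp: D_def less_le subset_iff)
  have "\<forall>t\<in>{0..1}. \<exists>m\<in>S. stewart d S x y t m"
    using S x by (auto simp: stewart_space_def)
  then obtain m where m: "\<And>t. 0 \<le> t \<Longrightarrow> t \<le> 1 \<Longrightarrow> m t \<in> S \<and> stewart d S x y t (m t)"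
    by (metis atLeastAtMost_iff)
  have mS: "0 \<le> t \<Longrightarrow> t \<le> 1 \<Longrightarrow> m t \<in> S" and
    mst: "0 \<le> t \<Longrightarrow> t \<le> 1 \<Longrightarrow> stewart d S x y t (m t)" for t using m by blast+
  have mx: "d x (m t) \<le> t * D" "d y (m t) \<le> (1 - t) * D" if "0 \<le> t" "t \<le> 1" for t
    using stewart_dist_left[OF mst[OF that] x(1)] stewart_dist_right[OF mst[OF that] x(2)] that x S
    by (auto simp: D_def)
  have ends: "m 0 = x" "m 1 = y"
    using mx[of 0] mx[of 1] mS[of 0] mS[of 1] S x nonneg[of x "m 0"] nonneg[of y "m 1"]
    by (auto simp: subset_iff)
  have upper: "d (m s) (m t) \<le> \<bar>s - t\<bar> * D" if s: "0 \<le> s" "s \<le> 1" and t: "0 \<le> t" "t \<le> 1" for s t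
  proof (rule power2_le_imp_le)
    have "(d (m s) (m t))\<^sup>2 \<le> (1 - t) * (d (m s) x)\<^sup>2 + t * (d (m s) y)\<^sup>2 - t * (1 - t) * D\<^sup>2"
      using stewartD[OF mst[OF t] mS[OF s]] by (simp add: D_def)
    also have "\<dots> \<le> (1 - t) * (s * D)\<^sup>2 + t * ((1 - s) * D)\<^sup>2 - t * (1 - t) * D\<^sup>2"
      using mx[OF s] t D by (intro diff_mono add_mono mult_left_mono power_mono) (auto simp: commute)
    also have "\<dots> = (\<bar>s - t\<bar> * D)\<^sup>2"
      by (simp add: power_mult_distrib) (simp add: power2_eq_square algebra_simps)
    finally show "(d (m s) (m t))\<^sup>2 \<le> (\<bar>s - t\<bar> * D)\<^sup>2" .
  qed (use D in auto)
  have exact: "d (m s) (m t) = \<bar>s - t\<bar> * D" if st: "0 \<le> s" "s \<le> t" "t \<le> 1" for s t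
  proof -
    have "D \<le> d x (m s) + (d (m s) (m t) + d (m t) y)"
      using triangle[of x "m s" y] triangle[of "m s" "m t" y] mS[of s] mS[of t] st S x
      by (auto simp: D_def subset_iff)
    also have "\<dots> \<le> s * D + (d (m s) (m t) + (1 - t) * D)"
      using mx[of s] mx[of t] st by (auto simp: commute)
    finally show ?thesis using upper[of s t] st by (simp add: algebra_simps)
  qed
  have exact': "d (m s) (m t) = \<bar>s - t\<bar> * D" if "0 \<le> s" "s \<le> 1" "0 \<le> t" "t \<le> 1" for s t
    using exact[of s t] exact[of t s] that by (cases "s \<le> t") (auto simp: commute)
  have "geodesic_segment S d (\<lambda>s. m (s / D)) x y"
    unfolding geodesic_segment_def D_def[symmetric]
  proof (intro conjI ballI)
    show "(\<lambda>s. m (s / D)) ` {0..D} \<subseteq> S" using mS D by auto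
    show "d (m (s / D)) (m (t / D)) = \<bar>s - t\<bar>" if "s \<in> {0..D}" "t \<in> {0..D}" for s t
      using exact'[of "s / D" "t / D"] that D by (auto simp: diff_divide_distrib[symmetric] abs_divide)
  qed (use ends D in auto)
  thus ?thesis by blast
qed

text \<open>For \<open>l = 0\<close> the quotient in \<open>cmp_point\<close> is 0, and the formula
  is then saved by the two ends being equal.\<close>

lemma cmp_point_convex:
  assumes "l \<noteq> 0 \<or> u = v"
  shows "cmp_point u v l (t * l) = (1 - t) *\<^sub>R u + t *\<^sub>R v"
proof (cases "u = v")
  case True
  thus ?thesis by (simp add: cmp_point_def scaleR_left_diff_distrib)
next
  case False
  hence "t * l / l = t" using assms by simp
  thus ?thesis by (simp add: cmp_point_def scaleR_conv_of_real algebra_simps)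
qed

text \<open>Two uses of the inequality: \<open>m\<close> against \<open>z\<close> and
  \<open>x\<close>, then \<open>n\<close> against \<open>m\<close>. In the plane both are
  equalities, so plane distances dominate at each stage.\<close>

lemma stewart_two_sides:
  assumes S: "S \<subseteq> M" and xyz: "x \<in> S" "y \<in> S" "z \<in> S"
    and m: "m \<in> S" "stewart d S x y s m" and n: "n \<in> S" "stewart d S x z t n"
    and s: "0 \<le> s" "s \<le> 1" and t: "0 \<le> t" "t \<le> 1"
    and cmp: "dist a b = d x y" "dist b c = d y z" "dist a c = d x z"
  shows "d m n \<le> dist ((1 - s) *\<^sub>R a + s *\<^sub>R b) ((1 - t) *\<^sub>R a + t *\<^sub>R (c::complex))"
proof (rule power2_le_imp_le)
  have mz: "(d m z)\<^sup>2 \<le> (dist ((1 - s) *\<^sub>R a + s *\<^sub>R b) c)\<^sup>2"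
    using stewartD[OF m(2) xyz(3)] unfolding dist_commute[of "(1 - s) *\<^sub>R a + s *\<^sub>R b" c] stewart_identity
    by (simp add: cmp commute dist_commute)
  have mx: "(d m x)\<^sup>2 \<le> (dist ((1 - s) *\<^sub>R a + s *\<^sub>R b) a)\<^sup>2"
    using stewartD[OF m(2) xyz(1)] S xyz unfolding dist_commute[of "(1 - s) *\<^sub>R a + s *\<^sub>R b" a] stewart_identity
    by (simp add: cmp commute[of m x] subset_iff)
  have "(d m n)\<^sup>2 \<le> (1 - t) * (d m x)\<^sup>2 + t * (d m z)\<^sup>2 - t * (1 - t) * (d x z)\<^sup>2"
    using stewartD[OF n(2) m(1)] .
  also have "\<dots> \<le> (1 - t) * (dist ((1 - s) *\<^sub>R a + s *\<^sub>R b) a)\<^sup>2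
      + t * (dist ((1 - s) *\<^sub>R a + s *\<^sub>R b) c)\<^sup>2 - t * (1 - t) * (dist a c)\<^sup>2"
    unfolding cmp using t mx mz by (intro diff_mono add_mono mult_left_mono) auto
  also have "\<dots> = (dist ((1 - s) *\<^sub>R a + s *\<^sub>R b) ((1 - t) *\<^sub>R a + t *\<^sub>R c))\<^sup>2"
    by (rule stewart_identity[symmetric])
  finally show "(d m n)\<^sup>2 \<le> (dist ((1 - s) *\<^sub>R a + s *\<^sub>R b) ((1 - t) *\<^sub>R a + t *\<^sub>R c))\<^sup>2" .
qed simp

lemma stewart_cmp_adjacent:
  assumes S: "S \<subseteq> M" "stewart_space S d" and xyz: "x \<in> S" "y \<in> S" "z \<in> S"
    and g: "geodesic_segment S d \<gamma>1 x y" "geodesic_segment S d \<gamma>2 y z"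
    and cmp: "dist a b = d x y" "dist b c = d y z" "dist c a = d z x"
    and s: "s \<in> {0..d x y}" and t: "t \<in> {0..d y z}"
  shows "d (\<gamma>1 s) (\<gamma>2 t) \<le> dist (cmp_point a b (d x y) s) (cmp_point b c (d y z) t)"
proof -
  have param: "\<exists>p. 0 \<le> p \<and> p \<le> 1 \<and> r = p * l" if "r \<in> {0..l}" for r l :: real
    using that by (intro exI[of _ "r / l"]) (auto simp: divide_le_eq_1)
  obtain p where p: "0 \<le> p" "p \<le> 1" "s = p * d x y" using param[OF s] by blast
  obtain q where q: "0 \<le> q" "q \<le> 1" "t = q * d y z" using param[OF t] by blast
  note G1 = geodesic_is_stewart[OF S xyz(1,2) g(1) p(1,2), folded p(3)]
  note G2 = geodesic_is_stewart[OF S xyz(2,3) g(2) q(1,2), folded q(3)]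
  \<comment> \<open>The common vertex is \<open>y\<close>, so the first side is run backwards, with
    parameter \<open>1 - p\<close>.\<close>
  have "d (\<gamma>1 s) (\<gamma>2 t)
      \<le> dist ((1 - (1 - p)) *\<^sub>R b + (1 - p) *\<^sub>R a) ((1 - q) *\<^sub>R b + q *\<^sub>R c)"
    by (rule stewart_two_sides[OF S(1) xyz(2,1,3) G1(2) stewart_commute[OF G1(1)] G2(2,1)])
      (use p q cmp in \<open>auto simp: dist_commute commute\<close>)
  moreover have "cmp_point a b (d x y) s = (1 - (1 - p)) *\<^sub>R b + (1 - p) *\<^sub>R a"
    unfolding p(3) using cmp by (subst cmp_point_convex) (auto simp: add.commute)
  moreover have "cmp_point b c (d y z) t = (1 - q) *\<^sub>R b + q *\<^sub>R c"
    unfolding q(3) using cmp by (subst cmp_point_convex) auto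
  ultimately show ?thesis by simp
qed

lemma cmp_point_same_side:
  assumes g: "geodesic_segment S d \<gamma> x y" and cmp: "dist a b = d x y"
    and st: "s \<in> {0..d x y}" "t \<in> {0..d x y}"
  shows "d (\<gamma> s) (\<gamma> t) \<le> dist (cmp_point a b (d x y) s) (cmp_point a b (d x y) t)"
proof (cases "d x y = 0")
  case True
  thus ?thesis using g st by (auto simp: geodesic_segment_def)
next
  case False
  have "cmp_point a b (d x y) s - cmp_point a b (d x y) t = of_real ((s - t) / d x y) * (b - a)"
    by (simp add: cmp_point_def diff_divide_distrib algebra_simps)
  hence "dist (cmp_point a b (d x y) s) (cmp_point a b (d x y) t) = \<bar>(s - t) / d x y\<bar> * d x y"
    using cmp by (simp add: dist_norm norm_mult norm_minus_commute del: of_real_divide of_real_diff)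
  also have "\<dots> = \<bar>s - t\<bar>" using False nonneg[of x y] by (simp add: abs_divide)
  also have "\<dots> = d (\<gamma> s) (\<gamma> t)" using g st by (auto simp: geodesic_segment_def)
  finally show ?thesis by simp
qed

theorem stewart_space_CAT0:
  assumes S: "stewart_space M d"
  shows "CAT0 M d"
  unfolding CAT0_def
proof (intro conjI, goal_cases)
  case 1
  show ?case by (rule Metric_space_axioms)
next
  case 2
  show "geodesic_space M d"
    unfolding geodesic_space_def using stewart_geodesic[OF order_refl S] by blast
next
  case 3
  show ?case
  proof (rule ballI, rule ballI, rule ballI, (rule allI)+, rule impI)
    fix x y z \<gamma>1 \<gamma>2 \<gamma>3 and a b c :: complex
    assume xyz: "x \<in> M" "y \<in> M" "z \<in> M"
    assume H: "geodesic_segment M d \<gamma>1 x y \<and> geodesic_segment M d \<gamma>2 y z \<and> geodesic_segment M d \<gamma>3 z x \<and>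
         dist a b = d x y \<and> dist b c = d y z \<and> dist c a = d z x"
    note adj = stewart_cmp_adjacent[OF order_refl S]
    have same: "d (\<gamma>1 s) (\<gamma>1 t) \<le> dist (cmp_point a b (d x y) s) (cmp_point a b (d x y) t)"
      if "s \<in> {0..d x y}" "t \<in> {0..d x y}" for s t
      using cmp_point_same_side[of M \<gamma>1 x y a b] H that by blast
    have same2: "d (\<gamma>2 s) (\<gamma>2 t) \<le> dist (cmp_point b c (d y z) s) (cmp_point b c (d y z) t)"
      if "s \<in> {0..d y z}" "t \<in> {0..d y z}" for s t
      using cmp_point_same_side[of M \<gamma>2 y z b c] H that by blast
    have same3: "d (\<gamma>3 s) (\<gamma>3 t) \<le> dist (cmp_point c a (d z x) s) (cmp_point c a (d z x) t)"
      if "s \<in> {0..d z x}" "t \<in> {0..d z x}" for s t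
      using cmp_point_same_side[of M \<gamma>3 z x c a] H that by blast
    have a12: "d (\<gamma>1 s) (\<gamma>2 t) \<le> dist (cmp_point a b (d x y) s) (cmp_point b c (d y z) t)"
      if "s \<in> {0..d x y}" "t \<in> {0..d y z}" for s t
      using adj[OF xyz, of \<gamma>1 \<gamma>2 a b c] H that by blast
    have a23: "d (\<gamma>2 s) (\<gamma>3 t) \<le> dist (cmp_point b c (d y z) s) (cmp_point c a (d z x) t)"
      if "s \<in> {0..d y z}" "t \<in> {0..d z x}" for s t
      using adj[OF xyz(2,3,1), of \<gamma>2 \<gamma>3 b c a] H that by blast
    have a31: "d (\<gamma>3 s) (\<gamma>1 t) \<le> dist (cmp_point c a (d z x) s) (cmp_point a b (d x y) t)"
      if "s \<in> {0..d z x}" "t \<in> {0..d x y}" for s t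
      using adj[OF xyz(3,1,2), of \<gamma>3 \<gamma>1 c a b] H that by blast
    show "\<forall>(\<gamma>, u, v, l) \<in> {(\<gamma>1, a, b, d x y), (\<gamma>2, b, c, d y z), (\<gamma>3, c, a, d z x)}.
          \<forall>(\<gamma>', u', v', l') \<in> {(\<gamma>1, a, b, d x y), (\<gamma>2, b, c, d y z), (\<gamma>3, c, a, d z x)}.
          \<forall>s\<in>{0..l}. \<forall>t\<in>{0..l'}.
            d (\<gamma> s) (\<gamma>' t) \<le> dist (cmp_point u v l s) (cmp_point u' v' l' t)"
      \<comment> \<open>Two different sides of a triangle share a vertex, so the nine pairs reduce,
        up to symmetry, to three equal and three adjacent ones.\<close>
      unfolding ball_simps prod.case
      using same same2 same3 a12 a23 a31 a12[unfolded commute[of "\<gamma>1 _"] dist_commute[of "cmp_point a b _ _"]]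
        a23[unfolded commute[of "\<gamma>2 _"] dist_commute[of "cmp_point b c _ _"]]
        a31[unfolded commute[of "\<gamma>3 _"] dist_commute[of "cmp_point c a _ _"]]
      by blast
  qed
qed

end

section \<open>Chain metrics\<close>

inductive chain :: "('p \<Rightarrow> 'p \<Rightarrow> bool) \<Rightarrow> ('p \<Rightarrow> 'p \<Rightarrow> real) \<Rightarrow> 'p \<Rightarrow> 'p \<Rightarrow> real \<Rightarrow> bool"
  for adj len where
  chain_refl: "chain adj len x x 0"
| chain_step: "chain adj len x y L \<Longrightarrow> adj y z \<Longrightarrow> chain adj len x z (L + len y z)"

lemma chain_one: "adj x y \<Longrightarrow> chain adj len x y (len x y)"
  using chain_step[OF chain_refl, of adj x y len] by simp

lemma chain_trans:
  "chain adj len y z L' \<Longrightarrow> chain adj len x y L \<Longrightarrow> chain adj len x z (L + L')"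
proof (induction rule: chain.induct)
  case (chain_step y z L' z')
  thus ?case using chain.chain_step[of adj len x z "L + L'" z'] by (simp add: add.assoc)
qed simp

lemma chain_sym:
  assumes "\<And>x y. adj x y \<Longrightarrow> adj y x" "\<And>x y. len x y = len y x"
  shows "chain adj len x y L \<Longrightarrow> chain adj len y x L"
proof (induction rule: chain.induct)
  case (chain_step x y L z)
  thus ?case
    using chain_trans[OF chain_step(3) chain_one[of adj z y len]] assms by (simp add: add.commute)
qed (rule chain_refl)

lemma chain_nonneg:
  assumes "\<And>x y. 0 \<le> len x y"
  shows "chain adj len x y L \<Longrightarrow> 0 \<le> L"
  by (induction rule: chain.induct) (simp_all add: assms)

lemma chain_map:
  assumes "\<And>y z. adj y z \<Longrightarrow> adj' (\<phi> y) (\<phi> z) \<and> len' (\<phi> y) (\<phi> z) \<le> len y z"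
  shows "chain adj len x y L \<Longrightarrow> \<exists>L'\<le>L. chain adj' len' (\<phi> x) (\<phi> y) L'"
proof (induction rule: chain.induct)
  case (chain_step x y L z)
  then obtain L' where "L' \<le> L" "chain adj' len' (\<phi> x) (\<phi> y) L'" by blast
  thus ?case using assms[OF chain_step(2)] chain.chain_step by (meson add_mono)
qed (auto intro: chain_refl)

text \<open>\<open>len\<close> is a metric on all of \<open>S\<close>, not only along
  \<open>adj\<close>. It is therefore a lower bound for every chain, which makes the infimum
  separate points.\<close>

locale chain_space =
  fixes S :: "'p set" and adj :: "'p \<Rightarrow> 'p \<Rightarrow> bool" and len :: "'p \<Rightarrow> 'p \<Rightarrow> real"
  assumes adj_in: "adj x y \<Longrightarrow> x \<in> S \<and> y \<in> S"
    and adj_sym: "adj x y \<Longrightarrow> adj y x"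
    and len_nonneg: "0 \<le> len x y"
    and len_commute: "len x y = len y x"
    and len_triangle: "x \<in> S \<Longrightarrow> y \<in> S \<Longrightarrow> z \<in> S \<Longrightarrow> len x z \<le> len x y + len y z"
    and len_zero: "x \<in> S \<Longrightarrow> y \<in> S \<Longrightarrow> len x y = 0 \<longleftrightarrow> x = y"
    and connected: "x \<in> S \<Longrightarrow> y \<in> S \<Longrightarrow> \<exists>L. chain adj len x y L"
begin

definition cdist :: "'p \<Rightarrow> 'p \<Rightarrow> real" where
  "cdist x y = (if x \<in> S \<and> y \<in> S then Inf {L. chain adj len x y L} else 0)"

lemma chain_in: "chain adj len x y L \<Longrightarrow> x \<in> S \<Longrightarrow> y \<in> S"
  by (induction rule: chain.induct) (use adj_in in auto)

lemma chains_bdd_below: "bdd_below {L. chain adj len x y L}"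
  by (rule bdd_belowI[of _ 0]) (auto intro: chain_nonneg len_nonneg)

lemma cdist_le: "x \<in> S \<Longrightarrow> chain adj len x y L \<Longrightarrow> cdist x y \<le> L"
  unfolding cdist_def using chain_in by (auto intro!: cInf_lower chains_bdd_below)

lemma cdist_adj_le: "adj x y \<Longrightarrow> cdist x y \<le> len x y"
  using cdist_le[OF _ chain_one] adj_in by blast

lemma cdist_greatest:
  assumes "x \<in> S" "y \<in> S" "\<And>L. chain adj len x y L \<Longrightarrow> c \<le> L"
  shows "c \<le> cdist x y"
  using assms connected[OF assms(1,2)] by (auto simp: cdist_def intro: cInf_greatest)

lemma cdist_approx:
  assumes "x \<in> S" "y \<in> S" "0 < e"
  obtains L where "chain adj len x y L" "L < cdist x y + e"
  using assms connected[OF assms(1,2)] cInf_lessD[of "{L. chain adj len x y L}" "cdist x y + e"]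
  by (auto simp: cdist_def)

lemma len_le_chain: "chain adj len x y L \<Longrightarrow> x \<in> S \<Longrightarrow> len x y \<le> L"
proof (induction rule: chain.induct)
  case (chain_refl x) thus ?case using len_zero[of x x] by simp
next
  case (chain_step x y L z)
  thus ?case using len_triangle[of x y z] chain_in adj_in by fastforce
qed

lemma len_le_cdist: "x \<in> S \<Longrightarrow> y \<in> S \<Longrightarrow> len x y \<le> cdist x y"
  by (rule cdist_greatest) (auto intro: len_le_chain)

lemma cdist_map_le:
  assumes "\<And>y z. adj y z \<Longrightarrow> adj (\<phi> y) (\<phi> z) \<and> len (\<phi> y) (\<phi> z) \<le> len y z"
    and "x \<in> S" "y \<in> S" "\<phi> x \<in> S"
  shows "cdist (\<phi> x) (\<phi> y) \<le> cdist x y"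
proof (rule cdist_greatest[OF assms(2,3)])
  fix L assume "chain adj len x y L"
  then obtain L' where "L' \<le> L" "chain adj len (\<phi> x) (\<phi> y) L'"
    using chain_map[of adj adj \<phi> len len, OF assms(1)] by blast
  thus "cdist (\<phi> x) (\<phi> y) \<le> L" using cdist_le[OF assms(4)] by fastforce
qed

lemma Metric_space_cdist: "Metric_space S cdist"
proof
  show "0 \<le> cdist x y" for x y
  proof (cases "x \<in> S \<and> y \<in> S")
    case True
    thus ?thesis using len_le_cdist[of x y] len_nonneg[of x y] by linarith
  qed (auto simp: cdist_def)
  show "cdist x y = cdist y x" for x y
  proof -
    have "chain adj len x y L \<longleftrightarrow> chain adj len y x L" for L
      using chain_sym[of adj len] adj_sym len_commute by blast
    hence "{L. chain adj len x y L} = {L. chain adj len y x L}" by blast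
    thus ?thesis by (simp add: cdist_def conj_commute)
  qed
  show "cdist x y = 0 \<longleftrightarrow> x = y" if "x \<in> S" "y \<in> S" for x y
    using len_le_cdist[OF that] len_nonneg[of x y] len_zero[OF that] cdist_le[OF that(1) chain_refl]
      len_le_cdist[of x x] len_nonneg[of x x] that
    by force
  show "cdist x z \<le> cdist x y + cdist y z" if xyz: "x \<in> S" "y \<in> S" "z \<in> S" for x y z
  proof (rule field_le_epsilon)
    fix e :: real assume "0 < e"
    hence e2: "0 < e / 2" by simp
    obtain L where L: "chain adj len x y L" "L < cdist x y + e / 2"
      using cdist_approx[OF xyz(1,2) e2] .
    obtain L' where L': "chain adj len y z L'" "L' < cdist y z + e / 2"
      using cdist_approx[OF xyz(2,3) e2] .
    have "cdist x z \<le> L + L'" using cdist_le[OF xyz(1) chain_trans[OF L'(1) L(1)]] .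
    thus "cdist x z \<le> cdist x y + cdist y z + e" using L L' by linarith
  qed
qed

end

sublocale chain_space \<subseteq> Metric_space S cdist by (rule Metric_space_cdist)

section \<open>Event structures\<close>

text \<open>The l2 distance of vectors that differ in finitely many coordinates. For infinitely many
  the sum, hence the value, is 0, which explains the finiteness premises below.\<close>

definition coord_dist :: "('e \<Rightarrow> real) \<Rightarrow> ('e \<Rightarrow> real) \<Rightarrow> real" where
  "coord_dist x y = L2_set (\<lambda>e. x e - y e) {e. x e \<noteq> y e}"

lemma coord_dist_eq:
  assumes "finite S" "{e. x e \<noteq> y e} \<subseteq> S"
  shows "coord_dist x y = L2_set (\<lambda>e. x e - y e) S"
  unfolding coord_dist_def L2_set_def using assms
  by (intro arg_cong[of _ _ sqrt] sum.mono_neutral_left) auto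

lemma coord_dist_nonneg: "0 \<le> coord_dist x y"
  by (simp add: coord_dist_def L2_set_nonneg)

lemma coord_dist_commute: "coord_dist x y = coord_dist y x"
  by (simp add: coord_dist_def L2_set_def power2_commute eq_commute[of "x _"])

lemma coord_dist_triangle:
  assumes "finite {e. x e \<noteq> y e}" "finite {e. y e \<noteq> z e}"
  shows "coord_dist x z \<le> coord_dist x y + coord_dist y z"
proof -
  define S where "S = {e. x e \<noteq> y e} \<union> {e. y e \<noteq> z e}"
  have "finite S" using assms by (simp add: S_def)
  hence "coord_dist x y = L2_set (\<lambda>e. x e - y e) S" "coord_dist y z = L2_set (\<lambda>e. y e - z e) S"
    "coord_dist x z = L2_set (\<lambda>e. (x e - y e) + (y e - z e)) S"
    by (auto simp: S_def intro!: coord_dist_eq trans[OF coord_dist_eq[of S]])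
  thus ?thesis using L2_set_triangle_ineq by metis
qed

lemma coord_dist_abs_le:
  assumes "finite {e. x e \<noteq> y e}"
  shows "\<bar>x e - y e\<bar> \<le> coord_dist x y"
proof (cases "x e = y e")
  case False
  thus ?thesis
    using member_le_L2_set[OF assms, of e "\<lambda>e. \<bar>x e - y e\<bar>"] by (simp add: coord_dist_def L2_set_def)
qed (simp add: coord_dist_nonneg)

lemma coord_dist_mono:
  assumes "finite {e. x e \<noteq> y e}" "\<And>e. \<bar>x' e - y' e\<bar> \<le> \<bar>x e - y e\<bar>"
  shows "coord_dist x' y' \<le> coord_dist x y"
proof -
  have "{e. x' e \<noteq> y' e} \<subseteq> {e. x e \<noteq> y e}"
  proof safe
    fix e assume "x' e \<noteq> y' e" "x e = y e" thus False using assms(2)[of e] by simp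
  qed
  hence "coord_dist x' y' = L2_set (\<lambda>e. x' e - y' e) {e. x e \<noteq> y e}"
    by (rule coord_dist_eq[OF assms(1)])
  also have "\<dots> \<le> coord_dist x y"
    unfolding coord_dist_def L2_set_def
    using assms(2) by (intro real_sqrt_le_mono sum_mono) (auto simp: abs_le_square_iff)
  finally show ?thesis .
qed

text \<open>Pythagoras for the coordinate \<open>h\<close>; the common value \<open>c\<close>
  removes it from the other term.\<close>

lemma coord_dist_split:
  assumes "finite {e. x e \<noteq> y e}"
  shows "coord_dist x y = sqrt ((coord_dist (x(h := c)) (y(h := c)))\<^sup>2 + (x h - y h)\<^sup>2)"
proof -
  define S where "S = {e. x e \<noteq> y e} - {h}"
  have S: "finite S" "h \<notin> S" using assms by (auto simp: S_def)
  have "coord_dist x y = L2_set (\<lambda>e. x e - y e) (insert h S)"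
    using S by (intro coord_dist_eq) (auto simp: S_def)
  moreover have "coord_dist (x(h := c)) (y(h := c)) = L2_set (\<lambda>e. (x(h := c)) e - (y(h := c)) e) S"
    using S by (intro coord_dist_eq) (auto simp: S_def)
  moreover have "L2_set (\<lambda>e. (x(h := c)) e - (y(h := c)) e) S = L2_set (\<lambda>e. x e - y e) S"
    using S(2) by (intro L2_set_cong) auto
  ultimately show ?thesis
    using S by (simp add: L2_set_def sum_nonneg add.commute)
qed

text \<open>Bolzano-Weierstrass one coordinate at a time; earlier coordinates keep their limits
  along a further subsequence.\<close>

lemma coordinatewise_subsequence:
  fixes s :: "nat \<Rightarrow> 'e \<Rightarrow> real"
  assumes "finite K" "\<And>n e. 0 \<le> s n e \<and> s n e \<le> 1"
  shows "\<exists>r. strict_mono r \<and> (\<forall>e\<in>K. \<exists>l\<in>{0..1}. (\<lambda>n. s (r n) e) \<longlonglongrightarrow> l)"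
  using assms(1)
proof (induction K rule: finite_induct)
  case empty
  show ?case using strict_mono_id by blast
next
  case (insert e K)
  then obtain r where r: "strict_mono r" "\<forall>e\<in>K. \<exists>l\<in>{0..1}. (\<lambda>n. s (r n) e) \<longlonglongrightarrow> l" by blast
  have "seq_compact {0..1::real}" using compact_Icc compact_imp_seq_compact by blast
  then obtain l r' where r': "l \<in> {0..1}" "strict_mono r'" "((\<lambda>n. s (r n) e) \<circ> r') \<longlonglongrightarrow> l"
    using seq_compactE[of "{0..1}" "\<lambda>n. s (r n) e"] assms(2) by (metis atLeastAtMost_iff)
  have "\<exists>l\<in>{0..1}. (\<lambda>n. s ((r \<circ> r') n) e') \<longlonglongrightarrow> l" if e': "e' \<in> insert e K" for e'
  proof (cases "e' = e")
    case True
    thus ?thesis using r' by (auto simp: o_def)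
  next
    case False
    then obtain l' where "l' \<in> {0..1}" "(\<lambda>n. s (r n) e') \<longlonglongrightarrow> l'" using r(2) e' by auto
    thus ?thesis using LIMSEQ_subseq_LIMSEQ[of "\<lambda>n. s (r n) e'" l' r'] r'(2) by (auto simp: o_def)
  qed
  thus ?case using strict_mono_o[OF r(1) r'(2)] by blast
qed

section \<open>Events, fractional configurations and their chain metric\<close>

definition midpoint_fun :: "('e \<Rightarrow> real) \<Rightarrow> ('e \<Rightarrow> real) \<Rightarrow> 'e \<Rightarrow> real" where
  "midpoint_fun x y = (\<lambda>e. (x e + y e) / 2)"

text \<open>Prime event structures in the sense of Winskel: \<open>lt b a\<close> says that
  \<open>b\<close> is a cause of \<open>a\<close>, and \<open>cf\<close> is conflict, inherited by
  effects.\<close>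

locale event_structure =
  fixes E :: "'e set" and lt cf :: "'e \<Rightarrow> 'e \<Rightarrow> bool"
  assumes lt_trans: "a \<in> E \<Longrightarrow> b \<in> E \<Longrightarrow> c \<in> E \<Longrightarrow> lt a b \<Longrightarrow> lt b c \<Longrightarrow> lt a c"
    and lt_irrefl: "\<not> lt a a"
    and finite_causes: "a \<in> E \<Longrightarrow> finite {b\<in>E. lt b a}"
    and cf_irrefl: "a \<in> E \<Longrightarrow> \<not> cf a a"
    and cf_sym: "cf a b \<Longrightarrow> cf b a"
    and cf_hereditary: "a \<in> E \<Longrightarrow> b \<in> E \<Longrightarrow> c \<in> E \<Longrightarrow> cf a b \<Longrightarrow> lt a c \<Longrightarrow> cf c b"
begin

text \<open>Configurations with fractional weights: an event may start only when all its causes are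
  complete, and of two events in conflict at most one may start. Weights 0 and 1 give the
  vertices.\<close>

definition points :: "('e \<Rightarrow> real) set" where
  "points = {x. finite {e. x e \<noteq> 0} \<and> (\<forall>e. 0 \<le> x e \<and> x e \<le> 1) \<and> (\<forall>e. e \<notin> E \<longrightarrow> x e = 0) \<and>
     (\<forall>a\<in>E. \<forall>b\<in>E. lt b a \<longrightarrow> 0 < x a \<longrightarrow> x b = 1) \<and>
     (\<forall>a\<in>E. \<forall>b\<in>E. cf a b \<longrightarrow> x a = 0 \<or> x b = 0)}"

definition adjacent :: "('e \<Rightarrow> real) \<Rightarrow> ('e \<Rightarrow> real) \<Rightarrow> bool" where
  "adjacent x y \<longleftrightarrow> x \<in> points \<and> y \<in> points \<and> midpoint_fun x y \<in> points"

lemma pointsI: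
  assumes "finite {e. x e \<noteq> 0}" "\<And>e. 0 \<le> x e" "\<And>e. x e \<le> 1" "\<And>e. e \<notin> E \<Longrightarrow> x e = 0"
    "\<And>a b. a \<in> E \<Longrightarrow> b \<in> E \<Longrightarrow> lt b a \<Longrightarrow> 0 < x a \<Longrightarrow> x b = 1"
    "\<And>a b. a \<in> E \<Longrightarrow> b \<in> E \<Longrightarrow> cf a b \<Longrightarrow> 0 < x a \<Longrightarrow> 0 < x b \<Longrightarrow> False"
  shows "x \<in> points"
  unfolding points_def mem_Collect_eq
proof (intro conjI allI ballI impI)
  show "x a = 0 \<or> x b = 0" if "a \<in> E" "b \<in> E" "cf a b" for a b
    using assms(6)[OF that] assms(2)[of a] assms(2)[of b] by (auto simp: less_le)
qed (use assms in auto)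

lemma pointsD:
  assumes "x \<in> points"
  shows "finite {e. x e \<noteq> 0}" "0 \<le> x e" "x e \<le> 1" "e \<notin> E \<Longrightarrow> x e = 0"
    "a \<in> E \<Longrightarrow> b \<in> E \<Longrightarrow> lt b a \<Longrightarrow> 0 < x a \<Longrightarrow> x b = 1"
    "a \<in> E \<Longrightarrow> b \<in> E \<Longrightarrow> cf a b \<Longrightarrow> 0 < x a \<Longrightarrow> x b = 0"
proof -
  show "finite {e. x e \<noteq> 0}" "0 \<le> x e" "x e \<le> 1" using assms by (simp_all add: points_def)
  show "x e = 0" if "e \<notin> E" using assms that by (simp add: points_def)
  show "x b = 1" if "a \<in> E" "b \<in> E" "lt b a" "0 < x a" using assms that by (simp add: points_def)
  show "x b = 0" if "a \<in> E" "b \<in> E" "cf a b" "0 < x a"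
  proof -
    have "x a = 0 \<or> x b = 0" using assms that(1-3) unfolding points_def by blast
    thus ?thesis using that(4) by auto
  qed
qed

lemma finite_diff_points: "x \<in> points \<Longrightarrow> y \<in> points \<Longrightarrow> finite {e. x e \<noteq> y e}"
  by (rule finite_subset[of _ "{e. x e \<noteq> 0} \<union> {e. y e \<noteq> 0}"]) (auto dest: pointsD(1))

text \<open>An event in the support already has its causes complete and its conflicts empty; if no
  started event depends on it, its weight is free.\<close>

lemma update_maximal:
  assumes x: "x \<in> points" and h: "h \<in> E" "0 < x h" "\<And>e. 0 < x e \<Longrightarrow> \<not> lt h e" and r: "0 \<le> r" "r \<le> 1"
  shows "x(h := r) \<in> points"
proof (rule pointsI)
  show "finite {e. (x(h := r)) e \<noteq> 0}"
    by (rule finite_subset[of _ "insert h {e. x e \<noteq> 0}"]) (use pointsD(1)[OF x] in auto)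
  show "(x(h := r)) b = 1" if "a \<in> E" "b \<in> E" "lt b a" "0 < (x(h := r)) a" for a b
    using that h pointsD(5)[OF x, of a b] lt_irrefl by (auto split: if_splits)
  show False if "a \<in> E" "b \<in> E" "cf a b" "0 < (x(h := r)) a" "0 < (x(h := r)) b" for a b
    using that h cf_irrefl[of h] pointsD(6)[OF x, of a b] pointsD(6)[OF x, of b a] cf_sym[of a b]
    by (auto split: if_splits)
qed (use pointsD(2-4)[OF x] h(1) r in \<open>auto split: if_splits\<close>)

lemma maximal_exists:
  assumes "finite K" "K \<subseteq> E" "K \<noteq> {}"
  shows "\<exists>h\<in>K. \<forall>e\<in>K. \<not> lt h e"
proof -
  have "asymp_on K lt" "transp_on K lt"
    using assms lt_trans lt_irrefl by (auto intro!: asymp_onI transp_onI) (metis subsetD)+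
  thus ?thesis
    using Finite_Set.bex_max_element[OF assms(1) _ _ assms(3), of lt] lt_irrefl by metis
qed

text \<open>Connectedness: a maximal event of the support is emptied first. This stays in one cube
  because the midpoint changes the same single coordinate.\<close>

lemma chain_to_origin: "x \<in> points \<Longrightarrow> \<exists>L. chain adjacent coord_dist x (\<lambda>_. 0) L"
proof (induction "card {e. x e \<noteq> 0}" arbitrary: x rule: less_induct)
  case less
  note x = less.prems
  show ?case
  proof (cases "x = (\<lambda>_. 0)")
    case True thus ?thesis using chain_refl[of adjacent coord_dist "\<lambda>_. 0"] by auto
  next
    case False
    have "{e. x e \<noteq> 0} \<subseteq> E" using pointsD(4)[OF x] by auto
    then obtain h where h: "x h \<noteq> 0" "\<And>e. x e \<noteq> 0 \<Longrightarrow> \<not> lt h e"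
      using maximal_exists[OF pointsD(1)[OF x]] False by (auto simp: fun_eq_iff)
    have hE: "h \<in> E" "0 < x h" using h(1) pointsD(2,4)[OF x, of h] by (auto simp: less_le)
    have up: "x(h := r) \<in> points" if "0 \<le> r" "r \<le> 1" for r
      using update_maximal[OF x hE _ that] h(2) by force
    have "midpoint_fun x (x(h := 0)) = x(h := x h / 2)" by (auto simp: midpoint_fun_def)
    hence adj: "adjacent x (x(h := 0))"
      using x up[of 0] up[of "x h / 2"] pointsD(2,3)[OF x, of h] by (simp add: adjacent_def)
    have "{e. (x(h := 0)) e \<noteq> 0} \<subset> {e. x e \<noteq> 0}" using h(1) by auto
    hence less: "card {e. (x(h := 0)) e \<noteq> 0} < card {e. x e \<noteq> 0}"
      using pointsD(1)[OF x] by (rule psubset_card_mono[rotated])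
    obtain L where "chain adjacent coord_dist (x(h := 0)) (\<lambda>_. 0) L"
      using less.hyps[OF less up[of 0]] by auto
    thus ?thesis using chain_trans[OF _ chain_one[of adjacent, OF adj]] by blast
  qed
qed

lemma adjacent_sym: "adjacent x y \<Longrightarrow> adjacent y x"
  by (simp add: adjacent_def midpoint_fun_def add.commute)

sublocale chain_space points adjacent coord_dist
proof
  show "coord_dist x y = 0 \<longleftrightarrow> x = y" if "x \<in> points" "y \<in> points" for x y
  proof
    assume 0: "coord_dist x y = 0"
    show "x = y" using coord_dist_abs_le[OF finite_diff_points[OF that]] 0 by (force simp: fun_eq_iff)
  qed (simp add: coord_dist_def)
  show "\<exists>L. chain adjacent coord_dist x y L" if "x \<in> points" "y \<in> points" for x y
  proof -
    obtain L where L: "chain adjacent coord_dist x (\<lambda>_. 0) L"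
      using chain_to_origin[OF \<open>x \<in> points\<close>] by blast
    obtain L' where L': "chain adjacent coord_dist y (\<lambda>_. 0) L'"
      using chain_to_origin[OF \<open>y \<in> points\<close>] by blast
    have "chain adjacent coord_dist (\<lambda>_. 0) y L'"
      by (rule chain_sym[OF adjacent_sym coord_dist_commute L'])
    thus ?thesis using chain_trans[OF _ L] by blast
  qed
  show "x \<in> points \<and> y \<in> points" if "adjacent x y" for x y
    using that by (simp add: adjacent_def)
  show "coord_dist x z \<le> coord_dist x y + coord_dist y z" if "x \<in> points" "y \<in> points" "z \<in> points" for x y z
    using that by (intro coord_dist_triangle finite_diff_points)
qed (fact adjacent_sym coord_dist_nonneg coord_dist_commute)+

section \<open>Finite parts of the complex\<close>

definition causal :: "'e set \<Rightarrow> bool" where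
  "causal K \<longleftrightarrow> finite K \<and> K \<subseteq> E \<and> (\<forall>a\<in>K. \<forall>b\<in>E. lt b a \<longrightarrow> b \<in> K)"

definition points_on :: "'e set \<Rightarrow> ('e \<Rightarrow> real) set" where
  "points_on K = {x \<in> points. \<forall>e. e \<notin> K \<longrightarrow> x e = 0}"

lemma points_on_subset: "points_on K \<subseteq> points"
  by (auto simp: points_on_def)

text \<open>Commuting with midpoints keeps steps inside cubes, and contracting each coordinate
  bounds their length. Both \<open>restr K\<close> and \<open>retr\<close> are maps of this
  kind.\<close>

lemma affine_map_adjacent:
  assumes "\<And>x. x \<in> points \<Longrightarrow> \<phi> x \<in> points"
    and "\<And>x y. midpoint_fun (\<phi> x) (\<phi> y) = \<phi> (midpoint_fun x y)"
    and "\<And>x y e. \<bar>\<phi> x e - \<phi> y e\<bar> \<le> \<bar>x e - y e\<bar>"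
    and "adjacent x y"
  shows "adjacent (\<phi> x) (\<phi> y) \<and> coord_dist (\<phi> x) (\<phi> y) \<le> coord_dist x y"
  using assms finite_diff_points by (auto simp: adjacent_def intro!: coord_dist_mono)

definition restr :: "'e set \<Rightarrow> ('e \<Rightarrow> real) \<Rightarrow> 'e \<Rightarrow> real" where
  "restr K x = (\<lambda>e. if e \<in> K then x e else 0)"

lemma restr_points_on:
  assumes K: "causal K" and x: "x \<in> points"
  shows "restr K x \<in> points_on K"
proof -
  have "restr K x \<in> points"
  proof (rule pointsI)
    show "finite {e. restr K x e \<noteq> 0}"
      using K by (rule_tac finite_subset[of _ K]) (auto simp: causal_def restr_def)
    show "restr K x b = 1" if "a \<in> E" "b \<in> E" "lt b a" "0 < restr K x a" for a b
      using that K pointsD(5)[OF x, of a b] by (auto simp: causal_def restr_def split: if_splits)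
    show False if "a \<in> E" "b \<in> E" "cf a b" "0 < restr K x a" "0 < restr K x b" for a b
      using that pointsD(6)[OF x, of a b] by (auto simp: restr_def split: if_splits)
  qed (use pointsD(2-4)[OF x] in \<open>auto simp: restr_def\<close>)
  thus ?thesis by (simp add: points_on_def restr_def)
qed

text \<open>Chains can be confined to a finite part without lengthening them, so the distances of
  that part may be measured in all of \<open>points\<close>.\<close>

lemma restr_adjacent:
  assumes "causal K" "adjacent x y"
  shows "adjacent (restr K x) (restr K y) \<and> coord_dist (restr K x) (restr K y) \<le> coord_dist x y"
  by (rule affine_map_adjacent[OF _ _ _ assms(2)])
    (use restr_points_on[OF assms(1)] in \<open>auto simp: points_on_def restr_def midpoint_fun_def\<close>)

text \<open>One layer of causes is enough, by transitivity.\<close>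

lemma causal_hull:
  assumes "finite K" "K \<subseteq> E"
  shows "causal (K \<union> (\<Union>a\<in>K. {b\<in>E. lt b a}))"
  unfolding causal_def
proof (intro conjI ballI impI)
  fix a b assume H: "a \<in> K \<union> (\<Union>a\<in>K. {b \<in> E. lt b a})" "b \<in> E" "lt b a"
  show "b \<in> K \<union> (\<Union>a\<in>K. {b \<in> E. lt b a})"
  proof (cases "a \<in> K")
    case False
    then obtain c where "c \<in> K" "a \<in> E" "lt a c" using H(1) by blast
    thus ?thesis using lt_trans[of b a c] H assms(2) by blast
  qed (use H in blast)
qed (use assms finite_causes in auto)

text \<open>Bolzano-Weierstrass gives coordinatewise limits. Convergence in \<open>cdist\<close>,
  which is only bounded below by \<open>coord_dist\<close>, follows because almost all terms share a
  cube with the limit.\<close>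

lemma points_on_compact:
  assumes K: "causal K" and s: "\<And>n::nat. s n \<in> points_on K"
  shows "\<exists>l r. l \<in> points_on K \<and> strict_mono r \<and> (\<lambda>n. cdist (s (r n)) l) \<longlonglongrightarrow> 0 \<and>
    (\<forall>e. (\<lambda>n. s (r n) e) \<longlonglongrightarrow> l e)"
proof -
  have finK: "finite K" and KE: "K \<subseteq> E" using K by (auto simp: causal_def)
  have sp: "s n \<in> points" and s0: "e \<notin> K \<Longrightarrow> s n e = 0" for n e
    using s by (auto simp: points_on_def)
  obtain r where r: "strict_mono r" "\<forall>e\<in>K. \<exists>l\<in>{0..1}. (\<lambda>n. s (r n) e) \<longlonglongrightarrow> l"
    using coordinatewise_subsequence[OF finK, of s] pointsD(2,3)[OF sp] by blast
  then obtain l' where l': "\<And>e. e \<in> K \<Longrightarrow> l' e \<in> {0..1} \<and> (\<lambda>n. s (r n) e) \<longlonglongrightarrow> l' e" by metis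
  define l where "l = restr K l'"
  have lim: "(\<lambda>n. s (r n) e) \<longlonglongrightarrow> l e" for e
    using l'[of e] s0 by (cases "e \<in> K") (auto simp: l_def restr_def)
  have l01: "0 \<le> l e" "l e \<le> 1" and l0: "e \<notin> K \<Longrightarrow> l e = 0" for e
    using l'[of e] by (auto simp: l_def restr_def)
  have ev: "\<forall>\<^sub>F n in sequentially. \<forall>e\<in>K. (0 < l e \<longrightarrow> 0 < s (r n) e) \<and> (l e < 1 \<longrightarrow> s (r n) e < 1)"
  proof (intro eventually_ball_finite[OF finK] ballI eventually_conj)
    fix e
    show "\<forall>\<^sub>F n in sequentially. 0 < l e \<longrightarrow> 0 < s (r n) e"
      using order_tendstoD(1)[OF lim, of 0 e] by (cases "0 < l e") auto
    show "\<forall>\<^sub>F n in sequentially. l e < 1 \<longrightarrow> s (r n) e < 1"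
      using order_tendstoD(2)[OF lim, of e 1] by (cases "l e < 1") auto
  qed
  \<comment> \<open>A near term has started every event that the limit has started and completed
    none that the limit has left incomplete.\<close>
  define near where "near n \<longleftrightarrow> (\<forall>e\<in>K. (0 < l e \<longrightarrow> 0 < s (r n) e) \<and> (l e < 1 \<longrightarrow> s (r n) e < 1))" for n
  have ev': "\<forall>\<^sub>F n in sequentially. near n"
    using ev by (simp add: near_def)
  have near_pos: "0 < s (r n) e" if "near n" "0 < l e" for n e
    using that l0[of e] by (cases "e \<in> K") (auto simp: near_def)
  have near_one: "l b = 1" if "near n" "a \<in> E" "b \<in> E" "lt b a" "0 < s (r n) a" for a b n
  proof -
    have "a \<in> K" using that(5) s0[of a "r n"] by (cases "a \<in> K") auto
    hence "b \<in> K" using K that(3,4) by (auto simp: causal_def)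
    moreover have "s (r n) b = 1" using pointsD(5)[OF sp that(2-5)] .
    ultimately have "\<not> l b < 1" using that(1) by (auto simp: near_def)
    thus ?thesis using l01[of b] by simp
  qed
  have lp: "l \<in> points"
  proof (rule pointsI)
    show "finite {e. l e \<noteq> 0}" by (rule finite_subset[OF _ finK]) (use l0 in auto)
    obtain n where n: "near n" using eventually_happens'[OF _ ev'] by auto
    show "l b = 1" if "a \<in> E" "b \<in> E" "lt b a" "0 < l a" for a b
      by (rule near_one[OF n that(1-3) near_pos[OF n that(4)]])
    show False if "a \<in> E" "b \<in> E" "cf a b" "0 < l a" "0 < l b" for a b
      using pointsD(6)[OF sp that(1-3) near_pos[OF n that(4)]] near_pos[OF n that(5)] by simp
    show "l e = 0" if "e \<notin> E" for e using l0 KE that by blast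
  qed (rule l01)+
  hence lon: "l \<in> points_on K" using l0 by (simp add: points_on_def)
  \<comment> \<open>The midpoint with a near term is supported where that term is, and by
    \<open>near_one\<close> the causes are complete in the limit too.\<close>
  have adj: "\<forall>\<^sub>F n in sequentially. adjacent (s (r n)) l"
    using ev'
  proof (rule eventually_mono)
    fix n assume n: "near n"
    let ?m = "midpoint_fun (s (r n)) l"
    have pos: "0 < s (r n) e" if "0 < ?m e" for e
    proof (cases "0 < l e")
      case False
      hence "l e = 0" using l01(1)[of e] by simp
      thus ?thesis using that by (simp add: midpoint_fun_def)
    qed (rule near_pos[OF n])
    have "?m \<in> points"
    proof (rule pointsI)
      show "finite {e. ?m e \<noteq> 0}"
      proof (rule finite_subset[OF _ finK], rule subsetI, rule ccontr)
        fix e assume "e \<in> {e. ?m e \<noteq> 0}" "e \<notin> K"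
        thus False using l0[of e] s0[of e "r n"] by (simp add: midpoint_fun_def)
      qed
      show "?m b = 1" if "a \<in> E" "b \<in> E" "lt b a" "0 < ?m a" for a b
        using near_one[OF n that(1-3) pos[OF that(4)]] pointsD(5)[OF sp that(1-3) pos[OF that(4)]]
        by (simp add: midpoint_fun_def)
      show False if "a \<in> E" "b \<in> E" "cf a b" "0 < ?m a" "0 < ?m b" for a b
        using pointsD(6)[OF sp that(1-3) pos[OF that(4)]] pos[OF that(5)] by simp
      show "?m e = 0" if "e \<notin> E" for e
        using pointsD(4)[OF sp that] pointsD(4)[OF lp that] by (simp add: midpoint_fun_def)
      show "0 \<le> ?m e" "?m e \<le> 1" for e
        using l01[of e] pointsD(2,3)[OF sp, of "r n" e] by (simp_all add: midpoint_fun_def)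
    qed
    thus "adjacent (s (r n)) l" using sp lp by (simp add: adjacent_def)
  qed
  have "(\<lambda>n. L2_set (\<lambda>e. s (r n) e - l e) K) \<longlonglongrightarrow> sqrt (\<Sum>e\<in>K. (l e - l e)\<^sup>2)"
    unfolding L2_set_def by (intro tendsto_intros lim)
  moreover have "coord_dist (s (r n)) l = L2_set (\<lambda>e. s (r n) e - l e) K" for n
    by (rule coord_dist_eq[OF finK]) (use s0 l0 in force)
  ultimately have lim0: "(\<lambda>n. coord_dist (s (r n)) l) \<longlonglongrightarrow> 0" by simp
  have "(\<lambda>n. cdist (s (r n)) l) \<longlonglongrightarrow> 0"
  proof (rule tendsto_sandwich[OF _ _ tendsto_const lim0])
    show "\<forall>\<^sub>F n in sequentially. cdist (s (r n)) l \<le> coord_dist (s (r n)) l"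
      by (rule eventually_mono[OF adj cdist_adj_le])
  qed simp
  thus ?thesis using lon r(1) lim by blast
qed

end

section \<open>Attaching a prism\<close>

lemma sqrt_sum_squares_scale:
  fixes l s :: real
  assumes "0 \<le> l"
  shows "sqrt (l\<^sup>2 + (s * l)\<^sup>2) = l * sqrt (1 + s\<^sup>2)"
proof -
  have "l\<^sup>2 + (s * l)\<^sup>2 = l\<^sup>2 * (1 + s\<^sup>2)" by (simp add: algebra_simps power_mult_distrib)
  thus ?thesis using assms by (simp add: real_sqrt_mult)
qed

locale event_extension = event_structure +
  fixes K :: "'a set" and h :: 'a
  assumes causal_K: "causal K" and causal_insert: "causal (insert h K)"
    and h_notin: "h \<notin> K" and h_maximal: "\<And>b. b \<in> K \<Longrightarrow> \<not> lt h b"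
begin

lemma h_in: "h \<in> E"
  using causal_insert by (auto simp: causal_def)

text \<open>The subcomplex of \<open>points_on K\<close> along which the prism of cubes in direction \<open>h\<close> is attached.\<close>
definition link :: "('a \<Rightarrow> real) set" where
  "link = {x \<in> points_on K. \<forall>b\<in>E. (lt b h \<longrightarrow> x b = 1) \<and> (cf b h \<longrightarrow> x b = 0)}"

definition prism :: "('a \<Rightarrow> real) set" where
  "prism = {x \<in> points_on (insert h K). x(h := 0) \<in> link}"

text \<open>The retraction onto \<open>link\<close>. The order of the tests does not matter: by
  heredity, a cause of \<open>h\<close> in conflict with \<open>h\<close> would put \<open>h\<close>
  in conflict with itself.\<close>

definition retr :: "('a \<Rightarrow> real) \<Rightarrow> 'a \<Rightarrow> real" where
  "retr x = (\<lambda>e. if e \<notin> K then 0 else if lt e h then 1 else if cf e h then 0 else x e)"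

lemma link_subset: "link \<subseteq> points_on K" "link \<subseteq> points"
  using points_on_subset by (auto simp: link_def)

lemma link_h: "x \<in> link \<Longrightarrow> x h = 0"
  using h_notin by (auto simp: link_def points_on_def)

text \<open>Causes of causes of \<open>h\<close> are causes of \<open>h\<close>, so raising them to
  1 respects causality. Heredity does the rest: the effects of an emptied event conflict with
  \<open>h\<close> and are emptied, and so is whatever conflicts with a cause of
  \<open>h\<close>.\<close>

lemma retr_link:
  assumes x: "x \<in> points"
  shows "retr x \<in> link"
proof -
  have KE: "K \<subseteq> E" and finK: "finite K" using causal_K by (auto simp: causal_def)
  have "retr x \<in> points"
  proof (rule pointsI)
    show "finite {e. retr x e \<noteq> 0}"
      by (rule finite_subset[OF _ finK]) (auto simp: retr_def split: if_splits)
    show "retr x b = 1" if ab: "a \<in> E" "b \<in> E" "lt b a" "0 < retr x a" for a b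
    proof -
      have a: "a \<in> K" "\<not> cf a h \<or> lt a h" using ab(4) by (auto simp: retr_def split: if_splits)
      hence b: "b \<in> K" using causal_K ab by (auto simp: causal_def)
      show ?thesis
      proof (cases "lt a h")
        case True
        hence "lt b h" using lt_trans ab h_in by blast
        thus ?thesis using b by (simp add: retr_def)
      next
        case False
        hence "0 < x a" using ab(4) a by (auto simp: retr_def split: if_splits)
        hence "x b = 1" using pointsD(5)[OF x ab(1-3)] by simp
        moreover have "\<not> cf b h" using cf_hereditary[OF ab(2) h_in ab(1) _ ab(3)] a False by blast
        ultimately show ?thesis using b by (simp add: retr_def)
      qed
    qed
    have lt_cf: "retr x b = 0" if "a \<in> E" "b \<in> E" "cf a b" "lt a h" for a b
    proof -
      have "cf b h" using cf_hereditary[OF that(1,2) h_in that(3,4)] cf_sym by blast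
      moreover have "\<not> lt b h"
        using cf_hereditary[OF that(2) h_in h_in calculation] cf_irrefl[OF h_in] by blast
      ultimately show ?thesis by (simp add: retr_def)
    qed
    show False if ab: "a \<in> E" "b \<in> E" "cf a b" "0 < retr x a" "0 < retr x b" for a b
    proof -
      have "\<not> lt a h" "\<not> lt b h"
        using lt_cf[OF ab(1-3)] lt_cf[OF ab(2,1) cf_sym[OF ab(3)]] ab by auto
      hence "0 < x a" "0 < x b" using ab by (auto simp: retr_def split: if_splits)
      thus False using pointsD(6)[OF x ab(1-3)] by simp
    qed
  qed (use pointsD(2-4)[OF x] KE in \<open>auto simp: retr_def\<close>)
  moreover have "retr x b = 1" if "b \<in> E" "lt b h" for b
    using causal_insert h_notin lt_irrefl that by (auto simp: causal_def retr_def)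
  moreover have "retr x b = 0" if "b \<in> E" "cf b h" for b
    using cf_hereditary[OF that(1) h_in h_in that(2)] cf_irrefl[OF h_in] that by (auto simp: retr_def)
  ultimately show ?thesis by (auto simp: link_def points_on_def) (simp add: retr_def)
qed

lemma retr_id: "x \<in> link \<Longrightarrow> retr x = x"
  using causal_K by (auto simp: link_def points_on_def retr_def causal_def fun_eq_iff)

lemma retr_adjacent:
  assumes "adjacent x y"
  shows "adjacent (retr x) (retr y) \<and> coord_dist (retr x) (retr y) \<le> coord_dist x y"
  by (rule affine_map_adjacent[OF _ _ _ assms])
    (use retr_link link_subset in \<open>auto simp: retr_def midpoint_fun_def\<close>)

section \<open>The prism as product of the link and an interval\<close>

lemma restr_eq: "x \<in> points_on (insert h K) \<Longrightarrow> restr K x = x(h := 0)"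
  using h_notin by (auto simp: restr_def points_on_def fun_eq_iff)

lemma prism_points: "x \<in> prism \<Longrightarrow> x \<in> points"
  by (simp add: prism_def points_on_def)

text \<open>Membership in \<open>link\<close> is what a positive weight on \<open>h\<close> demands
  of the other coordinates, and \<open>h\<close> is a cause of nothing in \<open>K\<close>; so the
  weight of \<open>h\<close> is free.\<close>

lemma link_update:
  assumes x: "x \<in> link" and r: "0 \<le> r" "r \<le> 1"
  shows "x(h := r) \<in> prism"
proof -
  have xp: "x \<in> points" using x link_subset by auto
  have xh: "x(h := 0) = x" using link_h[OF x] by auto
  have "x(h := r) \<in> points"
  proof (rule pointsI)
    show "finite {e. (x(h := r)) e \<noteq> 0}"
      by (rule finite_subset[of _ "insert h {e. x e \<noteq> 0}"]) (use pointsD(1)[OF xp] in auto)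
    show "(x(h := r)) b = 1" if ab: "a \<in> E" "b \<in> E" "lt b a" "0 < (x(h := r)) a" for a b
    proof (cases "a = h")
      case True
      thus ?thesis using x ab lt_irrefl by (auto simp: link_def)
    next
      case False
      hence a: "0 < x a" using ab by simp
      hence "a \<in> K" using x by (auto simp: link_def points_on_def)
      hence "b \<noteq> h" using h_maximal ab by auto
      thus ?thesis using pointsD(5)[OF xp ab(1-3) a] by simp
    qed
    show False if ab: "a \<in> E" "b \<in> E" "cf a b" "0 < (x(h := r)) a" "0 < (x(h := r)) b" for a b
    proof -
      consider "a = h" "b = h" | "a = h" "b \<noteq> h" | "a \<noteq> h" "b = h" | "a \<noteq> h" "b \<noteq> h" by blast
      thus False
      proof cases
        case 1 thus ?thesis using cf_irrefl ab by auto
      next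
        case 2
        hence "x b = 0" using x ab cf_sym[OF ab(3)] by (auto simp: link_def)
        thus ?thesis using 2 ab by simp
      next
        case 3
        hence "x a = 0" using x ab by (auto simp: link_def)
        thus ?thesis using 3 ab by simp
      next
        case 4 thus ?thesis using pointsD(6)[OF xp ab(1-3)] ab by simp
      qed
    qed
  qed (use pointsD(2-4)[OF xp] r h_in in auto)
  thus ?thesis using x xh by (auto simp: prism_def points_on_def link_def lt_irrefl)
qed

lemma prism_cases: "x \<in> prism \<Longrightarrow> \<exists>y\<in>link. \<exists>r. 0 \<le> r \<and> r \<le> 1 \<and> x = y(h := r)"
  using pointsD(2,3)[OF prism_points, of x h]
  by (intro bexI[of _ "x(h := 0)"] exI[of _ "x h"]) (auto simp: prism_def)

lemma link_of_positive:
  assumes x: "x \<in> points" and b: "b \<in> E" and pos: "0 < x h"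
  shows "lt b h \<Longrightarrow> x b = 1" "cf b h \<Longrightarrow> x b = 0"
  using pointsD(5)[OF x h_in b _ pos] pointsD(6)[OF x h_in b cf_sym pos] by auto

lemma points_on_insert: "points_on (insert h K) = points_on K \<union> prism"
proof (intro equalityI subsetI)
  fix x assume x: "x \<in> points_on (insert h K)"
  hence xp: "x \<in> points" using points_on_subset by auto
  show "x \<in> points_on K \<union> prism"
  proof (cases "x h = 0")
    case True
    have "x e = 0" if "e \<notin> K" for e using x True that by (cases "e = h") (auto simp: points_on_def)
    thus ?thesis using xp by (simp add: points_on_def)
  next
    case False
    hence pos: "0 < x h" using pointsD(2)[OF xp, of h] by simp
    have "x(h := 0) \<in> points_on K"
      using restr_points_on[OF causal_K xp] restr_eq[OF x] by simp
    moreover have "(x(h := 0)) b = 1" if "b \<in> E" "lt b h" for b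
      using link_of_positive(1)[OF xp that(1) pos that(2)] that(2) lt_irrefl by auto
    moreover have "(x(h := 0)) b = 0" if "b \<in> E" "cf b h" for b
      using link_of_positive(2)[OF xp that(1) pos that(2)] by simp
    ultimately show ?thesis using x by (simp add: prism_def link_def)
  qed
qed (auto simp: points_on_def prism_def)

lemma points_on_Int_prism: "points_on K \<inter> prism = link"
proof (intro equalityI subsetI)
  fix x assume x: "x \<in> points_on K \<inter> prism"
  hence "x(h := 0) = x" using h_notin by (auto simp: points_on_def)
  thus "x \<in> link" using x by (auto simp: prism_def)
next
  fix x assume x: "x \<in> link"
  hence "x(h := 0) = x" using link_h by auto
  thus "x \<in> points_on K \<inter> prism" using x by (auto simp: prism_def points_on_def link_def lt_irrefl)
qed

text \<open>The lower bound for the product metric. Each step gives a plane vector, formed by its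
  length after \<open>restr K\<close> and its change in \<open>h\<close>, and the triangle
  inequality in the plane adds these up. Coordinates outside \<open>insert h K\<close> are dropped,
  hence an inequality for each step.\<close>

lemma chain_project:
  "chain adjacent coord_dist x y L \<Longrightarrow> x \<in> points \<Longrightarrow>
    \<exists>L1. chain adjacent coord_dist (restr K x) (restr K y) L1 \<and> sqrt (L1\<^sup>2 + (x h - y h)\<^sup>2) \<le> L"
proof (induction rule: chain.induct)
  case (chain_refl x)
  show ?case by (rule exI[of _ 0]) (simp add: chain.chain_refl)
next
  case (chain_step x y L z)
  then obtain L1 where L1: "chain adjacent coord_dist (restr K x) (restr K y) L1"
      "sqrt (L1\<^sup>2 + (x h - y h)\<^sup>2) \<le> L" by blast
  have yz: "y \<in> points" "z \<in> points" using chain_step(2) by (auto simp: adjacent_def)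
  note adj = restr_adjacent[OF causal_K chain_step(2)]
  have fin: "finite {e. (y(h := 0)) e \<noteq> (z(h := 0)) e}"
    by (rule finite_subset[OF _ finite_diff_points[OF yz]]) auto
  have "coord_dist (restr K y) (restr K z) \<le> coord_dist (y(h := 0)) (z(h := 0))"
    by (rule coord_dist_mono[OF fin]) (use h_notin in \<open>auto simp: restr_def\<close>)
  hence "sqrt ((coord_dist (restr K y) (restr K z))\<^sup>2 + (y h - z h)\<^sup>2) \<le> coord_dist y z"
    unfolding coord_dist_split[OF finite_diff_points[OF yz], of h 0]
    by (intro real_sqrt_le_mono add_right_mono power_mono) (auto simp: coord_dist_nonneg)
  moreover have "sqrt ((L1 + coord_dist (restr K y) (restr K z))\<^sup>2 + ((x h - y h) + (y h - z h))\<^sup>2)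
      \<le> sqrt (L1\<^sup>2 + (x h - y h)\<^sup>2) + sqrt ((coord_dist (restr K y) (restr K z))\<^sup>2 + (y h - z h)\<^sup>2)"
    by (rule real_sqrt_sum_squares_triangle_ineq)
  ultimately have "sqrt ((L1 + coord_dist (restr K y) (restr K z))\<^sup>2 + (x h - z h)\<^sup>2) \<le> L + coord_dist y z"
    using L1(2) by simp
  moreover have "chain adjacent coord_dist (restr K x) (restr K z) (L1 + coord_dist (restr K y) (restr K z))"
    using chain.chain_step[OF L1(1)] adj by blast
  ultimately show ?case by blast
qed

text \<open>The upper bound for the product metric: a chain in the link is lifted so that
  \<open>h\<close> changes in proportion to the length covered, with slope \<open>s\<close>. Every
  step is then stretched by the same factor.\<close>

lemma chain_lift:
  "chain (\<lambda>x y. adjacent x y \<and> x \<in> link \<and> y \<in> link) coord_dist x y L \<Longrightarrow> x \<in> link \<Longrightarrow>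
    0 \<le> r \<Longrightarrow> r \<le> 1 \<Longrightarrow> 0 \<le> r + s * L \<Longrightarrow> r + s * L \<le> 1 \<Longrightarrow>
    chain adjacent coord_dist (x(h := r)) (y(h := r + s * L)) (L * sqrt (1 + s\<^sup>2))"
proof (induction rule: chain.induct)
  case (chain_refl x)
  show ?case by (simp add: chain.chain_refl)
next
  case (chain_step x y L z)
  let ?l = "coord_dist y z"
  have L: "0 \<le> L" by (rule chain_nonneg[OF coord_dist_nonneg chain_step(1)])
  have l: "0 \<le> ?l" by (rule coord_dist_nonneg)
  have adj: "adjacent y z" "y \<in> link" "z \<in> link" using chain_step(2) by auto
  \<comment> \<open>The intermediate height lies between the two end heights, whatever the sign of
    \<open>s\<close>.\<close>
  have rL: "0 \<le> r + s * L \<and> r + s * L \<le> 1"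
  proof (cases "0 \<le> s")
    case True
    hence "0 \<le> s * L" "0 \<le> s * ?l" using L l by auto
    thus ?thesis using chain_step.prems by (simp add: distrib_left)
  next
    case False
    hence "s * L \<le> 0" "s * ?l \<le> 0" using L l by (auto simp: mult_nonpos_nonneg)
    thus ?thesis using chain_step.prems by (simp add: distrib_left)
  qed
  hence c: "chain adjacent coord_dist (x(h := r)) (y(h := r + s * L)) (L * sqrt (1 + s\<^sup>2))"
    using chain_step.IH chain_step.prems by blast
  let ?y = "y(h := r + s * L)" and ?z = "z(h := r + s * (L + ?l))"
  have yz: "?y \<in> points" "?z \<in> points"
    using link_update[OF adj(2)] link_update[OF adj(3)] rL chain_step.prems prism_points by blast+
  have "midpoint_fun y z \<in> link"
    using adj by (auto simp: link_def points_on_def adjacent_def midpoint_fun_def)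
  moreover have "midpoint_fun ?y ?z = (midpoint_fun y z)(h := (r + s * L + (r + s * (L + ?l))) / 2)"
    by (auto simp: midpoint_fun_def)
  ultimately have "midpoint_fun ?y ?z \<in> points"
    using link_update[of "midpoint_fun y z"] rL chain_step.prems prism_points by fastforce
  hence "adjacent ?y ?z" using yz by (simp add: adjacent_def)
  hence "chain adjacent coord_dist (x(h := r)) ?z (L * sqrt (1 + s\<^sup>2) + coord_dist ?y ?z)"
    by (rule chain.chain_step[OF c])
  moreover have "coord_dist ?y ?z = ?l * sqrt (1 + s\<^sup>2)"
  proof -
    have "?y(h := 0) = y" "?z(h := 0) = z" using adj link_h by (auto simp: fun_eq_iff)
    moreover have "(?y h - ?z h)\<^sup>2 = (s * ?l)\<^sup>2"
      by (simp add: algebra_simps power2_eq_square)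
    ultimately have "coord_dist ?y ?z = sqrt (?l\<^sup>2 + (s * ?l)\<^sup>2)"
      unfolding coord_dist_split[OF finite_diff_points[OF yz], of h 0] by (simp only:)
    thus ?thesis using sqrt_sum_squares_scale[OF l] by simp
  qed
  ultimately show ?case by (simp only: distrib_right)
qed

lemma cdist_prism:
  assumes x: "x \<in> link" "0 \<le> r" "r \<le> 1" and y: "y \<in> link" "0 \<le> r'" "r' \<le> 1"
  shows "cdist (x(h := r)) (y(h := r')) = sqrt ((cdist x y)\<^sup>2 + (r - r')\<^sup>2)"
proof (rule antisym)
  have xr: "x(h := r) \<in> prism" and yr: "y(h := r') \<in> prism" using link_update x y by auto
  hence xyr: "x(h := r) \<in> points" "y(h := r') \<in> points" using prism_points by auto
  have xy: "x \<in> points" "y \<in> points" using x y link_subset by auto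
  have res: "restr K (x(h := r)) = x" "restr K (y(h := r')) = y"
    using restr_eq xr yr x y link_h by (auto simp: prism_def fun_eq_iff)
  show "sqrt ((cdist x y)\<^sup>2 + (r - r')\<^sup>2) \<le> cdist (x(h := r)) (y(h := r'))"
  proof (rule cdist_greatest[OF xyr])
    fix L assume "chain adjacent coord_dist (x(h := r)) (y(h := r')) L"
    then obtain L1 where L1: "chain adjacent coord_dist x y L1" "sqrt (L1\<^sup>2 + (r - r')\<^sup>2) \<le> L"
      using chain_project[OF _ xyr(1)] res by fastforce
    have "sqrt ((cdist x y)\<^sup>2 + (r - r')\<^sup>2) \<le> sqrt (L1\<^sup>2 + (r - r')\<^sup>2)"
      using cdist_le[OF xy(1) L1(1)] by (intro real_sqrt_le_mono add_right_mono power_mono) auto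
    thus "sqrt ((cdist x y)\<^sup>2 + (r - r')\<^sup>2) \<le> L" using L1(2) by linarith
  qed
  have le: "cdist (x(h := r)) (y(h := r')) \<le> sqrt (L\<^sup>2 + (r - r')\<^sup>2)"
    if "chain adjacent coord_dist x y L" for L
  proof -
    \<comment> \<open>The given chain may wander through all of \<open>points\<close>;
      \<open>retr\<close> brings it into the link, where it can be lifted, and fixes its
      ends.\<close>
    have "(adjacent (retr y) (retr z) \<and> retr y \<in> link \<and> retr z \<in> link)
        \<and> coord_dist (retr y) (retr z) \<le> coord_dist y z" if "adjacent y z" for y z
      using retr_adjacent[OF that] that retr_link by (simp add: adjacent_def)
    from chain_map[where adj = adjacent and len = coord_dist and len' = coord_dist, OF this that]
    obtain L1 where L1: "L1 \<le> L"
        "chain (\<lambda>x y. adjacent x y \<and> x \<in> link \<and> y \<in> link) coord_dist (retr x) (retr y) L1"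
      by blast
    hence c: "chain (\<lambda>x y. adjacent x y \<and> x \<in> link \<and> y \<in> link) coord_dist x y L1"
      using retr_id x y by simp
    have L10: "0 \<le> L1" by (rule chain_nonneg[OF coord_dist_nonneg c])
    have "cdist (x(h := r)) (y(h := r')) \<le> sqrt (L1\<^sup>2 + (r - r')\<^sup>2)"
    proof (cases "L1 = 0")
      \<comment> \<open>A chain of length 0 admits no slope; then \<open>x = y\<close>, and one step
        in the direction \<open>h\<close> does.\<close>
      case True
      obtain L2 where L2: "L2 \<le> L1" "chain adjacent coord_dist x y L2"
        using chain_map[where adj' = adjacent and \<phi> = id and len' = coord_dist, OF _ c] by auto
      have "cdist x y = 0" using cdist_le[OF xy(1) L2(2)] L2(1) True nonneg[of x y] by linarith
      hence "x = y" using zero[OF xy] by simp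
      have "x(h := (r + r') / 2) \<in> points"
        using link_update[OF x(1), of "(r + r') / 2"] x y prism_points by auto
      moreover have "midpoint_fun (x(h := r)) (x(h := r')) = x(h := (r + r') / 2)"
        by (auto simp: midpoint_fun_def)
      ultimately have "adjacent (x(h := r)) (y(h := r'))"
        using xyr \<open>x = y\<close> by (simp add: adjacent_def)
      hence "cdist (x(h := r)) (y(h := r')) \<le> coord_dist (x(h := r)) (y(h := r'))"
        by (rule cdist_adj_le)
      also have "\<dots> = sqrt ((r - r')\<^sup>2)"
        unfolding coord_dist_split[OF finite_diff_points[OF xyr], of h 0]
        using \<open>x = y\<close> by (simp add: coord_dist_def)
      finally show ?thesis using True by simp
    next
      case False
      \<comment> \<open>The slope that reaches \<open>r'\<close> at the end of the chain.\<close>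
      define s where "s = (r' - r) / L1"
      have s: "r + s * L1 = r'" "s * L1 = r' - r" using False by (auto simp: s_def)
      have "chain adjacent coord_dist (x(h := r)) (y(h := r')) (L1 * sqrt (1 + s\<^sup>2))"
        using chain_lift[OF c x, of s] s y by simp
      hence "cdist (x(h := r)) (y(h := r')) \<le> L1 * sqrt (1 + s\<^sup>2)"
        by (rule cdist_le[OF xyr(1)])
      also have "\<dots> = sqrt (L1\<^sup>2 + (r - r')\<^sup>2)"
        using sqrt_sum_squares_scale[OF L10, of s] s by (simp add: power2_commute)
      finally show ?thesis .
    qed
    also have "\<dots> \<le> sqrt (L\<^sup>2 + (r - r')\<^sup>2)"
      using L1 L10 by (intro real_sqrt_le_mono add_right_mono power_mono)
    finally show ?thesis .
  qed
  show "cdist (x(h := r)) (y(h := r')) \<le> sqrt ((cdist x y)\<^sup>2 + (r - r')\<^sup>2)"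
  proof (rule field_le_epsilon)
    fix e :: real assume e: "0 < e"
    obtain L where L: "chain adjacent coord_dist x y L" "L < cdist x y + e"
      using cdist_approx[OF xy e] .
    have "cdist (x(h := r)) (y(h := r')) \<le> sqrt (L\<^sup>2 + (r - r')\<^sup>2)" by (rule le[OF L(1)])
    also have "\<dots> \<le> sqrt ((cdist x y + e)\<^sup>2 + (r - r')\<^sup>2)"
      using L chain_nonneg[OF coord_dist_nonneg L(1)]
      by (intro real_sqrt_le_mono add_right_mono power_mono) auto
    also have "\<dots> \<le> sqrt ((cdist x y)\<^sup>2 + (r - r')\<^sup>2) + sqrt (e\<^sup>2 + 0\<^sup>2)"
      using real_sqrt_sum_squares_triangle_ineq[of "cdist x y" e "r - r'" 0] by simp
    finally show "cdist (x(h := r)) (y(h := r')) \<le> sqrt ((cdist x y)\<^sup>2 + (r - r')\<^sup>2) + e"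
      using e by simp
  qed
qed

text \<open>Convexity of the link: \<open>retr\<close> fixes \<open>x\<close> and \<open>y\<close>
  and moves \<open>m\<close> no farther from them, so \<open>stewart_unique\<close> gives
  \<open>retr m = m\<close>.\<close>

lemma link_stewart:
  assumes P: "stewart_space (points_on K) cdist"
    and x: "x \<in> link" and y: "y \<in> link" and t: "0 \<le> t" "t \<le> 1"
  shows "\<exists>m\<in>link. stewart cdist (points_on K) x y t m"
proof -
  obtain m where m: "m \<in> points_on K" "stewart cdist (points_on K) x y t m"
    using stewart_spaceD[OF P _ _ t] x y link_subset(1) by blast
  have xyp: "x \<in> points_on K" "y \<in> points_on K" "x \<in> points" "y \<in> points" "m \<in> points"
    using x y m link_subset points_on_subset by auto
  have le: "cdist z (retr m) \<le> cdist z m" if "z \<in> link" for z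
    using cdist_map_le[OF retr_adjacent, of z m] retr_id[OF that] that xyp link_subset by auto
  have "retr m = m"
  proof (rule stewart_unique[OF m(2) _ _ _ t])
    show "cdist x (retr m) \<le> t * cdist x y"
      using le[OF x] stewart_dist_left[OF m(2) xyp(1,3) t(1)] by linarith
    show "cdist y (retr m) \<le> (1 - t) * cdist x y"
      using le[OF y] stewart_dist_right[OF m(2) xyp(2,4) t(2)] by linarith
  qed (use retr_link[OF xyp(5)] link_subset xyp in auto)
  thus ?thesis using m(2) retr_link[OF xyp(5)] by metis
qed

text \<open>Squared distances add in a product, so the inequality in the link and the exact identity
  on the interval add as well.\<close>

lemma prism_stewart:
  assumes m: "m \<in> link" "stewart cdist link x y t m"
    and x: "x \<in> link" "0 \<le> r" "r \<le> 1" and y: "y \<in> link" "0 \<le> r'" "r' \<le> 1"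
    and t: "0 \<le> t" "t \<le> 1"
  shows "(1 - t) * r + t * r' \<in> {0..1}"
    and "stewart cdist prism (x(h := r)) (y(h := r')) t (m(h := (1 - t) * r + t * r'))"
proof -
  let ?q = "(1 - t) * r + t * r'"
  show "?q \<in> {0..1}"
    using convexD[OF convex_real_interval(5), of r 0 1 r' "1 - t" t] x y t by simp
  hence q: "0 \<le> ?q" "?q \<le> 1" by auto
  show "stewart cdist prism (x(h := r)) (y(h := r')) t (m(h := ?q))"
    unfolding stewart_def
  proof
    fix z assume "z \<in> prism"
    then obtain w u where w: "w \<in> link" "0 \<le> u" "u \<le> 1" "z = w(h := u)" using prism_cases by blast
    have "(cdist w m)\<^sup>2 \<le> (1 - t) * (cdist w x)\<^sup>2 + t * (cdist w y)\<^sup>2 - t * (1 - t) * (cdist x y)\<^sup>2"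
      by (rule stewartD[OF m(2) w(1)])
    moreover have "(u - ?q)\<^sup>2 = (1 - t) * (u - r)\<^sup>2 + t * (u - r')\<^sup>2 - t * (1 - t) * (r - r')\<^sup>2"
      by (simp add: power2_eq_square algebra_simps)
    ultimately show "(cdist z (m(h := ?q)))\<^sup>2 \<le> (1 - t) * (cdist z (x(h := r)))\<^sup>2
        + t * (cdist z (y(h := r')))\<^sup>2 - t * (1 - t) * (cdist (x(h := r)) (y(h := r')))\<^sup>2"
      unfolding w(4) cdist_prism[OF w(1-3) m(1) q] cdist_prism[OF w(1-3) x] cdist_prism[OF w(1-3) y]
        cdist_prism[OF x y]
      by (simp add: algebra_simps)
  qed
qed

text \<open>A chain from the old part is followed, with coordinates outside
  \<open>insert h K\<close> deleted, until \<open>h\<close> first becomes positive. The step that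
  does this already starts in the link. The disjunction records whether it has happened.\<close>

lemma chain_through_link:
  "chain adjacent coord_dist x y L \<Longrightarrow> x \<in> points_on K \<Longrightarrow>
    restr (insert h K) y \<in> points_on K \<or>
    (\<exists>c\<in>link. cdist x c + cdist c (restr (insert h K) y) \<le> L)"
proof (induction rule: chain.induct)
  case (chain_refl x)
  have "restr (insert h K) x = x" using chain_refl by (auto simp: restr_def points_on_def fun_eq_iff)
  thus ?case using chain_refl by simp
next
  case (chain_step x y L z)
  let ?R = "restr (insert h K)"
  have xp: "x \<in> points" using chain_step.prems points_on_subset by auto
  have adj: "adjacent (?R y) (?R z)" "coord_dist (?R y) (?R z) \<le> coord_dist y z"
    using restr_adjacent[OF causal_insert chain_step(2)] by auto
  have Rp: "?R y \<in> points" "?R z \<in> points" using adj(1) by (auto simp: adjacent_def)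
  have step: "cdist (?R y) (?R z) \<le> coord_dist y z"
    using cdist_adj_le[OF adj(1)] adj(2) by linarith
  consider "\<exists>c\<in>link. cdist x c + cdist c (?R y) \<le> L" | "?R y \<in> points_on K" "?R z \<in> points_on K"
    | "?R y \<in> points_on K" "?R z \<notin> points_on K"
    using chain_step.IH[OF chain_step.prems] by blast
  thus ?case
  proof cases
    case 1
    then obtain c where c: "c \<in> link" "cdist x c + cdist c (?R y) \<le> L" by blast
    have "cdist c (?R z) \<le> cdist c (?R y) + cdist (?R y) (?R z)"
      using c link_subset Rp by (intro triangle) auto
    thus ?thesis using c step by force
  next
    case 2 thus ?thesis by simp
  next
    case 3
    have zh: "0 < ?R z h"
    proof (rule ccontr)
      assume "\<not> 0 < ?R z h"
      hence "?R z h = 0" using pointsD(2)[OF Rp(2), of h] by linarith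
      hence "?R z \<in> points_on K" using Rp(2) by (auto simp: points_on_def restr_def)
      thus False using 3 by simp
    qed
    let ?m = "midpoint_fun (?R y) (?R z)"
    \<comment> \<open>Since the midpoint has positive weight on \<open>h\<close>, it is 1 on the
      causes of \<open>h\<close> and 0 on the conflicts; an average with these extreme values forces
      them on \<open>?R y\<close>.\<close>
    have m: "?m \<in> points" "0 < ?m h"
      using adj(1) zh pointsD(2)[OF Rp(1), of h] by (auto simp: adjacent_def midpoint_fun_def)
    have "?R y b = 1" if "b \<in> E" "lt b h" for b
      using link_of_positive(1)[OF m(1) that(1) m(2) that(2)] pointsD(3)[OF Rp(1), of b] pointsD(3)[OF Rp(2), of b]
      by (simp add: midpoint_fun_def)
    moreover have "?R y b = 0" if "b \<in> E" "cf b h" for b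
      using link_of_positive(2)[OF m(1) that(1) m(2) that(2)] pointsD(2)[OF Rp(1), of b] pointsD(2)[OF Rp(2), of b]
      by (simp add: midpoint_fun_def)
    ultimately have yl: "?R y \<in> link" using 3 by (simp add: link_def)
    have "cdist x (?R y) \<le> L"
    proof -
      have "?R x = x" using chain_step.prems by (auto simp: restr_def points_on_def fun_eq_iff)
      hence "cdist x (?R y) \<le> cdist x y"
        using cdist_map_le[OF restr_adjacent[OF causal_insert], of x y] xp chain_in[OF chain_step(1) xp] by simp
      also have "\<dots> \<le> L" by (rule cdist_le[OF xp chain_step(1)])
      finally show ?thesis .
    qed
    thus ?thesis using yl step by force
  qed
qed

text \<open>\<open>chain_through_link\<close> splits the distance up to an error
  \<open>1 / Suc n\<close>. Compactness of the old part, together with the link conditions fixing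
  coordinates and so passing to limits, gives an exact splitting point.\<close>

lemma cross_link:
  assumes a: "a \<in> points_on K" and b: "b \<in> prism"
  shows "\<exists>c\<in>points_on K \<inter> prism. cdist a b = cdist a c + cdist c b"
proof (cases "b \<in> points_on K")
  case True
  hence "b \<in> points" using points_on_subset by auto
  thus ?thesis using True b by (intro bexI[of _ b]) auto
next
  case False
  have ap: "a \<in> points" and bp: "b \<in> points" using a b points_on_subset prism_points by auto
  have Rb: "restr (insert h K) b = b"
    using b by (auto simp: prism_def points_on_def restr_def fun_eq_iff)
  have "\<exists>c\<in>link. cdist a c + cdist c b \<le> cdist a b + 1 / real (Suc n)" for n
  proof -
    have pos: "0 < 1 / real (Suc n)" by simp
    obtain L where L: "chain adjacent coord_dist a b L" "L < cdist a b + 1 / real (Suc n)"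
      using cdist_approx[OF ap bp pos] .
    thus ?thesis using chain_through_link[OF L(1) a] False Rb by force
  qed
  then obtain s where s: "\<And>n. s n \<in> link"
    "\<And>n. cdist a (s n) + cdist (s n) b \<le> cdist a b + 1 / real (Suc n)" by metis
  have sK: "\<And>n::nat. s n \<in> points_on K" using s(1) link_subset by auto
  obtain l r where l: "l \<in> points_on K" "strict_mono r" "(\<lambda>n. cdist (s (r n)) l) \<longlonglongrightarrow> 0"
      "\<And>e. (\<lambda>n. s (r n) e) \<longlonglongrightarrow> l e"
    using points_on_compact[OF causal_K, of s] sK by blast
  have lp: "l \<in> points" using l points_on_subset by auto
  have "l e = 1" if "e \<in> E" "lt e h" for e
  proof -
    have "\<And>n. s (r n) e = 1" using s(1) that by (auto simp: link_def)
    thus ?thesis using l(4)[of e] by (simp add: LIMSEQ_const_iff)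
  qed
  moreover have "l e = 0" if "e \<in> E" "cf e h" for e
  proof -
    have "\<And>n. s (r n) e = 0" using s(1) that by (auto simp: link_def)
    thus ?thesis using l(4)[of e] by (simp add: LIMSEQ_const_iff)
  qed
  ultimately have ll: "l \<in> link" using l(1) by (simp add: link_def)
  have "cdist a l + cdist l b \<le> cdist a b"
  proof (rule LIMSEQ_le_const)
    have "(\<lambda>n. 1 / real (Suc (r n))) \<longlonglongrightarrow> 0"
      using LIMSEQ_subseq_LIMSEQ[OF LIMSEQ_Suc[OF lim_1_over_n] l(2)] by (simp add: o_def)
    hence "(\<lambda>n. cdist a b + 1 / real (Suc (r n)) + 2 * cdist (s (r n)) l) \<longlonglongrightarrow> cdist a b + 0 + 2 * 0"
      using l(3) by (intro tendsto_intros)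
    thus "(\<lambda>n. cdist a b + 1 / real (Suc (r n)) + 2 * cdist (s (r n)) l) \<longlonglongrightarrow> cdist a b" by simp
    have "cdist a l + cdist l b \<le> cdist a b + 1 / real (Suc (r n)) + 2 * cdist (s (r n)) l" for n
    proof -
      have sp: "s (r n) \<in> points" using s(1) link_subset by auto
      have "cdist a l \<le> cdist a (s (r n)) + cdist (s (r n)) l" using ap lp sp by (intro triangle)
      moreover have "cdist l b \<le> cdist (s (r n)) l + cdist (s (r n)) b"
        using triangle[OF lp sp bp] commute[of l "s (r n)"] by simp
      ultimately show ?thesis using s(2)[of "r n"] by linarith
    qed
    thus "\<exists>N. \<forall>n\<ge>N. cdist a l + cdist l b \<le> cdist a b + 1 / real (Suc (r n)) + 2 * cdist (s (r n)) l"
      by blast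
  qed
  hence "cdist a b = cdist a l + cdist l b" using triangle[OF ap lp bp] by linarith
  thus ?thesis using ll points_on_Int_prism by blast
qed

lemma stewart_space_insert:
  assumes P: "stewart_space (points_on K) cdist"
  shows "stewart_space (points_on (insert h K)) cdist"
  unfolding points_on_insert
proof (rule stewart_space_Un[OF _ _ P])
  show "points_on K \<subseteq> points" "prism \<subseteq> points" using points_on_subset prism_points by auto
  have lm: "\<exists>m\<in>link. stewart cdist link x y t m" if "x \<in> link" "y \<in> link" "0 \<le> t" "t \<le> 1" for x y t
    using link_stewart[OF P that] stewart_mono[OF _ link_subset(1)] by blast
  show "stewart_space prism cdist"
    unfolding stewart_space_def
  proof (intro ballI)
    fix x y t assume "x \<in> prism" "y \<in> prism" and t: "t \<in> {0..1::real}"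
    then obtain x' r y' r' where x: "x' \<in> link" "0 \<le> r" "r \<le> 1" "x = x'(h := r)"
      and y: "y' \<in> link" "0 \<le> r'" "r' \<le> 1" "y = y'(h := r')"
      using prism_cases[of x] prism_cases[of y] by blast
    have t': "0 \<le> t" "t \<le> 1" using t by auto
    obtain m where m: "m \<in> link" "stewart cdist link x' y' t m" using lm[OF x(1) y(1) t'] by blast
    note ps = prism_stewart[OF m x(1-3) y(1-3) t']
    show "\<exists>m\<in>prism. stewart cdist prism x y t m"
      using ps link_update[OF m(1)] x(4) y(4) by (metis atLeastAtMost_iff)
  qed
  show "\<forall>x\<in>points_on K \<inter> prism. \<forall>y\<in>points_on K \<inter> prism. \<forall>t\<in>{0..1}.
      \<exists>m\<in>points_on K \<inter> prism. stewart cdist (points_on K \<union> prism) x y t m"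
    unfolding points_on_Int_prism
  proof (intro ballI)
    fix x y t assume xy: "x \<in> link" "y \<in> link" and "t \<in> {0..1::real}"
    hence t: "0 \<le> t" "t \<le> 1" by auto
    obtain m where m: "m \<in> link" "stewart cdist (points_on K) x y t m"
      using link_stewart[OF P xy t] by blast
    have upd: "z(h := 0) = z" if "z \<in> link" for z using link_h[OF that] by auto
    \<comment> \<open>The link is the bottom \<open>h = 0\<close> of the prism, so its dividing
      point also passes the tests by points of the prism.\<close>
    have "stewart cdist prism (x(h := 0)) (y(h := 0)) t (m(h := (1 - t) * 0 + t * 0))"
      using prism_stewart(2)[OF m(1) stewart_mono[OF m(2) link_subset(1)] xy(1) _ _ xy(2) _ _ t, of 0 0]
      by simp
    hence "stewart cdist prism x y t m" using upd xy m(1) by simp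
    from stewart_Un[OF m(2) this]
    show "\<exists>m\<in>link. stewart cdist (points_on K \<union> prism) x y t m" using m(1) by blast
  qed
  show "\<forall>a\<in>points_on K. \<forall>b\<in>prism. \<exists>c\<in>points_on K \<inter> prism. cdist a b = cdist a c + cdist c b"
    using cross_link by blast
qed

end

section \<open>The Stewart inequality on finite parts and on the whole complex\<close>

context event_structure
begin

lemma stewart_space_points_on: "causal K \<Longrightarrow> stewart_space (points_on K) cdist"
proof (induction "card K" arbitrary: K)
  case 0
  hence "K = {}" by (simp add: causal_def)
  have "x = (\<lambda>_. 0)" if "x \<in> points_on K" for x
    using that \<open>K = {}\<close> by (auto simp: points_on_def)
  hence eq: "x = y" if "x \<in> points_on K" "y \<in> points_on K" for x y using that by metis
  show ?case
    unfolding stewart_space_def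
  proof (intro ballI)
    fix x y t assume H: "x \<in> points_on K" "y \<in> points_on K"
    have "stewart cdist (points_on K) x y t x"
      unfolding stewart_def
    proof
      fix z assume z: "z \<in> points_on K"
      have "z \<in> points" using z points_on_subset by auto
      thus "(cdist z x)\<^sup>2 \<le> (1 - t) * (cdist z x)\<^sup>2 + t * (cdist z y)\<^sup>2 - t * (1 - t) * (cdist x y)\<^sup>2"
        using eq[OF H(1) z] eq[OF H(2) z] by simp
    qed
    thus "\<exists>m\<in>points_on K. stewart cdist (points_on K) x y t m" using H by blast
  qed
next
  case (Suc n)
  have fin: "finite K" and KE: "K \<subseteq> E" using Suc.prems by (auto simp: causal_def)
  have "K \<noteq> {}" using Suc.hyps(2) by auto
  then obtain h where h: "h \<in> K" "\<forall>e\<in>K. \<not> lt h e" using maximal_exists[OF fin KE] by blast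
  have c: "causal (K - {h})"
    unfolding causal_def using Suc.prems h(2) by (auto simp: causal_def)
  interpret event_extension E lt cf "K - {h}" h
    by unfold_locales (use c h Suc.prems in \<open>simp_all add: insert_absorb\<close>)
  have "n = card (K - {h})" using h fin Suc.hyps(2) by (simp add: card_Diff_singleton)
  hence "stewart_space (points_on (insert h (K - {h}))) cdist"
    using stewart_space_insert Suc.hyps(1) c by blast
  thus ?case using h(1) by (simp add: insert_absorb)
qed

theorem stewart_space_points: "stewart_space points cdist"
  unfolding stewart_space_def
proof (intro ballI)
  fix x y t assume xy: "x \<in> points" "y \<in> points" and "t \<in> {0..1::real}"
  hence t: "0 \<le> t" "t \<le> 1" by auto
  \<comment> \<open>Two test points are allowed so that, besides the \<open>z\<close> of interest,
    the candidate \<open>m\<close> can be tested and thereby identified with the dividing point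
    found for \<open>z\<close>.\<close>
  have local: "\<exists>m\<in>points. stewart cdist {x, y, z, z'} x y t m" if zz: "z \<in> points" "z' \<in> points" for z z'
  proof -
    define K where "K = {e. x e \<noteq> 0} \<union> {e. y e \<noteq> 0} \<union> {e. z e \<noteq> 0} \<union> {e. z' e \<noteq> 0}"
    have K: "finite K" "K \<subseteq> E" using xy zz pointsD(1,4) by (auto simp: K_def)
    define K' where "K' = K \<union> (\<Union>a\<in>K. {b\<in>E. lt b a})"
    have K': "causal K'" unfolding K'_def by (rule causal_hull[OF K])
    have mem: "{x, y, z, z'} \<subseteq> points_on K'" using xy zz by (auto simp: points_on_def K'_def K_def)
    have "x \<in> points_on K'" "y \<in> points_on K'" using mem by auto
    from stewart_spaceD[OF stewart_space_points_on[OF K'] this t]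
    obtain m where m: "m \<in> points_on K'" "stewart cdist (points_on K') x y t m" .
    have "m \<in> points" using m(1) points_on_subset by auto
    thus ?thesis using stewart_mono[OF m(2) mem] by blast
  qed
  obtain m where m: "m \<in> points" "stewart cdist {x, y, x, x} x y t m" using local[OF xy(1) xy(1)] by blast
  have mx: "cdist x m \<le> t * cdist x y" "cdist y m \<le> (1 - t) * cdist x y"
    using stewart_dist_left[OF m(2) _ xy(1) t(1)] stewart_dist_right[OF m(2) _ xy(2) t(2)] by auto
  have "stewart cdist points x y t m"
    unfolding stewart_def
  proof
    fix z assume z: "z \<in> points"
    obtain m' where m': "m' \<in> points" "stewart cdist {x, y, z, m} x y t m'" using local[OF z m(1)] by blast
    have "m = m'" by (rule stewart_unique[OF m'(2) _ m'(1) m(1) t mx]) simp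
    thus "(cdist z m)\<^sup>2 \<le> (1 - t) * (cdist z x)\<^sup>2 + t * (cdist z y)\<^sup>2 - t * (1 - t) * (cdist x y)\<^sup>2"
      using stewartD[OF m'(2), of z] by simp
  qed
  thus "\<exists>m\<in>points. stewart cdist points x y t m" using m(1) by blast
qed

end

section \<open>The cube complex of a space with walls\<close>

text \<open>\<open>cplx_dist\<close> is defined by indexed sequences; the inductive form is easier
  to transport along maps.\<close>

lemma chain_iff_path:
  "chain adj len x y L \<longleftrightarrow>
    (\<exists>n xs. L = (\<Sum>i<n. len (xs i) (xs (Suc i))) \<and> xs 0 = x \<and> xs n = y \<and> (\<forall>i<n. adj (xs i) (xs (Suc i))))"
proof
  assume "chain adj len x y L"
  thus "\<exists>n xs. L = (\<Sum>i<n. len (xs i) (xs (Suc i))) \<and> xs 0 = x \<and> xs n = y \<and> (\<forall>i<n. adj (xs i) (xs (Suc i)))"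
  proof (induction rule: chain.induct)
    case (chain_refl x)
    show ?case by (intro exI[of _ 0] exI[of _ "\<lambda>_. x"]) simp
  next
    case (chain_step x y L z)
    then obtain n xs where xs: "L = (\<Sum>i<n. len (xs i) (xs (Suc i)))" "xs 0 = x" "xs n = y"
        "\<forall>i<n. adj (xs i) (xs (Suc i))" by blast
    let ?ys = "xs(Suc n := z)"
    have "(\<Sum>i<n. len (?ys i) (?ys (Suc i))) = L"
      unfolding xs(1) by (intro sum.cong) auto
    hence "L + len y z = (\<Sum>i<Suc n. len (?ys i) (?ys (Suc i)))" using xs(3) by simp
    moreover have "\<forall>i<Suc n. adj (?ys i) (?ys (Suc i))"
      using xs(3,4) chain_step(2) by (auto simp: less_Suc_eq)
    ultimately show ?case using xs(2)
      by (intro exI[of _ "Suc n"] exI[of _ ?ys]) auto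
  qed
next
  assume "\<exists>n xs. L = (\<Sum>i<n. len (xs i) (xs (Suc i))) \<and> xs 0 = x \<and> xs n = y \<and> (\<forall>i<n. adj (xs i) (xs (Suc i)))"
  then obtain n xs where xs: "L = (\<Sum>i<n. len (xs i) (xs (Suc i)))" "xs 0 = x" "xs n = y"
      "\<forall>i<n. adj (xs i) (xs (Suc i))" by blast
  have "m \<le> n \<Longrightarrow> chain adj len (xs 0) (xs m) (\<Sum>i<m. len (xs i) (xs (Suc i)))" for m
  proof (induction m)
    case (Suc m)
    thus ?case using chain_step[of adj len "xs 0" "xs m"] xs(4) by simp
  qed (simp add: chain_refl)
  thus "chain adj len x y L" using xs by blast
qed

lemma chain_map_exact:
  assumes "\<And>y z. adj y z \<Longrightarrow> adj' (\<phi> y) (\<phi> z) \<and> len' (\<phi> y) (\<phi> z) = len y z"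
  shows "chain adj len x y L \<Longrightarrow> chain adj' len' (\<phi> x) (\<phi> y) L"
proof (induction rule: chain.induct)
  case (chain_step x y L z)
  thus ?case using assms[OF chain_step(2)] chain.chain_step by metis
qed (rule chain_refl)

section \<open>Half-spaces, walls and vertices\<close>

locale pointed_wall_space =
  fixes Y :: "'a set" and H :: "'a set set" and p :: 'a
  assumes walls_space: "space_with_walls Y H" and p_in: "p \<in> Y"
begin

lemma half_space:
  assumes "h \<in> H"
  shows "h \<subseteq> Y" "h \<noteq> {}" "Y - h \<in> H" "Y - (Y - h) = h" "Y - h \<noteq> h" "h \<noteq> Y - h"
proof -
  have H: "H \<subseteq> Pow Y" "\<forall>h\<in>H. h \<noteq> {}" "\<forall>h\<in>H. Y - h \<in> H"
    using walls_space by (simp_all add: space_with_walls_def)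
  show "h \<subseteq> Y" "h \<noteq> {}" "Y - h \<in> H" using H assms by auto
  thus "Y - (Y - h) = h" "Y - h \<noteq> h" "h \<noteq> Y - h" by auto
qed

lemma finite_separating: "q \<in> Y \<Longrightarrow> r \<in> Y \<Longrightarrow> finite {h\<in>H. q \<in> h \<and> r \<notin> h}"
  using walls_space by (simp add: space_with_walls_def)

lemma wall_of_in: "h \<in> H \<Longrightarrow> wall_of Y h \<in> walls Y H"
  by (simp add: walls_def)

lemma wall_of_compl: "h \<in> H \<Longrightarrow> wall_of Y (Y - h) = wall_of Y h"
  using half_space(4) by (auto simp: wall_of_def)

lemma wall_elem:
  assumes "w \<in> walls Y H" "h \<in> w"
  shows "h \<in> H" "w = wall_of Y h" "Y - h \<in> w"
  using assms half_space by (auto simp: walls_def wall_of_def)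

lemma wall_of_eq_iff: "h \<in> H \<Longrightarrow> k \<in> H \<Longrightarrow> wall_of Y h = wall_of Y k \<longleftrightarrow> k = h \<or> k = Y - h"
  using half_space(4) by (auto simp: wall_of_def doubleton_eq_iff)

definition away :: "'a set set \<Rightarrow> 'a set" where
  "away w = (THE h. h \<in> w \<and> p \<notin> h)"

lemma away_wall_of:
  assumes "h \<in> H"
  shows "away (wall_of Y h) = (if p \<in> h then Y - h else h)"
  unfolding away_def
  by (rule the_equality) (use assms p_in in \<open>auto simp: wall_of_def split: if_splits\<close>)

lemma away_in:
  assumes "w \<in> walls Y H"
  shows "away w \<in> w" "p \<notin> away w" "away w \<in> H" "Y - away w \<in> w"
  using assms half_space away_wall_of by (auto simp: walls_def wall_of_def split: if_splits)

lemma wall_away: "w \<in> walls Y H \<Longrightarrow> w = {away w, Y - away w}"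
  using away_in wall_elem(2) by (metis wall_of_def)

lemma point_section_eq:
  assumes "q \<in> Y" "h \<in> H"
  shows "point_section Y H q (wall_of Y h) = (if q \<in> h then h else Y - h)"
  unfolding point_section_def restrict_apply' [OF wall_of_in[OF assms(2)]]
  by (rule the_equality) (use assms in \<open>auto simp: wall_of_def split: if_splits\<close>)

lemma point_section_away: "w \<in> walls Y H \<Longrightarrow> point_section Y H p w = Y - away w"
  using point_section_eq[OF p_in away_in(3)] away_in(1,2) wall_elem(2) by metis

lemma subset_compl_iff: "h \<in> H \<Longrightarrow> h \<subseteq> Y - k \<longleftrightarrow> h \<inter> k = {}"
  using half_space(1) by auto

lemma admissible_iff:
  "admissible Y H \<sigma> \<longleftrightarrow> \<sigma> \<in> extensional (walls Y H) \<and> (\<forall>w\<in>walls Y H. \<sigma> w \<in> w) \<and>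
     (\<forall>w\<in>walls Y H. \<forall>k\<in>walls Y H. \<sigma> w \<inter> \<sigma> k \<noteq> {})"
  unfolding admissible_def using subset_compl_iff wall_elem(1) by meson

lemma admissibleD:
  assumes "admissible Y H \<sigma>" "w \<in> walls Y H"
  shows "\<sigma> w \<in> w" "\<sigma> w \<in> H" "w = wall_of Y (\<sigma> w)" "Y - \<sigma> w \<in> w" "Y - \<sigma> w \<noteq> \<sigma> w"
proof -
  show 1: "\<sigma> w \<in> w" using assms by (simp add: admissible_iff)
  show "\<sigma> w \<in> H" "w = wall_of Y (\<sigma> w)" "Y - \<sigma> w \<in> w" "Y - \<sigma> w \<noteq> \<sigma> w"
    using wall_elem[OF assms(2) 1] half_space(5) by auto
qed

lemma admissible_meet:
  "admissible Y H \<sigma> \<Longrightarrow> w \<in> walls Y H \<Longrightarrow> k \<in> walls Y H \<Longrightarrow> \<sigma> w \<inter> \<sigma> k \<noteq> {}"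
  by (simp add: admissible_iff)

lemma point_section_admissible:
  assumes "q \<in> Y"
  shows "admissible Y H (point_section Y H q)"
proof -
  have "point_section Y H q w \<in> w \<and> q \<in> point_section Y H q w" if w: "w \<in> walls Y H" for w
  proof -
    obtain h where h: "h \<in> H" "w = wall_of Y h" using w by (auto simp: walls_def)
    show ?thesis
      unfolding h(2) point_section_eq[OF assms h(1)] using assms by (simp add: wall_of_def)
  qed
  moreover have "point_section Y H q \<in> extensional (walls Y H)" by (simp add: point_section_def)
  ultimately show ?thesis unfolding admissible_iff by blast
qed

lemma flip_apply: "flip Y \<sigma> w k = (if k = w then Y - \<sigma> w else \<sigma> k)"
  by (simp add: flip_def)

lemma gamma_edge_flip_iff:
  assumes "w \<in> walls Y H"
  shows "gamma_edge Y H \<sigma> (flip Y \<sigma> w) \<longleftrightarrow> admissible Y H \<sigma> \<and> admissible Y H (flip Y \<sigma> w)"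
proof -
  have "card {k \<in> walls Y H. \<sigma> k \<noteq> flip Y \<sigma> w k} = 1" if "admissible Y H \<sigma>"
  proof -
    have "{k \<in> walls Y H. \<sigma> k \<noteq> flip Y \<sigma> w k} = {w}"
      using assms admissibleD(5)[OF that assms] by (auto simp: flip_apply)
    thus ?thesis by simp
  qed
  thus ?thesis by (auto simp: gamma_edge_def)
qed

text \<open>An edge changes one wall, so along a path the difference from the base section stays
  finite. Conversely a finite difference is undone wall by wall, each time at a minimal half-space
  so that the section stays admissible.\<close>

lemma gamma_vertices_iff:
  "\<sigma> \<in> gamma_vertices Y H p \<longleftrightarrow> admissible Y H \<sigma> \<and> finite {w \<in> walls Y H. p \<notin> \<sigma> w}"
proof
  assume "\<sigma> \<in> gamma_vertices Y H p"
  hence "(gamma_edge Y H)\<^sup>*\<^sup>* (point_section Y H p) \<sigma>" by (simp add: gamma_vertices_def)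
  thus "admissible Y H \<sigma> \<and> finite {w \<in> walls Y H. p \<notin> \<sigma> w}"
  proof (induction rule: rtranclp_induct)
    case base
    have "{w \<in> walls Y H. p \<notin> point_section Y H p w} = {}"
      using away_in p_in point_section_away by auto
    thus ?case using point_section_admissible[OF p_in] by (metis finite.emptyI)
  next
    case (step \<sigma> \<tau>)
    have "finite {w \<in> walls Y H. \<sigma> w \<noteq> \<tau> w}"
      using step(2) by (intro card_ge_0_finite) (simp add: gamma_edge_def)
    moreover have "{w \<in> walls Y H. p \<notin> \<tau> w} \<subseteq> {w \<in> walls Y H. p \<notin> \<sigma> w} \<union> {w \<in> walls Y H. \<sigma> w \<noteq> \<tau> w}"
      by auto
    ultimately have "finite {w \<in> walls Y H. p \<notin> \<tau> w}"
      using step(3) finite_subset[OF _ finite_UnI] by blast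
    thus ?case using step(2) by (simp add: gamma_edge_def)
  qed
next
  assume "admissible Y H \<sigma> \<and> finite {w \<in> walls Y H. p \<notin> \<sigma> w}"
  thus "\<sigma> \<in> gamma_vertices Y H p"
  proof (induction "card {w \<in> walls Y H. p \<notin> \<sigma> w}" arbitrary: \<sigma> rule: less_induct)
    case less
    let ?D = "{w \<in> walls Y H. p \<notin> \<sigma> w}"
    have adm: "admissible Y H \<sigma>" and fin: "finite ?D" using less.prems by auto
    show ?case
    proof (cases "?D = {}")
      case True
      have "\<sigma> = point_section Y H p"
      proof (rule extensionalityI)
        show "\<sigma> \<in> extensional (walls Y H)" using adm by (simp add: admissible_iff)
        show "point_section Y H p \<in> extensional (walls Y H)" by (simp add: point_section_def)
        fix w assume w: "w \<in> walls Y H"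
        hence "p \<in> \<sigma> w" using True by auto
        thus "\<sigma> w = point_section Y H p w"
          using admissibleD[OF adm w] point_section_eq[OF p_in] by metis
      qed
      thus ?thesis by (simp add: gamma_vertices_def)
    next
      case False
      \<comment> \<open>Among the chosen half-spaces that avoid \<open>p\<close>, one that is
        minimal for inclusion.\<close>
      obtain w where w: "w \<in> ?D" "\<And>k. k \<in> ?D \<Longrightarrow> \<sigma> k \<subseteq> \<sigma> w \<Longrightarrow> \<sigma> k = \<sigma> w"
      proof -
        obtain h where h: "h \<in> \<sigma> ` ?D" "\<forall>k\<in>\<sigma> ` ?D. k \<subseteq> h \<longrightarrow> h = k"
          using finite_has_minimal[of "\<sigma> ` ?D"] fin False by auto
        then obtain w where w: "w \<in> ?D" "h = \<sigma> w" by blast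
        show thesis
        proof (rule that[OF w(1)])
          fix k assume "k \<in> ?D" "\<sigma> k \<subseteq> \<sigma> w"
          thus "\<sigma> k = \<sigma> w" using h(2) w(2) by blast
        qed
      qed
      have wW: "w \<in> walls Y H" "p \<notin> \<sigma> w" using w(1) by auto
      let ?\<tau> = "flip Y \<sigma> w"
      \<comment> \<open>A chosen half-space disjoint from \<open>Y - \<sigma> w\<close> would lie
        inside \<open>\<sigma> w\<close>, hence avoid \<open>p\<close>, against minimality.\<close>
      have meet: "(Y - \<sigma> w) \<inter> \<sigma> k \<noteq> {}" if k: "k \<in> walls Y H" "k \<noteq> w" for k
      proof
        assume "(Y - \<sigma> w) \<inter> \<sigma> k = {}"
        hence sub: "\<sigma> k \<subseteq> \<sigma> w" using half_space(1)[OF admissibleD(2)[OF adm k(1)]] by blast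
        hence "k \<in> ?D" using wW k by blast
        hence "\<sigma> k = \<sigma> w" using w(2) sub by blast
        thus False using admissibleD(3)[OF adm] k wW by metis
      qed
      have adm': "admissible Y H ?\<tau>"
        unfolding admissible_iff
      proof (intro conjI ballI)
        show "?\<tau> \<in> extensional (walls Y H)"
          using adm wW by (auto simp: admissible_iff extensional_def flip_apply)
        show "?\<tau> k \<in> k" if "k \<in> walls Y H" for k
          using admissibleD(1,4)[OF adm that] by (auto simp: flip_apply)
        show "?\<tau> k \<inter> ?\<tau> l \<noteq> {}" if k: "k \<in> walls Y H" and l: "l \<in> walls Y H" for k l
        proof -
          have "Y - \<sigma> w \<noteq> {}" using wW p_in by auto
          thus ?thesis
            using admissible_meet[OF adm k l] meet[OF k] meet[OF l] by (auto simp: flip_apply)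
        qed
      qed
      have "{k \<in> walls Y H. p \<notin> ?\<tau> k} = ?D - {w}"
        using wW p_in by (auto simp: flip_apply)
      hence "?\<tau> \<in> gamma_vertices Y H p"
        using less.hyps[of ?\<tau>] adm' fin w(1) card_Diff1_less[OF fin w(1)] by simp
      moreover have "gamma_edge Y H ?\<tau> \<sigma>"
      proof -
        have "gamma_edge Y H \<sigma> ?\<tau>" using gamma_edge_flip_iff[OF wW(1)] adm adm' by simp
        thus ?thesis by (simp add: gamma_edge_def eq_commute[of "\<sigma> _"])
      qed
      ultimately show ?thesis by (simp add: gamma_vertices_def)
    qed
  qed
qed

section \<open>Points and cubes in terms of weights\<close>

lemma weight_funD:
  assumes "weight_fun Y H f" "h \<in> H"
  shows "0 \<le> f h" "f h \<le> 1" "f (Y - h) = 1 - f h"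
  using assms by (auto simp: weight_fun_def algebra_simps)

lemma weight_fun_ext: "weight_fun Y H f \<Longrightarrow> h \<notin> H \<Longrightarrow> f h = undefined"
  by (auto simp: weight_fun_def extensional_def)

text \<open>An intrinsic description of the points of the complex: half-spaces that carry weight
  meet, unless they are the two sides of one wall.\<close>

definition consistent :: "'a xpoint \<Rightarrow> bool" where
  "consistent f \<longleftrightarrow> weight_fun Y H f \<and> finite {h\<in>H. p \<notin> h \<and> f h \<noteq> 0} \<and>
     (\<forall>h\<in>H. \<forall>k\<in>H. 0 < f h \<longrightarrow> 0 < f k \<longrightarrow> h \<inter> k = {} \<longrightarrow> k = Y - h)"

text \<open>Two disjoint chosen half-spaces would be the two sides of one wall, of which a section
  takes only one.\<close>

lemma section_of_support_admissible:
  assumes f: "consistent f" and ext: "\<sigma> \<in> extensional (walls Y H)"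
    and in_w: "\<And>w. w \<in> walls Y H \<Longrightarrow> \<sigma> w \<in> w" and pos: "\<And>w. w \<in> walls Y H \<Longrightarrow> 0 < f (\<sigma> w)"
  shows "admissible Y H \<sigma>"
  unfolding admissible_iff
proof (intro conjI ballI ext in_w)
  fix w k assume w: "w \<in> walls Y H" and k: "k \<in> walls Y H"
  note W = wall_elem[OF w in_w[OF w]] and K = wall_elem[OF k in_w[OF k]]
  show "\<sigma> w \<inter> \<sigma> k \<noteq> {}"
  proof
    assume 0: "\<sigma> w \<inter> \<sigma> k = {}"
    hence "\<sigma> k = Y - \<sigma> w" using f pos[OF w] pos[OF k] W(1) K(1) by (simp add: consistent_def)
    hence "wall_of Y (\<sigma> k) = wall_of Y (\<sigma> w)" using wall_of_compl[OF W(1)] by simp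
    hence "w = k" using W(2) K(2) by simp
    thus False using 0 half_space(2)[OF W(1)] by simp
  qed
qed

text \<open>The smallest cube that contains \<open>f\<close>: its walls are those with fractional
  weights. \<open>\<sigma>\<close> and its flips at these walls choose half-spaces of positive
  weight, hence are admissible. All sides of these walls carry weight, so different walls
  cross.\<close>

lemma consistent_corner:
  assumes f: "consistent f"
  shows "\<exists>\<sigma>. corner Y H p \<sigma> {w \<in> walls Y H. \<exists>h\<in>w. 0 < f h \<and> f h < 1} \<and>
    (\<forall>w\<in>walls Y H. 0 < f (\<sigma> w))"
proof -
  let ?C = "{w \<in> walls Y H. \<exists>h\<in>w. 0 < f h \<and> f h < 1}"
  have wf: "weight_fun Y H f" using f by (simp add: consistent_def)
  have C: "0 < f h \<and> f h < 1" if w: "w \<in> ?C" and h: "h \<in> w" for w h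
  proof -
    have w': "w \<in> walls Y H" using w by simp
    obtain k where k: "k \<in> w" "0 < f k" "f k < 1" using w by blast
    have "h = k \<or> h = Y - k"
      using wall_elem(2)[OF w' k(1)] h by (auto simp: wall_of_def)
    thus ?thesis using k weight_funD(3)[OF wf wall_elem(1)[OF w' k(1)]] by auto
  qed
  define \<sigma> where "\<sigma> = (\<lambda>w\<in>walls Y H. if 0 < f (away w) then away w else Y - away w)"
  have in_w: "\<sigma> w \<in> w" if "w \<in> walls Y H" for w
    using away_in[OF that] that by (simp add: \<sigma>_def)
  have pos: "0 < f (\<sigma> w)" if "w \<in> walls Y H" for w
    using weight_funD[OF wf away_in(3)[OF that]] that by (simp add: \<sigma>_def)
  have ext: "\<sigma> \<in> extensional (walls Y H)" by (simp add: \<sigma>_def)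
  have adm: "admissible Y H \<sigma>" by (rule section_of_support_admissible[OF f ext in_w pos])
  have flip: "admissible Y H (flip Y \<sigma> w)" if w: "w \<in> ?C" for w
  proof (rule section_of_support_admissible[OF f])
    show "flip Y \<sigma> w \<in> extensional (walls Y H)"
      using ext w by (auto simp: extensional_def flip_apply)
    show "flip Y \<sigma> w k \<in> k" if "k \<in> walls Y H" for k
      using admissibleD(1,4)[OF adm that] by (auto simp: flip_apply)
    show "0 < f (flip Y \<sigma> w k)" if "k \<in> walls Y H" for k
      using C[OF w admissibleD(4)[OF adm]] w pos[OF that] by (simp add: flip_apply)
  qed
  have finE: "finite {h\<in>H. p \<notin> h \<and> f h \<noteq> 0}" using f by (simp add: consistent_def)
  have "{w \<in> walls Y H. p \<notin> \<sigma> w} \<subseteq> wall_of Y ` {h\<in>H. p \<notin> h \<and> f h \<noteq> 0}"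
  proof
    fix w assume w: "w \<in> {w \<in> walls Y H. p \<notin> \<sigma> w}"
    hence "\<sigma> w \<in> {h\<in>H. p \<notin> h \<and> f h \<noteq> 0}"
      using pos[of w] admissibleD(2)[OF adm] by auto
    thus "w \<in> wall_of Y ` {h\<in>H. p \<notin> h \<and> f h \<noteq> 0}" using admissibleD(3)[OF adm, of w] w by blast
  qed
  hence vert: "\<sigma> \<in> gamma_vertices Y H p"
    using adm finE finite_surj by (auto simp: gamma_vertices_iff)
  have "?C \<subseteq> wall_of Y ` {h\<in>H. p \<notin> h \<and> f h \<noteq> 0}"
  proof
    fix w assume w: "w \<in> ?C"
    hence w': "w \<in> walls Y H" by simp
    have "away w \<in> {h\<in>H. p \<notin> h \<and> f h \<noteq> 0}" using away_in[OF w'] C[OF w] by fastforce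
    thus "w \<in> wall_of Y ` {h\<in>H. p \<notin> h \<and> f h \<noteq> 0}" using wall_elem(2)[OF w' away_in(1)[OF w']] by blast
  qed
  hence finC: "finite ?C" using finE finite_surj by blast
  have cross: "pairwise_crossing ?C"
    unfolding pairwise_crossing_def crosses_def
  proof (intro ballI impI notI)
    fix w1 w2 h k assume w: "w1 \<in> ?C" "w2 \<in> ?C" "w1 \<noteq> w2" and hk: "h \<in> w1" "k \<in> w2" "h \<inter> k = {}"
    have wW: "w1 \<in> walls Y H" "w2 \<in> walls Y H" using w by auto
    have "k = Y - h"
      using f C[OF w(1) hk(1)] C[OF w(2) hk(2)] wall_elem(1)[OF wW(1) hk(1)] wall_elem(1)[OF wW(2) hk(2)] hk(3)
      by (simp add: consistent_def)
    thus False
      using w(3) wall_elem(2)[OF wW(1) hk(1)] wall_elem(2)[OF wW(2) hk(2)] wall_of_compl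
        wall_elem(1)[OF wW(1) hk(1)] by metis
  qed
  have "corner Y H p \<sigma> ?C"
    unfolding corner_def using vert finC cross adm flip gamma_edge_flip_iff by blast
  thus ?thesis using pos by blast
qed

text \<open>Stated for all weight functions that are 1 where \<open>f\<close> is, so that an
  application to a midpoint yields both ends.\<close>

lemma consistent_cube:
  assumes f: "consistent f"
  shows "\<exists>Q\<in>cubes Y H p. \<forall>g. weight_fun Y H g \<longrightarrow> (\<forall>h\<in>H. f h = 1 \<longrightarrow> g h = 1) \<longrightarrow> g \<in> Q"
proof -
  let ?C = "{w \<in> walls Y H. \<exists>h\<in>w. 0 < f h \<and> f h < 1}"
  obtain \<sigma> where \<sigma>: "corner Y H p \<sigma> ?C" "\<And>w. w \<in> walls Y H \<Longrightarrow> 0 < f (\<sigma> w)"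
    using consistent_corner[OF f] by blast
  have adm: "admissible Y H \<sigma>" using \<sigma>(1) by (simp add: corner_def gamma_vertices_iff)
  have one: "f (\<sigma> w) = 1" if "w \<in> walls Y H - ?C" for w
  proof -
    have w: "w \<in> walls Y H" using that by simp
    have "\<not> f (\<sigma> w) < 1" using that \<sigma>(2)[OF w] admissibleD(1)[OF adm w] by blast
    thus ?thesis using weight_funD(2)[of f "\<sigma> w"] admissibleD(2)[OF adm w] f
      by (simp add: consistent_def)
  qed
  show ?thesis
  proof (rule bexI)
    show "cube_set Y H \<sigma> ?C \<in> cubes Y H p" using \<sigma>(1) unfolding cubes_def by blast
    show "\<forall>g. weight_fun Y H g \<longrightarrow> (\<forall>h\<in>H. f h = 1 \<longrightarrow> g h = 1) \<longrightarrow> g \<in> cube_set Y H \<sigma> ?C"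
      unfolding cube_set_def using one admissibleD(2)[OF adm] by blast
  qed
qed

text \<open>Two walls of \<open>C\<close> cross. Otherwise at most one of the two sides differs from
  the choice of \<open>\<sigma>\<close>, and flipping \<open>\<sigma>\<close> at that wall alone
  gives an admissible section.\<close>

lemma corner_halves_meet:
  assumes c: "corner Y H p \<sigma> C" and w: "w \<in> walls Y H" "k \<in> walls Y H" "w \<noteq> k"
    and h: "h \<in> w" "w \<in> C \<or> h = \<sigma> w" and l: "l \<in> k" "k \<in> C \<or> l = \<sigma> k"
  shows "h \<inter> l \<noteq> {}"
proof -
  have adm: "admissible Y H \<sigma>" using c by (simp add: corner_def gamma_vertices_iff)
  have C: "\<And>w. w \<in> C \<Longrightarrow> admissible Y H (flip Y \<sigma> w)" "pairwise_crossing C"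
    using c by (auto simp: corner_def gamma_edge_def)
  have hw: "h = \<sigma> w \<or> h = Y - \<sigma> w" and lk: "l = \<sigma> k \<or> l = Y - \<sigma> k"
    using h(1) l(1) admissibleD(3)[OF adm w(1)] admissibleD(3)[OF adm w(2)]
    by (auto simp: wall_of_def)
  show ?thesis
  proof (cases "w \<in> C \<and> k \<in> C")
    case True
    thus ?thesis using C(2) w(3) h(1) l(1) by (auto simp: pairwise_crossing_def crosses_def)
  next
    case False
    then consider "h = \<sigma> w" "l = \<sigma> k" | "w \<in> C" "h = Y - \<sigma> w" "l = \<sigma> k" | "k \<in> C" "h = \<sigma> w" "l = Y - \<sigma> k"
      using h l hw lk by blast
    thus ?thesis
    proof cases
      case 1 thus ?thesis using admissible_meet[OF adm w(1,2)] by simp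
    next
      case 2 thus ?thesis
        using admissible_meet[OF C(1)[OF 2(1)] w(1,2)] w(3) by (simp add: flip_apply)
    next
      case 3 thus ?thesis
        using admissible_meet[OF C(1)[OF 3(1)] w(1,2)] w(3) by (simp add: flip_apply)
    qed
  qed
qed

lemma cube_consistent:
  assumes Q: "Q \<in> cubes Y H p" and f: "f \<in> Q"
  shows "consistent f"
proof -
  obtain \<sigma> C where c: "corner Y H p \<sigma> C" and fQ: "f \<in> cube_set Y H \<sigma> C"
    using Q f by (auto simp: cubes_def)
  have wf: "weight_fun Y H f" and one: "\<And>w. w \<in> walls Y H - C \<Longrightarrow> f (\<sigma> w) = 1"
    using fQ by (auto simp: cube_set_def)
  have vert: "\<sigma> \<in> gamma_vertices Y H p" and finC: "finite C" using c by (auto simp: corner_def)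
  have adm: "admissible Y H \<sigma>" and finD: "finite {w \<in> walls Y H. p \<notin> \<sigma> w}"
    using vert by (auto simp: gamma_vertices_iff)
  \<comment> \<open>If neither held, \<open>\<sigma>\<close> would choose the opposite side, which
    would then have weight 1.\<close>
  have sup: "wall_of Y h \<in> C \<or> h = \<sigma> (wall_of Y h)" if h: "h \<in> H" "0 < f h" for h
  proof (rule ccontr)
    assume "\<not> ?thesis"
    hence n: "wall_of Y h \<notin> C" "h \<noteq> \<sigma> (wall_of Y h)" by auto
    have w: "wall_of Y h \<in> walls Y H" by (rule wall_of_in[OF h(1)])
    have "\<sigma> (wall_of Y h) = Y - h"
      using admissibleD(1)[OF adm w] n(2) by (auto simp: wall_of_def)
    hence "f (Y - h) = 1" using one[of "wall_of Y h"] n w by simp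
    thus False using weight_funD(3)[OF wf h(1)] h(2) by simp
  qed
  have fin: "finite {h\<in>H. p \<notin> h \<and> f h \<noteq> 0}"
  proof (rule finite_subset)
    show "{h\<in>H. p \<notin> h \<and> f h \<noteq> 0} \<subseteq> away ` C \<union> \<sigma> ` {w \<in> walls Y H. p \<notin> \<sigma> w}"
    proof
      fix h assume h: "h \<in> {h\<in>H. p \<notin> h \<and> f h \<noteq> 0}"
      hence hH: "h \<in> H" "p \<notin> h" "0 < f h" using weight_funD(1)[OF wf, of h] by auto
      have a: "away (wall_of Y h) = h" using away_wall_of[OF hH(1)] hH(2) by simp
      consider "wall_of Y h \<in> C" | "h = \<sigma> (wall_of Y h)" using sup[OF hH(1,3)] by blast
      thus "h \<in> away ` C \<union> \<sigma> ` {w \<in> walls Y H. p \<notin> \<sigma> w}"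
      proof cases
        case 1 thus ?thesis using a imageI[OF 1, of away] by simp
      next
        case 2
        hence "wall_of Y h \<in> {w \<in> walls Y H. p \<notin> \<sigma> w}" using wall_of_in[OF hH(1)] hH(2) by simp
        from imageI[OF this, of \<sigma>] show ?thesis using 2 by simp
      qed
    qed
  qed (use finC finD in auto)
  have "k = Y - h" if hk: "h \<in> H" "k \<in> H" "0 < f h" "0 < f k" "h \<inter> k = {}" for h k
  proof (cases "wall_of Y h = wall_of Y k")
    case True
    thus ?thesis using wall_of_eq_iff[OF hk(1,2)] hk(5) half_space(2)[OF hk(1)] by auto
  next
    case False
    thus ?thesis
      using corner_halves_meet[OF c wall_of_in[OF hk(1)] wall_of_in[OF hk(2)] False _ sup[OF hk(1,3)] _ sup[OF hk(2,4)]] hk(5)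
      by (simp add: wall_of_def)
  qed
  thus ?thesis using wf fin by (simp add: consistent_def)
qed

definition mid :: "'a xpoint \<Rightarrow> 'a xpoint \<Rightarrow> 'a xpoint" where
  "mid f g = (\<lambda>h\<in>H. (f h + g h) / 2)"

lemma mid_weight_fun:
  assumes wf: "weight_fun Y H f" "weight_fun Y H g"
  shows "weight_fun Y H (mid f g)"
  unfolding weight_fun_def
proof (intro conjI ballI)
  fix h assume h: "h \<in> H"
  note F = weight_funD[OF wf(1) h] and G = weight_funD[OF wf(2) h]
  show "0 \<le> mid f g h" "mid f g h \<le> 1" "mid f g h + mid f g (Y - h) = 1"
    using F G h half_space(3)[OF h] by (simp_all add: mid_def field_simps)
qed (simp add: mid_def)

lemma mem_cplx_iff: "f \<in> cplx Y H p \<longleftrightarrow> consistent f"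
proof
  assume "f \<in> cplx Y H p"
  thus "consistent f" using cube_consistent by (auto simp: cplx_def)
next
  assume f: "consistent f"
  obtain Q where Q: "Q \<in> cubes Y H p"
      "\<forall>g. weight_fun Y H g \<longrightarrow> (\<forall>h\<in>H. f h = 1 \<longrightarrow> g h = 1) \<longrightarrow> g \<in> Q"
    using consistent_cube[OF f] by blast
  have "f \<in> Q" using Q(2) f by (simp add: consistent_def)
  thus "f \<in> cplx Y H p" using Q(1) by (auto simp: cplx_def)
qed

text \<open>A cube is closed under averages. Conversely the smallest cube of the midpoint contains
  both ends, because an average of two weights is 1 only if both are.\<close>

lemma common_cube_iff:
  "(\<exists>Q\<in>cubes Y H p. f \<in> Q \<and> g \<in> Q) \<longleftrightarrow> consistent f \<and> consistent g \<and> consistent (mid f g)"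
proof
  assume "\<exists>Q\<in>cubes Y H p. f \<in> Q \<and> g \<in> Q"
  then obtain Q where Q1: "Q \<in> cubes Y H p" "f \<in> Q" "g \<in> Q" by blast
  then obtain \<sigma> C where Q2: "corner Y H p \<sigma> C" "Q = cube_set Y H \<sigma> C"
    unfolding cubes_def by blast
  note Q = Q1 Q2
  have adm: "admissible Y H \<sigma>" using Q(4) by (simp add: corner_def gamma_vertices_iff)
  have midQ: "mid f g \<in> Q"
    using Q mid_weight_fun[of f g] admissibleD(2)[OF adm] by (auto simp: cube_set_def mid_def)
  thus "consistent f \<and> consistent g \<and> consistent (mid f g)"
    using cube_consistent[OF Q(1)] Q(2,3) by simp
next
  assume H: "consistent f \<and> consistent g \<and> consistent (mid f g)"
  hence wf: "weight_fun Y H f" "weight_fun Y H g" by (auto simp: consistent_def)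
  have "f h = 1 \<and> g h = 1" if "h \<in> H" "mid f g h = 1" for h
    using that weight_funD(2)[OF wf(1) that(1)] weight_funD(2)[OF wf(2) that(1)] by (simp add: mid_def)
  hence one: "\<forall>h\<in>H. mid f g h = 1 \<longrightarrow> f h = 1" "\<forall>h\<in>H. mid f g h = 1 \<longrightarrow> g h = 1" by auto
  obtain Q where Q: "Q \<in> cubes Y H p"
      "\<forall>k. weight_fun Y H k \<longrightarrow> (\<forall>h\<in>H. mid f g h = 1 \<longrightarrow> k h = 1) \<longrightarrow> k \<in> Q"
    using consistent_cube[of "mid f g"] H by blast
  have "f \<in> Q" "g \<in> Q"
    using Q(2)[rule_format, OF wf(1) one(1)[rule_format]] Q(2)[rule_format, OF wf(2) one(2)[rule_format]]
    by simp_all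
  thus "\<exists>Q\<in>cubes Y H p. f \<in> Q \<and> g \<in> Q" using Q(1) by blast
qed

end

section \<open>Coordinates on the complex\<close>

context pointed_wall_space
begin

text \<open>The half-spaces avoiding the base point form an event structure: a larger half-space is a
  cause of a smaller one, and disjoint half-spaces are in conflict.\<close>
definition events :: "'a set set" where
  "events = {h\<in>H. p \<notin> h}"

sublocale ES: event_structure events "\<lambda>b a. a \<subset> b" "\<lambda>a b. a \<inter> b = {}"
proof
  show "finite {b \<in> events. a \<subset> b}" if a: "a \<in> events" for a
  proof -
    have aH: "a \<in> H" using a by (simp add: events_def)
    obtain q where q: "q \<in> a" using half_space(2)[OF aH] by blast
    have "finite {h\<in>H. q \<in> h \<and> p \<notin> h}"
      using finite_separating half_space(1)[OF aH] q p_in by blast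
    thus ?thesis by (rule rev_finite_subset) (use q in \<open>auto simp: events_def\<close>)
  qed
  show "a \<inter> a \<noteq> {}" if "a \<in> events" for a
    using that half_space(2) by (auto simp: events_def)
qed auto

section \<open>Event coordinates of the points\<close>

definition coords :: "'a xpoint \<Rightarrow> 'a set \<Rightarrow> real" where
  "coords f = (\<lambda>h. if h \<in> events then f h else 0)"

definition of_coords :: "('a set \<Rightarrow> real) \<Rightarrow> 'a xpoint" where
  "of_coords x = (\<lambda>h\<in>H. if p \<in> h then 1 - x (Y - h) else x h)"

lemma eventsD: "e \<in> events \<Longrightarrow> e \<in> H" "e \<in> events \<Longrightarrow> p \<notin> e"
  by (auto simp: events_def)

lemma consistentD:
  assumes "consistent f"
  shows "weight_fun Y H f" "finite {h\<in>H. p \<notin> h \<and> f h \<noteq> 0}"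
    "h \<in> H \<Longrightarrow> k \<in> H \<Longrightarrow> 0 < f h \<Longrightarrow> 0 < f k \<Longrightarrow> h \<inter> k = {} \<Longrightarrow> k = Y - h"
  using assms unfolding consistent_def by (simp, simp, blast)

text \<open>Causality: an incomplete \<open>b\<close> gives weight to \<open>Y - b\<close>, which is
  disjoint from an \<open>a\<close> strictly inside \<open>b\<close> without being its complement.
  Conflict: two disjoint events with weight would be complementary, but both avoid
  \<open>p\<close>.\<close>

lemma coords_points:
  assumes f: "consistent f"
  shows "coords f \<in> ES.points"
proof (rule ES.pointsI)
  note wf = consistentD(1)[OF f]
  have "{e. coords f e \<noteq> 0} \<subseteq> {h\<in>H. p \<notin> h \<and> f h \<noteq> 0}"
    by (auto simp: coords_def events_def)
  thus "finite {e. coords f e \<noteq> 0}" using consistentD(2)[OF f] finite_subset by blast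
  show "coords f b = 1" if ab: "a \<in> events" "b \<in> events" "a \<subset> b" "0 < coords f a" for a b
  proof (rule ccontr)
    assume "coords f b \<noteq> 1"
    hence "0 < f (Y - b)"
      using weight_funD[OF wf eventsD(1)[OF ab(2)]] ab(2) by (simp add: coords_def)
    moreover have "0 < f a" using ab by (simp add: coords_def)
    moreover have "a \<inter> (Y - b) = {}" using ab(3) by blast
    ultimately have "Y - b = Y - a"
      using consistentD(3)[OF f] eventsD(1)[OF ab(1)] half_space(3)[OF eventsD(1)[OF ab(2)]] by blast
    thus False using half_space(4)[OF eventsD(1)] ab by (metis psubset_eq)
  qed
  show False if ab: "a \<in> events" "b \<in> events" "a \<inter> b = {}" "0 < coords f a" "0 < coords f b" for a b
  proof -
    have "b = Y - a" using consistentD(3)[OF f] ab eventsD(1) by (simp add: coords_def)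
    thus False using eventsD(2)[OF ab(1)] eventsD(2)[OF ab(2)] p_in by simp
  qed
  show "0 \<le> coords f e" "coords f e \<le> 1" for e
    using weight_funD[OF wf eventsD(1)] by (auto simp: coords_def)
qed (simp add: coords_def)

lemma coords_of_coords: "x \<in> ES.points \<Longrightarrow> coords (of_coords x) = x"
  using ES.pointsD(4) by (auto simp: coords_def of_coords_def events_def fun_eq_iff)

text \<open>Two disjoint half-spaces cannot both contain \<open>p\<close>. If neither does, they are
  events in conflict. If only \<open>h\<close> does and \<open>k\<close> is not
  \<open>Y - h\<close>, then \<open>Y - h\<close> is a cause of \<open>k\<close>; when
  \<open>k\<close> has positive weight, \<open>Y - h\<close> has weight 1, leaving none for
  \<open>h\<close>.\<close>

lemma of_coords_consistent:
  assumes x: "x \<in> ES.points"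
  shows "consistent (of_coords x)"
proof -
  have compl: "Y - h \<in> events" if "h \<in> H" "p \<in> h" for h
    using that half_space(3) by (simp add: events_def)
  have wf: "weight_fun Y H (of_coords x)"
    unfolding weight_fun_def
  proof (intro conjI ballI)
    fix h assume h: "h \<in> H"
    show "0 \<le> of_coords x h" "of_coords x h \<le> 1"
      using h ES.pointsD(2,3)[OF x] by (simp_all add: of_coords_def)
    show "of_coords x h + of_coords x (Y - h) = 1"
      using h half_space(3,4)[OF h] p_in by (simp add: of_coords_def)
  qed (simp add: of_coords_def)
  have fin: "finite {h\<in>H. p \<notin> h \<and> of_coords x h \<noteq> 0}"
    by (rule finite_subset[OF _ ES.pointsD(1)[OF x]]) (auto simp: of_coords_def)
  have mixed: "k = Y - h"
    if h: "h \<in> H" "p \<in> h" "0 < of_coords x h" and k: "k \<in> H" "p \<notin> k" "0 < of_coords x k"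
      and hk: "h \<inter> k = {}" for h k
  proof (rule ccontr)
    assume "k \<noteq> Y - h"
    hence "k \<subset> Y - h" using hk half_space(1)[OF k(1)] by blast
    moreover have "0 < x k" using k by (simp add: of_coords_def)
    moreover have "k \<in> events" using k by (simp add: events_def)
    ultimately have "x (Y - h) = 1" using ES.pointsD(5)[OF x _ compl[OF h(1,2)]] by blast
    thus False using h by (simp add: of_coords_def)
  qed
  have "k = Y - h"
    if hk: "h \<in> H" "k \<in> H" "0 < of_coords x h" "0 < of_coords x k" "h \<inter> k = {}" for h k
  proof -
    consider "p \<in> h" "p \<notin> k" | "p \<notin> h" "p \<in> k" | "p \<notin> h" "p \<notin> k" using hk(5) by blast
    thus ?thesis
    proof cases
      case 1 thus ?thesis using mixed hk by blast
    next
      case 2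
      hence "h = Y - k" using mixed[of k h] hk by blast
      thus ?thesis using half_space(4)[OF hk(2)] by simp
    next
      case 3
      hence "0 < x h" "0 < x k" "h \<in> events" "k \<in> events" using hk by (auto simp: of_coords_def events_def)
      thus ?thesis using ES.pointsD(6)[OF x, of h k] hk(5) by simp
    qed
  qed
  thus ?thesis using wf fin by (simp add: consistent_def)
qed

lemma of_coords_coords:
  assumes "weight_fun Y H f"
  shows "of_coords (coords f) = f"
proof
  fix h
  show "of_coords (coords f) h = f h"
    using weight_funD(3)[OF assms, of h] weight_fun_ext[OF assms, of h] half_space(3)[of h] p_in
    by (auto simp: of_coords_def coords_def events_def)
qed

lemma coords_inject:
  "consistent f \<Longrightarrow> consistent g \<Longrightarrow> coords f = coords g \<longleftrightarrow> f = g"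
  using of_coords_coords consistentD(1) by metis

lemma coords_mid: "coords (mid f g) = midpoint_fun (coords f) (coords g)"
  by (auto simp: coords_def mid_def midpoint_fun_def events_def fun_eq_iff)

lemma mid_coords:
  assumes wf: "weight_fun Y H f" "weight_fun Y H g"
    and "midpoint_fun (coords f) (coords g) \<in> ES.points"
  shows "consistent (mid f g)"
  using of_coords_consistent[OF assms(3)] coords_mid[of f g] of_coords_coords[OF mid_weight_fun[OF wf]]
  by simp

text \<open>A wall on which the points differ contributes its two sides equally to
  \<open>cube_dist\<close>, but only the side that avoids \<open>p\<close> to the coordinates; this
  cancels the factor 1/2.\<close>

lemma cube_dist_coords:
  assumes f: "consistent f" and g: "consistent g"
  shows "cube_dist H f g = coord_dist (coords f) (coords g)"
proof -
  note wf = consistentD(1)[OF f] consistentD(1)[OF g]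
  define D where "D = {e\<in>events. f e \<noteq> g e}"
  have D_eq: "{e. coords f e \<noteq> coords g e} = D" by (auto simp: D_def coords_def)
  have finD: "finite D"
    using ES.finite_diff_points[OF coords_points[OF f] coords_points[OF g]] D_eq by simp
  have DH: "h \<in> H" if "h \<in> D" for h using that by (simp add: D_def events_def)
  have inj: "inj_on (\<lambda>h. Y - h) D"
    by (rule inj_onI) (metis DH half_space(4))
  have disj: "D \<inter> (\<lambda>h. Y - h) ` D = {}"
    using p_in by (auto simp: D_def events_def)
  have "{h\<in>H. f h \<noteq> g h} = D \<union> (\<lambda>h. Y - h) ` D"
  proof (intro equalityI subsetI)
    fix h assume h: "h \<in> {h\<in>H. f h \<noteq> g h}"
    show "h \<in> D \<union> (\<lambda>h. Y - h) ` D"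
    proof (cases "p \<in> h")
      case True
      have "Y - h \<in> D"
        using h True half_space(3) weight_funD(3)[OF wf(1), of h] weight_funD(3)[OF wf(2), of h]
        by (simp add: D_def events_def)
      thus ?thesis using half_space(4)[of h] h by (metis UnI2 image_eqI mem_Collect_eq)
    qed (use h in \<open>simp add: D_def events_def\<close>)
  next
    fix h assume "h \<in> D \<union> (\<lambda>h. Y - h) ` D"
    thus "h \<in> {h\<in>H. f h \<noteq> g h}"
      using DH half_space(3) weight_funD(3)[OF wf(1)] weight_funD(3)[OF wf(2)] by (auto simp: D_def)
  qed
  hence "(\<Sum>h\<in>{h\<in>H. f h \<noteq> g h}. (f h - g h)\<^sup>2)
      = (\<Sum>h\<in>D. (f h - g h)\<^sup>2) + (\<Sum>h\<in>(\<lambda>h. Y - h) ` D. (f h - g h)\<^sup>2)"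
    using finD disj by (simp add: sum.union_disjoint)
  also have "(\<Sum>h\<in>(\<lambda>h. Y - h) ` D. (f h - g h)\<^sup>2) = (\<Sum>h\<in>D. (f h - g h)\<^sup>2)"
    unfolding sum.reindex[OF inj] o_def
    using weight_funD(3)[OF wf(1) DH] weight_funD(3)[OF wf(2) DH] by (intro sum.cong) (auto simp: power2_commute)
  finally have "1/2 * (\<Sum>h\<in>{h\<in>H. f h \<noteq> g h}. (f h - g h)\<^sup>2) = (\<Sum>h\<in>D. (f h - g h)\<^sup>2)" by simp
  moreover have "(\<Sum>h\<in>D. (f h - g h)\<^sup>2) = (\<Sum>h\<in>D. (coords f h - coords g h)\<^sup>2)"
    by (intro sum.cong) (auto simp: D_def coords_def)
  ultimately show ?thesis by (simp add: cube_dist_def coord_dist_def L2_set_def D_eq)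
qed

section \<open>Transfer of the metric\<close>

abbreviation share_cube :: "'a xpoint \<Rightarrow> 'a xpoint \<Rightarrow> bool" where
  "share_cube f g \<equiv> \<exists>Q\<in>cubes Y H p. f \<in> Q \<and> g \<in> Q"

lemma cplx_dist_chain:
  "cplx_dist Y H p f g = (if consistent f \<and> consistent g
     then Inf {L. chain share_cube (cube_dist H) f g L} else 0)"
proof -
  have "{(\<Sum>i<n. cube_dist H (xs i) (xs (Suc i))) | n xs.
      xs 0 = f \<and> xs n = g \<and> (\<forall>i<n. \<exists>Q\<in>cubes Y H p. xs i \<in> Q \<and> xs (Suc i) \<in> Q)}
    = {L. chain share_cube (cube_dist H) f g L}"
    unfolding chain_iff_path by blast
  thus ?thesis by (simp add: cplx_dist_def mem_cplx_iff)
qed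

lemma chain_coords:
  "consistent f \<Longrightarrow> consistent g \<Longrightarrow>
    chain share_cube (cube_dist H) f g L \<longleftrightarrow> chain ES.adjacent coord_dist (coords f) (coords g) L"
proof
  assume "chain share_cube (cube_dist H) f g L"
  thus "chain ES.adjacent coord_dist (coords f) (coords g) L"
  proof (rule chain_map_exact[rotated])
    fix k l assume "share_cube k l"
    hence "consistent k" "consistent l" "consistent (mid k l)" unfolding common_cube_iff by auto
    thus "ES.adjacent (coords k) (coords l) \<and> coord_dist (coords k) (coords l) = cube_dist H k l"
      using coords_points[of k] coords_points[of l] coords_points[of "mid k l"] coords_mid[of k l]
        cube_dist_coords[of k l] by (simp add: ES.adjacent_def)
  qed
next
  assume f: "consistent f" and g: "consistent g"
    and c: "chain ES.adjacent coord_dist (coords f) (coords g) L"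
  have "chain share_cube (cube_dist H) (of_coords (coords f)) (of_coords (coords g)) L"
    using c
  proof (rule chain_map_exact[rotated])
    fix x y assume xy: "ES.adjacent x y"
    hence pts: "x \<in> ES.points" "y \<in> ES.points" "midpoint_fun x y \<in> ES.points" by (auto simp: ES.adjacent_def)
    note cx = of_coords_consistent[OF pts(1)] and cy = of_coords_consistent[OF pts(2)]
    have "consistent (mid (of_coords x) (of_coords y))"
      using mid_coords[OF consistentD(1)[OF cx] consistentD(1)[OF cy]] pts coords_of_coords by simp
    thus "share_cube (of_coords x) (of_coords y) \<and> cube_dist H (of_coords x) (of_coords y) = coord_dist x y"
      unfolding common_cube_iff using cx cy cube_dist_coords[OF cx cy] pts coords_of_coords by simp
  qed
  thus "chain share_cube (cube_dist H) f g L"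
    using of_coords_coords consistentD(1) f g by simp
qed

lemma cplx_dist_eq:
  assumes "consistent f" "consistent g"
  shows "cplx_dist Y H p f g = ES.cdist (coords f) (coords g)"
proof -
  have "{L. chain share_cube (cube_dist H) f g L} = {L. chain ES.adjacent coord_dist (coords f) (coords g) L}"
    using chain_coords[OF assms] by blast
  thus ?thesis using assms coords_points by (simp add: cplx_dist_chain ES.cdist_def)
qed

lemma cplx_dist_outside: "\<not> (consistent f \<and> consistent g) \<Longrightarrow> cplx_dist Y H p f g = 0"
  unfolding cplx_dist_chain by (rule if_not_P)

lemma Metric_space_cplx: "Metric_space (cplx Y H p) (cplx_dist Y H p)"
proof
  show "0 \<le> cplx_dist Y H p f g" for f g
    using cplx_dist_eq[of f g] cplx_dist_outside[of f g] by (cases "consistent f \<and> consistent g") auto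
  show "cplx_dist Y H p f g = cplx_dist Y H p g f" for f g
    using cplx_dist_eq[of f g] cplx_dist_outside[of f g] cplx_dist_eq[of g f] cplx_dist_outside[of g f]
      ES.commute by (cases "consistent f \<and> consistent g") auto
  show "cplx_dist Y H p f g = 0 \<longleftrightarrow> f = g" if "f \<in> cplx Y H p" "g \<in> cplx Y H p" for f g
    using that coords_inject cplx_dist_eq coords_points by (simp add: mem_cplx_iff)
  show "cplx_dist Y H p f k \<le> cplx_dist Y H p f g + cplx_dist Y H p g k"
    if "f \<in> cplx Y H p" "g \<in> cplx Y H p" "k \<in> cplx Y H p" for f g k
    using that cplx_dist_eq coords_points ES.triangle by (simp add: mem_cplx_iff)
qed

lemma stewart_space_cplx: "stewart_space (cplx Y H p) (cplx_dist Y H p)"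
  unfolding stewart_space_def
proof (intro ballI)
  fix f g t assume "f \<in> cplx Y H p" "g \<in> cplx Y H p" and "t \<in> {0..1::real}"
  hence c: "consistent f" "consistent g" and t: "0 \<le> t" "t \<le> 1" by (auto simp: mem_cplx_iff)
  obtain m where m: "m \<in> ES.points" "stewart ES.cdist ES.points (coords f) (coords g) t m"
    using stewart_spaceD[OF ES.stewart_space_points coords_points[OF c(1)] coords_points[OF c(2)] t] .
  note cm = of_coords_consistent[OF m(1)]
  have "stewart (cplx_dist Y H p) (cplx Y H p) f g t (of_coords m)"
    unfolding stewart_def
  proof
    fix k assume "k \<in> cplx Y H p"
    hence k: "consistent k" by (simp add: mem_cplx_iff)
    show "(cplx_dist Y H p k (of_coords m))\<^sup>2 \<le> (1 - t) * (cplx_dist Y H p k f)\<^sup>2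
        + t * (cplx_dist Y H p k g)\<^sup>2 - t * (1 - t) * (cplx_dist Y H p f g)\<^sup>2"
      using stewartD[OF m(2) coords_points[OF k]] cplx_dist_eq c k cm coords_of_coords[OF m(1)] by simp
  qed
  thus "\<exists>m\<in>cplx Y H p. stewart (cplx_dist Y H p) (cplx Y H p) f g t m"
    using cm by (auto simp: mem_cplx_iff)
qed

theorem CAT0_cplx: "CAT0 (cplx Y H p) (cplx_dist Y H p)"
  by (rule Metric_space.stewart_space_CAT0[OF Metric_space_cplx stewart_space_cplx])

text \<open>The centre of the wanted cube is written down as a weight function;
  \<open>consistent_corner\<close> then finds the vertex.\<close>

lemma crossing_family_is_corner:
  assumes F: "F \<subseteq> walls Y H" "finite F" "pairwise_crossing F"
  shows "\<exists>\<sigma>. corner Y H p \<sigma> F"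
proof -
  define U where "U = \<Union>F"
  define sup where "sup h \<longleftrightarrow> (\<exists>u\<in>U. u \<subseteq> h)" for h
  \<comment> \<open>Sides of walls of \<open>F\<close> are undecided, a half-space that properly
    contains such a side must be chosen, its complement must not, and the remaining walls are turned
    towards \<open>p\<close>.\<close>
  define f where "f = (\<lambda>h\<in>H. if h \<in> U then 1/2 else if sup h then 1 else if sup (Y - h) then 0
      else if p \<in> h then 1 else (0::real))"
  have UH: "u \<in> H" "wall_of Y u \<in> F" "Y - u \<in> U" if u: "u \<in> U" for u
  proof -
    obtain w where w: "w \<in> F" "u \<in> w" using u by (auto simp: U_def)
    note W = wall_elem[OF subsetD[OF F(1) w(1)] w(2)]
    show "u \<in> H" "wall_of Y u \<in> F" "Y - u \<in> U" using W w by (auto simp: U_def)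
  qed
  have UF: "wall_of Y h \<in> F \<longleftrightarrow> h \<in> U" if "h \<in> H" for h
    using UH(2) by (auto simp: U_def wall_of_def)
  have U_compl: "Y - h \<in> U \<longleftrightarrow> h \<in> U" if "h \<in> H" for h
    using UH(3) half_space(4)[OF that] by metis
  have finU: "finite U"
  proof -
    have "finite w" if "w \<in> F" for w
      using wall_away[OF subsetD[OF F(1) that]] by (metis finite.emptyI finite.insertI)
    thus ?thesis using F(2) by (simp add: U_def)
  qed
  \<comment> \<open>If \<open>h\<close> and \<open>k\<close> contain sides \<open>u\<close> and
    \<open>v\<close> of walls of \<open>F\<close>, disjointness excludes crossing; so
    \<open>u\<close> and \<open>v\<close> are the two sides of one wall and fill \<open>h\<close>
    and \<open>k\<close>.\<close>
  have both: "h \<in> U \<and> k = Y - h" if hk: "h \<in> H" "k \<in> H" "h \<inter> k = {}" "sup h" "sup k" for h k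
  proof -
    obtain u v where uv: "u \<in> U" "u \<subseteq> h" "v \<in> U" "v \<subseteq> k" using hk by (auto simp: sup_def)
    have 0: "u \<inter> v = {}" using uv hk(3) by blast
    have "wall_of Y u = wall_of Y v"
    proof (rule ccontr)
      assume "wall_of Y u \<noteq> wall_of Y v"
      hence "crosses (wall_of Y u) (wall_of Y v)"
        using F(3) UH(2) uv by (auto simp: pairwise_crossing_def)
      thus False using 0 by (auto simp: crosses_def wall_of_def)
    qed
    hence "v = Y - u"
      using wall_of_eq_iff[OF UH(1)[OF uv(1)] UH(1)[OF uv(3)]] 0 half_space(2)[OF UH(1)[OF uv(1)]] by auto
    hence vk: "Y - u \<subseteq> k" using uv by simp
    have "h \<subseteq> u" using vk hk(3) half_space(1)[OF hk(1)] by blast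
    hence "h = u" using uv(2) by blast
    moreover have "k = Y - u" using vk hk(3) uv(2) half_space(1)[OF hk(2)] by blast
    ultimately show ?thesis using uv by simp
  qed
  have supU: "sup h" if "h \<in> U" for h using that by (auto simp: sup_def)
  have compl_meet: "h \<inter> (Y - h) = {}" for h by blast
  have wf: "weight_fun Y H f"
    unfolding weight_fun_def
  proof (intro conjI ballI)
    fix h assume h: "h \<in> H"
    show "0 \<le> f h" "f h \<le> 1" using h by (auto simp: f_def)
    show "f h + f (Y - h) = 1"
    proof (cases "h \<in> U")
      case True
      thus ?thesis using h half_space(3)[OF h] U_compl[OF h] by (simp add: f_def)
    next
      case False
      hence "\<not> (sup h \<and> sup (Y - h))" using both[OF h half_space(3)[OF h] compl_meet] by blast
      thus ?thesis
        using False h half_space(3,4)[OF h] U_compl[OF h] p_in by (simp add: f_def)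
    qed
  qed (simp add: f_def)
  have pos: "sup h \<or> (p \<in> h \<and> \<not> sup (Y - h))" if "h \<in> H" "0 < f h" for h
    using that supU by (auto simp: f_def split: if_splits)
  have consistent: "consistent f"
    unfolding consistent_def
  proof (intro conjI ballI impI wf)
    \<comment> \<open>Such a half-space contains some \<open>u\<close> in \<open>U\<close>, so it
      separates a fixed point of \<open>u\<close> from \<open>p\<close>; there are finitely many
      \<open>u\<close>.\<close>
    have "{h\<in>H. p \<notin> h \<and> f h \<noteq> 0} \<subseteq> (\<Union>u\<in>U. {h\<in>H. (SOME q. q \<in> u) \<in> h \<and> p \<notin> h})"
    proof
      fix h assume h: "h \<in> {h\<in>H. p \<notin> h \<and> f h \<noteq> 0}"
      hence "0 < f h" using weight_funD(1)[OF wf, of h] by auto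
      then obtain u where u: "u \<in> U" "u \<subseteq> h" using pos[of h] h by (auto simp: sup_def)
      have "(SOME q. q \<in> u) \<in> u" using half_space(2)[OF UH(1)[OF u(1)]] by (simp add: some_in_eq)
      thus "h \<in> (\<Union>u\<in>U. {h\<in>H. (SOME q. q \<in> u) \<in> h \<and> p \<notin> h})" using u h by blast
    qed
    moreover have "finite {h\<in>H. (SOME q. q \<in> u) \<in> h \<and> p \<notin> h}" if u: "u \<in> U" for u
    proof -
      have "(SOME q. q \<in> u) \<in> u" using half_space(2)[OF UH(1)[OF u]] by (simp add: some_in_eq)
      thus ?thesis using finite_separating[OF _ p_in] half_space(1)[OF UH(1)[OF u]] by blast
    qed
    ultimately show "finite {h\<in>H. p \<notin> h \<and> f h \<noteq> 0}"
      by (rule finite_subset[OF _ finite_UN_I[OF finU]])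
  next
    fix h k assume hk: "h \<in> H" "k \<in> H" "0 < f h" "0 < f k" "h \<inter> k = {}"
    have sup_mono: "sup a \<Longrightarrow> a \<subseteq> b \<Longrightarrow> sup b" for a b by (auto simp: sup_def)
    have "h \<subseteq> Y - k" "k \<subseteq> Y - h" using hk half_space(1) by blast+
    \<comment> \<open>If \<open>h\<close> had its weight only by the default towards
      \<open>p\<close>, then \<open>k\<close> would miss \<open>p\<close> and contain a side of
      \<open>F\<close>; so would \<open>Y - h\<close>, against the default. The same holds with
      \<open>h\<close> and \<open>k\<close> exchanged.\<close>
    hence "sup h \<and> sup k"
      using pos[OF hk(1,3)] pos[OF hk(2,4)] sup_mono hk(5) by blast
    thus "k = Y - h" using both hk by blast
  qed
  have "{w \<in> walls Y H. \<exists>h\<in>w. 0 < f h \<and> f h < 1} = F"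
  proof (intro equalityI subsetI)
    fix w assume "w \<in> {w \<in> walls Y H. \<exists>h\<in>w. 0 < f h \<and> f h < 1}"
    then obtain h where h: "w \<in> walls Y H" "h \<in> w" "0 < f h" "f h < 1" by blast
    have "h \<in> U" using h wall_elem(1)[OF h(1,2)] by (auto simp: f_def split: if_splits)
    thus "w \<in> F" using UF wall_elem[OF h(1,2)] by simp
  next
    fix w assume w: "w \<in> F"
    have wW: "w \<in> walls Y H" using F w by blast
    have "away w \<in> U" using away_in(1)[OF wW] w by (auto simp: U_def)
    hence "f (away w) = 1/2" using UH(1) by (simp add: f_def)
    thus "w \<in> {w \<in> walls Y H. \<exists>h\<in>w. 0 < f h \<and> f h < 1}"
      using wW away_in(1)[OF wW] by (auto intro!: bexI[of _ "away w"])
  qed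
  thus ?thesis using consistent_corner[OF consistent] by auto
qed

theorem cplx_dim_eq: "cplx_dim Y H p = crossing_number Y H"
proof -
  have "{enat (card C) | \<sigma> C. corner Y H p \<sigma> C}
      = {enat (card F) | F. F \<subseteq> walls Y H \<and> finite F \<and> pairwise_crossing F}"
    using crossing_family_is_corner unfolding corner_def by blast
  thus ?thesis by (simp add: cplx_dim_def crossing_number_def)
qed

end

section \<open>The group action\<close>

text \<open>HOL-Algebra lets groups act through extensional bijections, hence the
  \<open>restrict\<close>; bijectivity comes from the inverse element.\<close>

lemma group_action_restrictI:
  fixes G (structure)
  assumes G: "group G"
    and closed: "\<And>g x. g \<in> carrier G \<Longrightarrow> x \<in> S \<Longrightarrow> \<psi> g x \<in> S"
    and one: "\<And>x. x \<in> S \<Longrightarrow> \<psi> \<one> x = x"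
    and mult: "\<And>g k x. g \<in> carrier G \<Longrightarrow> k \<in> carrier G \<Longrightarrow> x \<in> S \<Longrightarrow> \<psi> (g \<otimes> k) x = \<psi> g (\<psi> k x)"
  shows "group_action G S (\<lambda>g. restrict (\<psi> g) S)"
proof -
  interpret group G by (rule G)
  have Bij: "restrict (\<psi> g) S \<in> Bij S" if g: "g \<in> carrier G" for g
  proof -
    have "bij_betw (\<psi> g) S S"
    proof (rule bij_betw_byWitness[where f' = "\<psi> (inv g)"])
      show "\<forall>x\<in>S. \<psi> (inv g) (\<psi> g x) = x" "\<forall>x\<in>S. \<psi> g (\<psi> (inv g) x) = x"
        using mult[of "inv g" g] mult[of g "inv g"] one g by simp_all
    qed (use closed g in auto)
    thus ?thesis by (simp add: Bij_def bij_betw_restrict_eq)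
  qed
  have "(\<lambda>g. restrict (\<psi> g) S) \<in> hom G (BijGroup S)"
  proof (rule homI)
    show "restrict (\<psi> g) S \<in> carrier (BijGroup S)" if "g \<in> carrier G" for g
      using Bij[OF that] by (simp add: BijGroup_def)
    show "restrict (\<psi> (g \<otimes> k)) S = restrict (\<psi> g) S \<otimes>\<^bsub>BijGroup S\<^esub> restrict (\<psi> k) S"
      if "g \<in> carrier G" "k \<in> carrier G" for g k
      using Bij[OF that(1)] Bij[OF that(2)] mult[OF that] closed[OF that(2)]
      by (auto simp: BijGroup_def compose_def fun_eq_iff)
  qed
  thus ?thesis
    by (simp add: group_action_def group_hom_def group_hom_axioms_def group_BijGroup G)
qed

section \<open>Action on half-spaces and walls\<close>

locale wall_space_action = pointed_wall_space Y H p
  for Y :: "'a set" and H :: "'a set set" and p :: 'a +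
  fixes G :: "('g, 'm) monoid_scheme" (structure) and \<phi> :: "'g \<Rightarrow> 'a \<Rightarrow> 'a"
  assumes is_group: "group G" and acts: "acts_on_walls G Y H \<phi>"
begin

sublocale G: group G by (rule is_group)

sublocale A: group_action G Y \<phi>
  using acts by (simp add: acts_on_walls_def)

lemma act_half_space: "g \<in> carrier G \<Longrightarrow> h \<in> H \<Longrightarrow> \<phi> g ` h \<in> H"
proof -
  assume "g \<in> carrier G" "h \<in> H"
  moreover from this(1) have "(\<lambda>h. \<phi> g ` h) ` H = H" using acts by (simp add: acts_on_walls_def)
  ultimately show ?thesis by blast
qed

lemma act_one: "h \<subseteq> Y \<Longrightarrow> \<phi> \<one> ` h = h"
proof -
  assume h: "h \<subseteq> Y"
  have "\<phi> \<one> x = x" if "x \<in> h" for x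
    using fun_cong[OF A.id_eq_one, of x] h that by auto
  thus ?thesis by simp
qed

lemma act_mult:
  "g \<in> carrier G \<Longrightarrow> k \<in> carrier G \<Longrightarrow> h \<subseteq> Y \<Longrightarrow> \<phi> (g \<otimes> k) ` h = \<phi> g ` \<phi> k ` h"
  unfolding image_image using A.composition_rule by (intro image_cong) auto

lemma act_inv:
  assumes "g \<in> carrier G" "h \<subseteq> Y"
  shows "\<phi> (inv g) ` \<phi> g ` h = h" "\<phi> g ` \<phi> (inv g) ` h = h"
  using act_mult[of "inv g" g h, symmetric] act_mult[of g "inv g" h, symmetric] act_one[of h] assms
  by (simp_all only: G.l_inv G.r_inv G.inv_closed)

lemma act_compl: "g \<in> carrier G \<Longrightarrow> h \<subseteq> Y \<Longrightarrow> \<phi> g ` (Y - h) = Y - \<phi> g ` h"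
  using inj_on_image_set_diff[OF A.inj_prop, of g Y h] A.surj_prop[of g] by simp

lemma act_disjoint:
  "g \<in> carrier G \<Longrightarrow> h \<subseteq> Y \<Longrightarrow> k \<subseteq> Y \<Longrightarrow> \<phi> g ` h \<inter> \<phi> g ` k = {} \<longleftrightarrow> h \<inter> k = {}"
proof -
  assume "g \<in> carrier G" "h \<subseteq> Y" "k \<subseteq> Y"
  hence "\<phi> g ` h \<inter> \<phi> g ` k = \<phi> g ` (h \<inter> k)"
    by (intro inj_on_image_Int[OF A.inj_prop, symmetric])
  thus ?thesis by (simp only: image_is_empty)
qed

lemma act_mem_iff:
  assumes g: "g \<in> carrier G" and q: "q \<in> Y" and h: "h \<subseteq> Y"
  shows "q \<in> \<phi> g ` h \<longleftrightarrow> \<phi> (inv g) q \<in> h"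
proof
  assume "q \<in> \<phi> g ` h"
  then obtain x where x: "x \<in> h" "q = \<phi> g x" by blast
  have "\<phi> (inv g) q = x" by (rule A.orbit_sym_aux[OF g subsetD[OF h x(1)] x(2)[symmetric]])
  thus "\<phi> (inv g) q \<in> h" using x(1) by simp
next
  assume i: "\<phi> (inv g) q \<in> h"
  have "\<phi> (inv (inv g)) (\<phi> (inv g) q) = q" using A.orbit_sym_aux[of "inv g" q] g q by simp
  thus "q \<in> \<phi> g ` h" using imageI[OF i, of "\<phi> g"] g by simp
qed

abbreviation act_wall :: "'g \<Rightarrow> 'a set set \<Rightarrow> 'a set set" where
  "act_wall g w \<equiv> (\<lambda>h. \<phi> g ` h) ` w"

lemma act_wall_of: "g \<in> carrier G \<Longrightarrow> h \<in> H \<Longrightarrow> act_wall g (wall_of Y h) = wall_of Y (\<phi> g ` h)"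
  using act_compl[OF _ half_space(1)] by (simp add: wall_of_def)

lemma act_wall_in: "g \<in> carrier G \<Longrightarrow> w \<in> walls Y H \<Longrightarrow> act_wall g w \<in> walls Y H"
  using act_wall_of act_half_space by (auto simp: walls_def)

lemma act_wall_subset: "w \<in> walls Y H \<Longrightarrow> h \<in> w \<Longrightarrow> h \<subseteq> Y"
  using wall_elem(1) half_space(1) by blast

lemma act_wall_one:
  assumes "w \<in> walls Y H"
  shows "act_wall \<one> w = w"
proof -
  have "act_wall \<one> w = (\<lambda>h. h) ` w"
    by (rule image_cong[OF refl act_one[OF act_wall_subset[OF assms]]])
  thus ?thesis by simp
qed

lemma act_wall_mult:
  assumes "g \<in> carrier G" "k \<in> carrier G" "w \<in> walls Y H"
  shows "act_wall (g \<otimes> k) w = act_wall g (act_wall k w)"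
  unfolding image_image[of "(`) (\<phi> g)"]
  by (rule image_cong[OF refl act_mult[OF assms(1,2) act_wall_subset[OF assms(3)]]])

lemma act_wall_inv:
  assumes "g \<in> carrier G" "w \<in> walls Y H"
  shows "act_wall (inv g) (act_wall g w) = w" "act_wall g (act_wall (inv g) w) = w"
  using act_wall_mult[of "inv g" g w, symmetric] act_wall_mult[of g "inv g" w, symmetric]
    act_wall_one[of w] assms
  by (simp_all only: G.l_inv G.r_inv G.inv_closed)

section \<open>Action on sections and points\<close>

abbreviation act_section :: "'g \<Rightarrow> ('a set set \<Rightarrow> 'a set) \<Rightarrow> 'a set set \<Rightarrow> 'a set" where
  "act_section \<equiv> section_action G Y H \<phi>"

abbreviation act_point :: "'g \<Rightarrow> 'a xpoint \<Rightarrow> 'a xpoint" where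
  "act_point \<equiv> cplx_action G Y H \<phi>"

lemma act_section_apply:
  "w \<in> walls Y H \<Longrightarrow> act_section g \<sigma> w = \<phi> g ` \<sigma> (act_wall (inv g) w)"
  by (simp add: section_action_def)

lemma act_point_apply: "h \<in> H \<Longrightarrow> act_point g f h = f (\<phi> (inv g) ` h)"
  by (simp add: cplx_action_def)

lemma act_section_admissible:
  assumes g: "g \<in> carrier G" and adm: "admissible Y H \<sigma>"
  shows "admissible Y H (act_section g \<sigma>)"
  unfolding admissible_iff
proof (intro conjI ballI)
  show "act_section g \<sigma> \<in> extensional (walls Y H)" by (simp add: section_action_def)
  have gi: "inv g \<in> carrier G" using g by simp
  note w' = act_wall_in[OF gi]
  show "act_section g \<sigma> w \<in> w" if w: "w \<in> walls Y H" for w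
    unfolding act_section_apply[OF w]
    using imageI[OF admissibleD(1)[OF adm w'[OF w]], of "(`) (\<phi> g)"] act_wall_inv(2)[OF g w] by simp
  show "act_section g \<sigma> w \<inter> act_section g \<sigma> k \<noteq> {}"
    if w: "w \<in> walls Y H" and k: "k \<in> walls Y H" for w k
    unfolding act_section_apply[OF w] act_section_apply[OF k]
    using act_disjoint[OF g half_space(1)[OF admissibleD(2)[OF adm w'[OF w]]]
        half_space(1)[OF admissibleD(2)[OF adm w'[OF k]]]] admissible_meet[OF adm w'[OF w] w'[OF k]]
    by simp
qed

text \<open>A wall on which the translate turns away from \<open>p\<close> comes from one on which
  \<open>\<sigma>\<close> turns away from \<open>\<phi> (inv g) p\<close>. There
  \<open>\<sigma>\<close> also turns away from \<open>p\<close>, or the wall separates the two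
  points; both kinds are finite in number.\<close>

lemma act_section_vertex:
  assumes g: "g \<in> carrier G" and \<sigma>: "\<sigma> \<in> gamma_vertices Y H p"
  shows "act_section g \<sigma> \<in> gamma_vertices Y H p"
proof -
  have adm: "admissible Y H \<sigma>" and fin: "finite {w \<in> walls Y H. p \<notin> \<sigma> w}"
    using \<sigma> by (auto simp: gamma_vertices_iff)
  have gi: "inv g \<in> carrier G" using g by simp
  let ?q = "\<phi> (inv g) p"
  have q: "?q \<in> Y" using A.element_image[OF gi p_in] by blast
  let ?S = "{w \<in> walls Y H. p \<notin> \<sigma> w} \<union> wall_of Y ` {h\<in>H. p \<in> h \<and> ?q \<notin> h}"
  have "{w \<in> walls Y H. p \<notin> act_section g \<sigma> w}
      \<subseteq> act_wall g ` ?S"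
  proof
    fix w assume "w \<in> {w \<in> walls Y H. p \<notin> act_section g \<sigma> w}"
    hence w: "w \<in> walls Y H" "p \<notin> act_section g \<sigma> w" by auto
    let ?k = "act_wall (inv g) w"
    have k: "?k \<in> walls Y H" using act_wall_in[OF gi w(1)] .
    have "?q \<notin> \<sigma> ?k"
      using w(2) act_mem_iff[OF g p_in half_space(1)[OF admissibleD(2)[OF adm k]]]
      by (simp add: act_section_apply[OF w(1)])
    hence "?k \<in> ?S"
      using k admissibleD(2,3)[OF adm k] by blast
    from imageI[OF this, of "act_wall g"]
    show "w \<in> act_wall g ` ?S"
      using act_wall_inv(2)[OF g w(1)] by simp
  qed
  moreover have "finite (act_wall g ` ?S)"
    using fin finite_separating[OF p_in q] by blast
  ultimately have "finite {w \<in> walls Y H. p \<notin> act_section g \<sigma> w}" by (rule finite_subset)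
  thus ?thesis using act_section_admissible[OF g adm] by (simp add: gamma_vertices_iff)
qed

lemma act_section_one:
  assumes adm: "admissible Y H \<sigma>"
  shows "act_section \<one> \<sigma> = \<sigma>"
proof (rule extensionalityI)
  show "\<sigma> \<in> extensional (walls Y H)" using adm by (simp add: admissible_iff)
  show "act_section \<one> \<sigma> w = \<sigma> w" if w: "w \<in> walls Y H" for w
    unfolding act_section_apply[OF w]
    using act_wall_one[OF w] act_one[OF half_space(1)[OF admissibleD(2)[OF adm w]]] by simp
qed (simp add: section_action_def)

lemma act_section_mult:
  assumes g: "g \<in> carrier G" and k: "k \<in> carrier G" and adm: "admissible Y H \<sigma>"
  shows "act_section (g \<otimes> k) \<sigma> = act_section g (act_section k \<sigma>)"
proof (rule extensionalityI)
  fix w assume w: "w \<in> walls Y H"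
  have gi: "inv g \<in> carrier G" and ki: "inv k \<in> carrier G" using g k by auto
  have w1: "act_wall (inv g) w \<in> walls Y H" by (rule act_wall_in[OF gi w])
  have "act_wall (inv (g \<otimes> k)) w = act_wall (inv k) (act_wall (inv g) w)"
    using act_wall_mult[OF ki gi w] g k by (simp add: G.inv_mult_group)
  thus "act_section (g \<otimes> k) \<sigma> w = act_section g (act_section k \<sigma>) w"
    unfolding act_section_apply[OF w] act_section_apply[OF w1]
    using act_mult[OF g k half_space(1)[OF admissibleD(2)[OF adm act_wall_in[OF ki w1]]]] by simp
qed (simp_all add: section_action_def)

lemma act_section_inv:
  assumes g: "g \<in> carrier G" and adm: "admissible Y H \<sigma>"
  shows "act_section g (act_section (inv g) \<sigma>) = \<sigma>"
  using act_section_mult[OF g _ adm, of "inv g"] act_section_one[OF adm] g by simp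

lemma act_weight_fun:
  assumes g: "g \<in> carrier G" and f: "weight_fun Y H f"
  shows "weight_fun Y H (act_point g f)"
  unfolding weight_fun_def
proof (intro conjI ballI)
  fix h assume h: "h \<in> H"
  have gi: "inv g \<in> carrier G" using g by simp
  note F = weight_funD[OF f act_half_space[OF gi h]]
  show "0 \<le> act_point g f h" "act_point g f h \<le> 1" "act_point g f h + act_point g f (Y - h) = 1"
    using F act_compl[OF gi half_space(1)[OF h]] by (simp_all add: act_point_apply h half_space(3))
qed (simp add: cplx_action_def)

text \<open>For finiteness the base point is moved back by \<open>g\<close>, which brings in only
  the half-spaces that separate its image from \<open>p\<close>, as for sections. The remaining
  conditions are invariant.\<close>

lemma act_consistent:
  assumes g: "g \<in> carrier G" and f: "consistent f"
  shows "consistent (act_point g f)"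
  unfolding consistent_def
proof (intro conjI ballI impI)
  have gi: "inv g \<in> carrier G" using g by simp
  note wf = consistentD(1)[OF f]
  show "weight_fun Y H (act_point g f)" by (rule act_weight_fun[OF g wf])
  let ?q = "\<phi> (inv g) p"
  have q: "?q \<in> Y" using A.element_image[OF gi p_in] by blast
  let ?S = "{h\<in>H. p \<notin> h \<and> f h \<noteq> 0} \<union> {h\<in>H. p \<in> h \<and> ?q \<notin> h}"
  have "{h\<in>H. p \<notin> h \<and> act_point g f h \<noteq> 0}
      \<subseteq> (`) (\<phi> g) ` ?S"
  proof
    fix h assume "h \<in> {h\<in>H. p \<notin> h \<and> act_point g f h \<noteq> 0}"
    hence h: "h \<in> H" "p \<notin> h" "f (\<phi> (inv g) ` h) \<noteq> 0" by (auto simp: act_point_apply)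
    have k: "\<phi> (inv g) ` h \<in> H" by (rule act_half_space[OF gi h(1)])
    have "?q \<notin> \<phi> (inv g) ` h"
      using act_mem_iff[OF g p_in half_space(1)[OF k]] act_inv(2)[OF g half_space(1)[OF h(1)]] h(2) by simp
    hence "\<phi> (inv g) ` h \<in> ?S"
      using k h(3) by blast
    from imageI[OF this, of "(`) (\<phi> g)"]
    show "h \<in> (`) (\<phi> g) ` ?S"
      using act_inv(2)[OF g half_space(1)[OF h(1)]] by simp
  qed
  moreover have "finite ((`) (\<phi> g) ` ?S)"
    using consistentD(2)[OF f] finite_separating[OF p_in q] by blast
  ultimately show "finite {h\<in>H. p \<notin> h \<and> act_point g f h \<noteq> 0}" by (rule finite_subset)
  fix h k assume hk: "h \<in> H" "k \<in> H" "0 < act_point g f h" "0 < act_point g f k" "h \<inter> k = {}"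
  have "\<phi> (inv g) ` h \<inter> \<phi> (inv g) ` k = {}"
    using act_disjoint[OF gi half_space(1)[OF hk(1)] half_space(1)[OF hk(2)]] hk(5) by simp
  hence "\<phi> (inv g) ` k = Y - \<phi> (inv g) ` h"
    using consistentD(3)[OF f act_half_space[OF gi hk(1)] act_half_space[OF gi hk(2)]] hk
    by (simp add: act_point_apply)
  also have "\<dots> = \<phi> (inv g) ` (Y - h)" using act_compl[OF gi half_space(1)[OF hk(1)]] by simp
  finally have "\<phi> g ` \<phi> (inv g) ` k = \<phi> g ` \<phi> (inv g) ` (Y - h)" by simp
  thus "k = Y - h"
    using act_inv(2)[OF g half_space(1)[OF hk(2)]] act_inv(2)[OF g half_space(1)[OF half_space(3)[OF hk(1)]]]
    by simp
qed

lemma act_point_one: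
  assumes "weight_fun Y H f"
  shows "act_point \<one> f = f"
proof (rule extensionalityI)
  show "f \<in> extensional H" using assms by (simp add: weight_fun_def)
  show "act_point \<one> f h = f h" if "h \<in> H" for h
    using act_one[OF half_space(1)[OF that]] by (simp add: act_point_apply[OF that])
qed (simp add: cplx_action_def)

lemma act_point_mult:
  assumes g: "g \<in> carrier G" and k: "k \<in> carrier G"
  shows "act_point (g \<otimes> k) f = act_point g (act_point k f)"
proof (rule extensionalityI)
  fix h assume h: "h \<in> H"
  have gi: "inv g \<in> carrier G" and ki: "inv k \<in> carrier G" using g k by auto
  show "act_point (g \<otimes> k) f h = act_point g (act_point k f) h"
    using act_mult[OF ki gi half_space(1)[OF h]] g k
    by (simp add: act_point_apply[OF h] act_point_apply[OF act_half_space[OF gi h]] G.inv_mult_group)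
qed (simp_all add: cplx_action_def)

lemma act_point_inv:
  assumes g: "g \<in> carrier G" and f: "weight_fun Y H f"
  shows "act_point g (act_point (inv g) f) = f" "act_point (inv g) (act_point g f) = f"
  using act_point_mult[of g "inv g" f, symmetric] act_point_mult[of "inv g" g f, symmetric]
    act_point_one[OF f] g
  by (simp_all only: G.l_inv G.r_inv G.inv_closed)

lemma act_mid:
  assumes g: "g \<in> carrier G"
  shows "mid (act_point g f) (act_point g k) = act_point g (mid f k)"
proof (rule extensionalityI)
  show "mid (act_point g f) (act_point g k) h = act_point g (mid f k) h" if "h \<in> H" for h
    using act_half_space[of "inv g" h] g that by (simp add: mid_def act_point_apply)
qed (simp_all add: mid_def cplx_action_def)

lemma act_cube_dist:
  assumes g: "g \<in> carrier G"
  shows "cube_dist H (act_point g f) (act_point g k) = cube_dist H f k"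
proof -
  have gi: "inv g \<in> carrier G" using g by simp
  have "bij_betw ((`) (\<phi> (inv g))) {h\<in>H. act_point g f h \<noteq> act_point g k h} {h\<in>H. f h \<noteq> k h}"
    by (rule bij_betw_byWitness[where f' = "(`) (\<phi> g)"])
      (use act_inv[OF g half_space(1)] act_half_space[OF g] act_half_space[OF gi] in
        \<open>auto simp: act_point_apply\<close>)
  hence "(\<Sum>h\<in>{h\<in>H. f h \<noteq> k h}. (f h - k h)\<^sup>2)
      = (\<Sum>h\<in>{h\<in>H. act_point g f h \<noteq> act_point g k h}. (f (\<phi> (inv g) ` h) - k (\<phi> (inv g) ` h))\<^sup>2)"
    by (rule sum.reindex_bij_betw[symmetric])
  also have "\<dots> = (\<Sum>h\<in>{h\<in>H. act_point g f h \<noteq> act_point g k h}. (act_point g f h - act_point g k h)\<^sup>2)"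
    by (rule sum.cong) (simp_all add: act_point_apply)
  finally have "(\<Sum>h\<in>{h\<in>H. act_point g f h \<noteq> act_point g k h}. (act_point g f h - act_point g k h)\<^sup>2)
      = (\<Sum>h\<in>{h\<in>H. f h \<noteq> k h}. (f h - k h)\<^sup>2)" by (rule sym)
  thus ?thesis by (simp add: cube_dist_def)
qed

lemma act_share_cube:
  assumes g: "g \<in> carrier G" and "share_cube f k"
  shows "share_cube (act_point g f) (act_point g k)"
  using assms(2) unfolding common_cube_iff act_mid[OF g] by (simp add: act_consistent[OF g])

text \<open>\<open>g\<close> and its inverse carry chains to chains of the same length, so both
  infima are taken over the same set.\<close>

lemma act_isometry:
  assumes g: "g \<in> carrier G" and f: "consistent f" "consistent k"
  shows "cplx_dist Y H p (act_point g f) (act_point g k) = cplx_dist Y H p f k"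
proof -
  have gi: "inv g \<in> carrier G" using g by simp
  have to: "chain share_cube (cube_dist H) (act_point a u) (act_point a v) L"
    if a: "a \<in> carrier G" and c: "chain share_cube (cube_dist H) u v L" for a u v L
    by (rule chain_map_exact[OF _ c]) (simp only: act_share_cube[OF a] act_cube_dist[OF a] simp_thms)
  have "chain share_cube (cube_dist H) (act_point g f) (act_point g k) L
      \<longleftrightarrow> chain share_cube (cube_dist H) f k L" for L
    using to[OF g, of f k L] to[OF gi, of "act_point g f" "act_point g k" L]
      act_point_inv(2)[OF g consistentD(1)[OF f(1)]] act_point_inv(2)[OF g consistentD(1)[OF f(2)]]
    by auto
  hence "{L. chain share_cube (cube_dist H) (act_point g f) (act_point g k) L}
      = {L. chain share_cube (cube_dist H) f k L}" by blast
  thus ?thesis using f act_consistent[OF g] by (simp add: cplx_dist_chain)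
qed

lemma act_vertex_point:
  assumes g: "g \<in> carrier G" and adm: "admissible Y H \<sigma>"
  shows "act_point g (vertex_point Y H \<sigma>) = vertex_point Y H (act_section g \<sigma>)"
proof (rule extensionalityI)
  fix h assume h: "h \<in> H"
  have gi: "inv g \<in> carrier G" using g by simp
  have k: "\<phi> (inv g) ` h \<in> H" by (rule act_half_space[OF gi h])
  have s: "\<sigma> (wall_of Y (\<phi> (inv g) ` h)) \<in> H" using admissibleD(2)[OF adm wall_of_in[OF k]] .
  have "act_section g \<sigma> (wall_of Y h) = \<phi> g ` \<sigma> (wall_of Y (\<phi> (inv g) ` h))"
    unfolding act_section_apply[OF wall_of_in[OF h]] act_wall_of[OF gi h] ..
  moreover have "\<phi> g ` \<sigma> (wall_of Y (\<phi> (inv g) ` h)) = h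
      \<longleftrightarrow> \<sigma> (wall_of Y (\<phi> (inv g) ` h)) = \<phi> (inv g) ` h"
    using act_inv[OF g half_space(1)[OF s]] act_inv[OF g half_space(1)[OF h]] by metis
  ultimately show "act_point g (vertex_point Y H \<sigma>) h = vertex_point Y H (act_section g \<sigma>) h"
    using h k by (simp add: act_point_apply vertex_point_def)
qed (simp_all add: cplx_action_def vertex_point_def)

lemma act_corner:
  assumes g: "g \<in> carrier G" and c: "corner Y H p \<sigma> C"
  shows "corner Y H p (act_section g \<sigma>) (act_wall g ` C)"
proof -
  have \<sigma>: "\<sigma> \<in> gamma_vertices Y H p" and C: "finite C" "C \<subseteq> walls Y H" "pairwise_crossing C"
    "\<forall>w\<in>C. gamma_edge Y H \<sigma> (flip Y \<sigma> w)" using c by (auto simp: corner_def)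
  have adm: "admissible Y H \<sigma>" using \<sigma> by (simp add: gamma_vertices_iff)
  have gi: "inv g \<in> carrier G" using g by simp
  have sub: "act_wall g ` C \<subseteq> walls Y H" using act_wall_in[OF g] C(2) by blast
  have "pairwise_crossing (act_wall g ` C)"
    unfolding pairwise_crossing_def crosses_def
  proof (intro ballI impI)
    fix v1 v2 h1 h2 assume v: "v1 \<in> act_wall g ` C" "v2 \<in> act_wall g ` C" "v1 \<noteq> v2" "h1 \<in> v1" "h2 \<in> v2"
    then obtain w1 w2 k1 k2 where w: "w1 \<in> C" "w2 \<in> C" "v1 = act_wall g w1" "v2 = act_wall g w2"
      "k1 \<in> w1" "k2 \<in> w2" "h1 = \<phi> g ` k1" "h2 = \<phi> g ` k2" by blast
    have "w1 \<noteq> w2" using v w by blast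
    hence "k1 \<inter> k2 \<noteq> {}" using C(3) w by (auto simp: pairwise_crossing_def crosses_def)
    moreover have "k1 \<subseteq> Y" "k2 \<subseteq> Y" using act_wall_subset C(2) w by blast+
    ultimately show "h1 \<inter> h2 \<noteq> {}" using act_disjoint[OF g] w by simp
  qed
  moreover have "gamma_edge Y H (act_section g \<sigma>) (flip Y (act_section g \<sigma>) v)"
    if v: "v \<in> act_wall g ` C" for v
  proof -
    obtain w where w: "w \<in> C" "v = act_wall g w" using v by blast
    have wW: "w \<in> walls Y H" using w C(2) by blast
    have vW: "v \<in> walls Y H" using v sub by blast
    have adm': "admissible Y H (flip Y \<sigma> w)" using C(4) w by (simp add: gamma_edge_def)
    have "flip Y (act_section g \<sigma>) v = act_section g (flip Y \<sigma> w)"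
    proof (rule extensionalityI)
      show "flip Y (act_section g \<sigma>) v \<in> extensional (walls Y H)"
        using vW by (auto simp: extensional_def flip_apply section_action_def)
      fix u assume u: "u \<in> walls Y H"
      have uv: "act_wall (inv g) u = w \<longleftrightarrow> u = v"
        using w(2) act_wall_inv[OF g u] act_wall_inv[OF g wW] by metis
      show "flip Y (act_section g \<sigma>) v u = act_section g (flip Y \<sigma> w) u"
        using uv act_compl[OF g half_space(1)[OF admissibleD(2)[OF adm wW]]]
        by (cases "u = v") (simp_all add: flip_apply act_section_apply[OF u] act_section_apply[OF vW])
    qed (simp add: section_action_def)
    thus ?thesis
      unfolding gamma_edge_flip_iff[OF vW]
      using act_section_admissible[OF g adm] act_section_admissible[OF g adm'] by simp
  qed
  ultimately show ?thesis
    using act_section_vertex[OF g \<sigma>] C(1) sub by (simp add: corner_def)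
qed

lemma act_cube_set_subset:
  assumes g: "g \<in> carrier G" and adm: "admissible Y H \<sigma>" and C: "C \<subseteq> walls Y H"
  shows "act_point g ` cube_set Y H \<sigma> C \<subseteq> cube_set Y H (act_section g \<sigma>) (act_wall g ` C)"
proof
  fix f' assume "f' \<in> act_point g ` cube_set Y H \<sigma> C"
  then obtain f where f: "f' = act_point g f" "weight_fun Y H f" "\<And>w. w \<in> walls Y H - C \<Longrightarrow> f (\<sigma> w) = 1"
    by (auto simp: cube_set_def)
  have gi: "inv g \<in> carrier G" using g by simp
  have "f' (act_section g \<sigma> w) = 1" if w: "w \<in> walls Y H - act_wall g ` C" for w
  proof -
    have wW: "w \<in> walls Y H" using w by simp
    have k: "act_wall (inv g) w \<in> walls Y H" by (rule act_wall_in[OF gi wW])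
    have "act_wall (inv g) w \<notin> C"
    proof
      assume "act_wall (inv g) w \<in> C"
      from imageI[OF this, of "act_wall g"] show False using w act_wall_inv(2)[OF g wW] by simp
    qed
    moreover have "f' (act_section g \<sigma> w) = f (\<sigma> (act_wall (inv g) w))"
    proof -
      have "act_section g \<sigma> w \<in> H" by (rule admissibleD(2)[OF act_section_admissible[OF g adm] wW])
      hence "f' (act_section g \<sigma> w) = f (\<phi> (inv g) ` act_section g \<sigma> w)"
        by (simp add: f(1) act_point_apply)
      also have "\<phi> (inv g) ` act_section g \<sigma> w = \<sigma> (act_wall (inv g) w)"
        unfolding act_section_apply[OF wW] by (rule act_inv(1)[OF g half_space(1)[OF admissibleD(2)[OF adm k]]])
      finally show ?thesis .
    qed
    ultimately show ?thesis using f(3) k by simp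
  qed
  thus "f' \<in> cube_set Y H (act_section g \<sigma>) (act_wall g ` C)"
    using act_weight_fun[OF g f(2)] f(1) by (simp add: cube_set_def)
qed

text \<open>Of the two inclusions, the missing one is \<open>act_cube_set_subset\<close> for
  \<open>inv g\<close>, applied to the image cube.\<close>

lemma act_cube:
  assumes g: "g \<in> carrier G" and Q: "Q \<in> cubes Y H p"
  shows "act_point g ` Q \<in> cubes Y H p"
proof -
  obtain \<sigma> C where c: "corner Y H p \<sigma> C" "Q = cube_set Y H \<sigma> C" using Q by (auto simp: cubes_def)
  have adm: "admissible Y H \<sigma>" and C: "C \<subseteq> walls Y H" using c by (auto simp: corner_def gamma_vertices_iff)
  have gi: "inv g \<in> carrier G" using g by simp
  let ?Q' = "cube_set Y H (act_section g \<sigma>) (act_wall g ` C)"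
  have C': "act_wall g ` C \<subseteq> walls Y H" using act_wall_in[OF g] C by blast
  have CC: "act_wall (inv g) ` act_wall g ` C = C"
  proof -
    have "act_wall (inv g) ` act_wall g ` C = (\<lambda>w. w) ` C"
      unfolding image_image[of "act_wall (inv g)"]
      by (rule image_cong[OF refl]) (use act_wall_inv(1)[OF g] C in blast)
    thus ?thesis by simp
  qed
  have "act_section (inv g) (act_section g \<sigma>) = \<sigma>" using act_section_inv[OF gi adm] g by simp
  hence sub: "act_point (inv g) ` ?Q' \<subseteq> Q"
    using act_cube_set_subset[OF gi act_section_admissible[OF g adm] C'] CC c(2) by simp
  have "?Q' \<subseteq> act_point g ` Q"
  proof
    fix f assume f: "f \<in> ?Q'"
    hence "act_point (inv g) f \<in> Q" using sub by blast
    moreover have "act_point g (act_point (inv g) f) = f"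
      using act_point_inv(1)[OF g] f by (simp add: cube_set_def)
    ultimately show "f \<in> act_point g ` Q" by (metis imageI)
  qed
  hence "act_point g ` Q = ?Q'"
    using act_cube_set_subset[OF g adm C] c(2) by blast
  thus ?thesis using act_corner[OF g c(1)] unfolding cubes_def by blast
qed

section \<open>Properness\<close>

lemma base_vertex_consistent: "consistent (vertex_point Y H (point_section Y H p))"
proof -
  let ?v = "vertex_point Y H (point_section Y H p)"
  have v: "?v h = (if p \<in> h then 1 else 0)" if "h \<in> H" for h
    using point_section_eq[OF p_in that] half_space(5)[OF that] that by (simp add: vertex_point_def)
  show ?thesis
    unfolding consistent_def weight_fun_def
  proof (intro conjI ballI impI)
    show "?v \<in> extensional H" by (simp add: vertex_point_def)
    show "?v h + ?v (Y - h) = 1" if "h \<in> H" for h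
      using v[OF that] v[OF half_space(3)[OF that]] p_in by simp
    have none: "{h\<in>H. p \<notin> h \<and> ?v h \<noteq> 0} = {}" using v by auto
    show "finite {h\<in>H. p \<notin> h \<and> ?v h \<noteq> 0}" unfolding none by simp
    show "k = Y - h" if "h \<in> H" "k \<in> H" "0 < ?v h" "0 < ?v k" "h \<inter> k = {}" for h k
      using that v[OF that(1)] v[OF that(2)] by (auto split: if_splits)
  qed (use v in auto)
qed

text \<open>The Euclidean distance of the coordinate vectors of \<open>g v\<close> and \<open>v\<close> is the square root of the
  number of separating walls.\<close>
lemma wall_dist_le_cplx_dist:
  assumes g: "g \<in> carrier G"
  defines "v \<equiv> vertex_point Y H (point_section Y H p)"
  shows "sqrt (real (wall_dist Y H (\<phi> g p) p)) \<le> cplx_dist Y H p (act_point g v) v"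
proof -
  have gi: "inv g \<in> carrier G" using g by simp
  have gp: "\<phi> g p \<in> Y" using A.element_image[OF g p_in] by blast
  have vh: "v h = (if p \<in> h then 1 else 0)" if "h \<in> H" for h
    using point_section_eq[OF p_in that] half_space(5)[OF that] that by (simp add: vertex_point_def v_def)
  have cv: "consistent v" unfolding v_def by (rule base_vertex_consistent)
  have cgv: "consistent (act_point g v)" by (rule act_consistent[OF g cv])
  define D where "D = {h\<in>H. \<phi> g p \<in> h \<and> p \<notin> h}"
  have gv: "act_point g v h = (if \<phi> g p \<in> h then 1 else 0)" if h: "h \<in> H" for h
  proof -
    have "p \<in> \<phi> (inv g) ` h \<longleftrightarrow> \<phi> g p \<in> h"
      using act_mem_iff[OF gi p_in half_space(1)[OF h]] g by simp
    thus ?thesis using vh[OF act_half_space[OF gi h]] by (simp add: act_point_apply[OF h])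
  qed
  have diff: "coords (act_point g v) e - coords v e = (if e \<in> D then 1 else 0)" for e
    using gv[of e] vh[of e] by (simp add: coords_def events_def D_def)
  have "coord_dist (coords (act_point g v)) (coords v) = L2_set (\<lambda>e. coords (act_point g v) e - coords v e) D"
  proof (rule coord_dist_eq)
    show "finite D" unfolding D_def by (rule finite_separating[OF gp p_in])
    show "{e. coords (act_point g v) e \<noteq> coords v e} \<subseteq> D"
    proof
      fix e assume "e \<in> {e. coords (act_point g v) e \<noteq> coords v e}"
      thus "e \<in> D" using diff[of e] by (auto split: if_splits)
    qed
  qed
  also have "\<dots> = sqrt (real (card D))"
    unfolding diff by (simp add: L2_set_def)
  finally have "sqrt (real (card D)) \<le> cplx_dist Y H p (act_point g v) v"
    using ES.len_le_cdist[OF coords_points[OF cgv] coords_points[OF cv]] cplx_dist_eq[OF cgv cv] by simp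
  moreover have "wall_dist Y H (\<phi> g p) p = card D"
  proof -
    have "{w \<in> walls Y H. \<exists>h\<in>w. \<phi> g p \<in> h \<and> p \<notin> h} = wall_of Y ` D"
    proof (intro equalityI subsetI)
      fix w assume "w \<in> {w \<in> walls Y H. \<exists>h\<in>w. \<phi> g p \<in> h \<and> p \<notin> h}"
      then obtain h where h: "w \<in> walls Y H" "h \<in> w" "\<phi> g p \<in> h" "p \<notin> h" by blast
      thus "w \<in> wall_of Y ` D" using wall_elem(1,2)[OF h(1,2)] by (auto simp: D_def)
    next
      fix w assume "w \<in> wall_of Y ` D"
      thus "w \<in> {w \<in> walls Y H. \<exists>h\<in>w. \<phi> g p \<in> h \<and> p \<notin> h}"
        by (auto simp: D_def wall_of_in wall_of_def walls_def)
    qed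
    moreover have "inj_on (wall_of Y) D"
    proof (rule inj_onI)
      fix h k assume "h \<in> D" "k \<in> D" "wall_of Y h = wall_of Y k"
      thus "h = k" using wall_of_eq_iff[of h k] p_in by (auto simp: D_def)
    qed
    ultimately show ?thesis by (simp add: wall_dist_def card_image)
  qed
  ultimately show ?thesis by simp
qed

text \<open>The base vertex is displaced by at least the square root of the wall distance. Since
  \<open>g\<close> acts by isometries, any other point is displaced by at least that minus twice its
  distance to the base vertex.\<close>

lemma act_proper:
  assumes proper: "proper_on_walls G Y H \<phi>"
  shows "proper_on_metric G (cplx Y H p) (cplx_dist Y H p) act_point"
  unfolding proper_on_metric_def
proof (intro ballI allI impI)
  fix f gs assume "f \<in> cplx Y H p" and gs: "(\<forall>n. gs n \<in> carrier G) \<and> leaves_finite G gs"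
  hence f: "consistent f" by (simp add: mem_cplx_iff)
  have g: "gs n \<in> carrier G" for n using gs by simp
  note triangle = Metric_space.triangle[OF Metric_space_cplx]
  define v where "v = vertex_point Y H (point_section Y H p)"
  have v: "consistent v" unfolding v_def by (rule base_vertex_consistent)
  define c where "c = cplx_dist Y H p f v"
  have lower: "sqrt (real (wall_dist Y H (\<phi> (gs n) p) p)) - 2 * c \<le> cplx_dist Y H p (act_point (gs n) f) f" for n
  proof -
    let ?f = "act_point (gs n) f" and ?v = "act_point (gs n) v"
    have mem: "f \<in> cplx Y H p" "v \<in> cplx Y H p" "?f \<in> cplx Y H p" "?v \<in> cplx Y H p"
      using f v act_consistent[OF g] by (auto simp: mem_cplx_iff)
    have "cplx_dist Y H p ?v v \<le> cplx_dist Y H p ?v ?f + (cplx_dist Y H p ?f f + c)"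
      using triangle[OF mem(4,3,2)] triangle[OF mem(3,1,2)] by (simp add: c_def)
    moreover have "cplx_dist Y H p ?v ?f = c"
      using act_isometry[OF g v f] Metric_space.commute[OF Metric_space_cplx, of v f] by (simp add: c_def)
    moreover have "sqrt (real (wall_dist Y H (\<phi> (gs n) p) p)) \<le> cplx_dist Y H p ?v v"
      unfolding v_def by (rule wall_dist_le_cplx_dist[OF g])
    ultimately show ?thesis by linarith
  qed
  have "filterlim (\<lambda>n. wall_dist Y H (\<phi> (gs n) p) p) at_top sequentially"
    using proper p_in gs by (simp add: proper_on_walls_def)
  hence "filterlim (\<lambda>n. sqrt (real (wall_dist Y H (\<phi> (gs n) p) p))) at_top sequentially"
    by (rule filterlim_compose[OF sqrt_at_top filterlim_compose[OF filterlim_real_sequentially]])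
  hence "filterlim (\<lambda>n. - (2 * c) + sqrt (real (wall_dist Y H (\<phi> (gs n) p) p))) at_top sequentially"
    by (rule filterlim_tendsto_add_at_top[OF tendsto_const])
  thus "filterlim (\<lambda>n. cplx_dist Y H p (act_point (gs n) f) f) at_top sequentially"
    by (rule filterlim_at_top_mono) (use lower in \<open>simp add: algebra_simps\<close>)
qed

end

theorem mainTheorem2:
  fixes G :: "('g, 'm) monoid_scheme" and Y :: "'a set" and H :: "'a set set"
    and \<phi> :: "'g \<Rightarrow> 'a \<Rightarrow> 'a" and p :: 'a
  assumes "space_with_walls Y H"
    and "group G"
    and "acts_on_walls G Y H \<phi>"
    and "proper_on_walls G Y H \<phi>"
    and "p \<in> Y"
  shows "CAT0 (cplx Y H p) (cplx_dist Y H p)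
    \<and> (\<forall>g\<in>carrier G. \<forall>\<sigma>\<in>gamma_vertices Y H p.
          section_action G Y H \<phi> g \<sigma> \<in> gamma_vertices Y H p \<and>
          cplx_action G Y H \<phi> g (vertex_point Y H \<sigma>)
            = vertex_point Y H (section_action G Y H \<phi> g \<sigma>))
    \<and> group_action G (gamma_vertices Y H p)
        (\<lambda>g. restrict (section_action G Y H \<phi> g) (gamma_vertices Y H p))
    \<and> group_action G (cplx Y H p)
        (\<lambda>g. restrict (cplx_action G Y H \<phi> g) (cplx Y H p))
    \<and> (\<forall>g\<in>carrier G. \<forall>Q\<in>cubes Y H p. cplx_action G Y H \<phi> g ` Q \<in> cubes Y H p)
    \<and> (\<forall>g\<in>carrier G. \<forall>f\<in>cplx Y H p. \<forall>f'\<in>cplx Y H p.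
          cplx_dist Y H p (cplx_action G Y H \<phi> g f) (cplx_action G Y H \<phi> g f')
            = cplx_dist Y H p f f')
    \<and> proper_on_metric G (cplx Y H p) (cplx_dist Y H p) (cplx_action G Y H \<phi>)
    \<and> (crossing_number Y H \<noteq> \<infinity> \<longrightarrow> cplx_dim Y H p = crossing_number Y H)"
proof -
  interpret wall_space_action Y H p G \<phi>
    by (intro wall_space_action.intro pointed_wall_space.intro wall_space_action_axioms.intro assms)
  have adm: "admissible Y H \<sigma>" if "\<sigma> \<in> gamma_vertices Y H p" for \<sigma>
    using that by (simp add: gamma_vertices_iff)
  show ?thesis
  proof (intro conjI ballI impI)
    show "CAT0 (cplx Y H p) (cplx_dist Y H p)" by (rule CAT0_cplx)
    show "group_action G (gamma_vertices Y H p)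
        (\<lambda>g. restrict (section_action G Y H \<phi> g) (gamma_vertices Y H p))"
      by (rule group_action_restrictI[OF is_group])
        (simp_all add: act_section_vertex act_section_one act_section_mult adm)
    show "group_action G (cplx Y H p) (\<lambda>g. restrict (cplx_action G Y H \<phi> g) (cplx Y H p))"
      by (rule group_action_restrictI[OF is_group])
        (simp_all add: mem_cplx_iff act_consistent act_point_one act_point_mult consistentD(1))
    show "proper_on_metric G (cplx Y H p) (cplx_dist Y H p) (cplx_action G Y H \<phi>)"
      by (rule act_proper[OF assms(4)])
  qed (simp_all add: act_section_vertex act_vertex_point adm act_cube act_isometry mem_cplx_iff cplx_dim_eq)
qed

end
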